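(* Let $p=O(1)$ as $n\to\infty$, $0<\alpha<p$, and $f_0\in\mathcal H^\alpha_p$ with $\|f_0\|_\infty\le F$. Let $L\asymp\log n$, $s\asymp n^{p/(2\alpha+p)}$ (with constants large enough that $\mathcal F(L,\mathbf p,s)$ contains the standard rate-optimal approximating sparse ReLU networks of $f_0$), and $\mathbf p=(p,12pN,\dots,12pN,1)\in\mathbb N^{L+2}$ with $N=C_N\lfloor n^{p/(2\alpha+p)}/\log n\rfloor$ for some $C_N>0$. Under the spike-and-slab prior with fully connected top layer described in the context, there is $\delta>1$ such that with $\epsilon_n=n^{-\alpha/(2\alpha+p)}\log^\delta n$, $$\Pi\big(f\in\mathcal F(L,\mathbf p,s):\|f-f_0\|_L>M_n\epsilon_n\mid\bm Y^{(n)}\big)\to0$$ in $\mathbb P_0^n$-probability as $n\to\infty$, for every sequence $M_n\to\infty$.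
   Context: Data: fixed covariates $\bm x_1,\dots,\bm x_n\in[0,1]^p$ and responses $Y_i=f_0(\bm x_i)+\epsilon_i$, $\epsilon_i$ i.i.d. $N(0,1)$; $\mathbb P_0^n$ is the law of $\bm Y^{(n)}=(Y_1,\dots,Y_n)$ under this model. $\mathcal H^\alpha_p$ denotes the $\alpha$-Hölder smooth functions on $[0,1]^p$. $\|g\|_L^2=\frac1n\sum_{i=1}^n g(\bm x_i)^2$ (empirical $L^2$ norm). ReLU networks: for $L\in\mathbb N$ and $\mathbf p=(p_0,\dots,p_{L+1})$ with $p_0=p$, $p_{L+1}=1$, a network is $f(\bm x)=W_{L+1}\sigma_{b_L}(W_L\sigma_{b_{L-1}}(\cdots\sigma_{b_1}(W_1\bm x)))+b_{L+1}$, with $W_l\in\mathbb R^{p_l\times p_{l-1}}$, $b_l\in\mathbb R^{p_l}$ for $l\le L$, $b_{L+1}\in\mathbb R$, and $\sigma_b(v)=\max(v+b,0)$ componentwise. All parameters are stacked (layers from bottom to top) into $\beta=(\beta_1,\dots,\beta_T)$, $T=\sum_{l=0}^{L}p_{l+1}(p_l+1)$, so the last $p_L+1$ coordinates are the top-layer parameters $(W_{L+1},b_{L+1})$. $\mathcal F(L,\mathbf p,s)$ is the set of such networks with at most $s$ nonzero parameters and $\|f\|_\infty\le F$, for a fixed constant $F>0$. Prior (spike-and-slab with fully connected top layer): a connectivity vector $\gamma\in\{0,1\}^T$ has $\gamma_j=1$ for all $j>T-p_L-1$ and is uniformly distributed over all such vectors with $|\gamma|=s$ (i.e. with exactly $s-p_L-1$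 ones among the first $T-p_L-1$ coordinates; $s>p_L$). Given $\gamma$, independently: $\beta_j=0$ if $\gamma_j=0$; $\beta_j\sim\mathrm{Uniform}[-1,1]$ if $\gamma_j=1$ and $j\le T-p_L-1$; $\beta_j\sim N(0,1)$ if $j>T-p_L-1$. The induced prior on $f$ is restricted to $\mathcal F(L,\mathbf p,s)$; $\Pi(\cdot\mid\bm Y^{(n)})$ is the posterior. *)

theory Defs
  imports "HOL-Probability.Probability"
begin

type_synonym fn = "(nat \<Rightarrow> real) \<Rightarrow> real"

definition cube :: "nat \<Rightarrow> (nat \<Rightarrow> real) set" where
  "cube p = {z. (\<forall>j<p. 0 \<le> z j \<and> z j \<le> 1) \<and> (\<forall>j\<ge>p. z j = 0)}"

definition sup_dist :: "nat \<Rightarrow> (nat \<Rightarrow> real) \<Rightarrow> (nat \<Rightarrow> real) \<Rightarrow> real" where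
  "sup_dist p z w = (MAX j\<in>{..<p}. \<bar>z j - w j\<bar>)"

text \<open>Partial derivative in coordinate j on the cube (one-sided at the boundary).\<close>
definition has_partial :: "nat \<Rightarrow> fn \<Rightarrow> (nat \<Rightarrow> real) \<Rightarrow> real \<Rightarrow> bool" where
  "has_partial j g z D \<longleftrightarrow>
     ((\<lambda>t. g (z(j := z j + t))) has_real_derivative D)
       (at 0 within {t. 0 \<le> z j + t \<and> z j + t \<le> 1})"

definition partial :: "nat \<Rightarrow> fn \<Rightarrow> fn" where
  "partial j g z = (THE D. has_partial j g z D)"

fun pder :: "nat list \<Rightarrow> fn \<Rightarrow> fn" where
  "pder [] g = g"
| "pder (j # js) g = partial j (pder js g)"

definition holder_smooth :: "nat \<Rightarrow> real \<Rightarrow> fn \<Rightarrow> bool" where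
  "holder_smooth p \<alpha> g \<longleftrightarrow>
    (let m = nat (\<lceil>\<alpha>\<rceil> - 1) in
      (\<forall>js. set js \<subseteq> {..<p} \<and> length js < m \<longrightarrow>
           (\<forall>j<p. \<forall>z\<in>cube p. \<exists>D. has_partial j (pder js g) z D))
    \<and> (\<exists>B. \<forall>js. set js \<subseteq> {..<p} \<and> length js \<le> m \<longrightarrow>
           (\<forall>z\<in>cube p. \<bar>pder js g z\<bar> \<le> B))
    \<and> (\<exists>C. \<forall>js. set js \<subseteq> {..<p} \<and> length js = m \<longrightarrow>
           (\<forall>z\<in>cube p. \<forall>w\<in>cube p.
              \<bar>pder js g z - pder js g w\<bar> \<le> C * sup_dist p z w powr (\<alpha> - real m))))"

text \<open>ReLU networks. Widths ps = [p_0,...,p_{L+1}]. Parameters of layer k+1 (k = 0..L)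
  occupy the block starting at layer_off ps k: first W_{k+1} row-major, then b_{k+1}.\<close>
definition layer_off :: "nat list \<Rightarrow> nat \<Rightarrow> nat" where
  "layer_off ps k = (\<Sum>i<k. ps ! Suc i * (ps ! i + 1))"

definition n_params :: "nat list \<Rightarrow> nat \<Rightarrow> nat" where
  "n_params ps L = layer_off ps (Suc L)"

definition wt :: "nat list \<Rightarrow> (nat \<Rightarrow> real) \<Rightarrow> nat \<Rightarrow> nat \<Rightarrow> nat \<Rightarrow> real" where
  "wt ps \<beta> k i j = \<beta> (layer_off ps k + i * ps ! k + j)"

definition bs :: "nat list \<Rightarrow> (nat \<Rightarrow> real) \<Rightarrow> nat \<Rightarrow> nat \<Rightarrow> real" where
  "bs ps \<beta> k i = \<beta> (layer_off ps k + ps ! Suc k * ps ! k + i)"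

fun hidden :: "nat list \<Rightarrow> (nat \<Rightarrow> real) \<Rightarrow> (nat \<Rightarrow> real) \<Rightarrow> nat \<Rightarrow> nat \<Rightarrow> real" where
  "hidden ps \<beta> z 0 = z"
| "hidden ps \<beta> z (Suc k) =
     (\<lambda>i. max ((\<Sum>j<ps ! k. wt ps \<beta> k i j * hidden ps \<beta> z k j) + bs ps \<beta> k i) 0)"

definition relu_net :: "nat \<Rightarrow> nat list \<Rightarrow> (nat \<Rightarrow> real) \<Rightarrow> fn" where
  "relu_net L ps \<beta> z = (\<Sum>j<ps ! L. wt ps \<beta> L 0 j * hidden ps \<beta> z L j) + bs ps \<beta> L 0"

definition nn_class :: "real \<Rightarrow> nat \<Rightarrow> nat \<Rightarrow> nat list \<Rightarrow> nat \<Rightarrow> fn set" where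
  "nn_class F p L ps s = {f. \<exists>\<beta>. f = relu_net L ps \<beta>
       \<and> card {j\<in>{..<n_params ps L}. \<beta> j \<noteq> 0} \<le> s
       \<and> (\<forall>z\<in>cube p. \<bar>f z\<bar> \<le> F)}"

definition arch_widths :: "nat \<Rightarrow> nat \<Rightarrow> nat \<Rightarrow> nat list" where
  "arch_widths p L N = p # replicate L (12 * p * N) @ [1]"

definition top_size :: "nat list \<Rightarrow> nat \<Rightarrow> nat" where
  "top_size ps L = ps ! L + 1"

definition conn_sets :: "nat list \<Rightarrow> nat \<Rightarrow> nat \<Rightarrow> nat set set" where
  "conn_sets ps L s = {S. S \<subseteq> {..< n_params ps L - top_size ps L} \<and> card S = s - top_size ps L}"

definition slab_given :: "nat list \<Rightarrow> nat \<Rightarrow> nat set \<Rightarrow> (nat \<Rightarrow> real) measure" where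
  "slab_given ps L S = PiM {..< n_params ps L} (\<lambda>j.
      if n_params ps L - top_size ps L \<le> j then density lborel std_normal_density
      else if j \<in> S then uniform_measure lborel {-1..1}
      else return lborel 0)"

definition ss_prior :: "nat list \<Rightarrow> nat \<Rightarrow> nat \<Rightarrow> (nat \<Rightarrow> real) measure" where
  "ss_prior ps L s = Giry_Monad.bind (measure_pmf (pmf_of_set (conn_sets ps L s))) (slab_given ps L)"

definition lik :: "nat \<Rightarrow> (nat \<Rightarrow> nat \<Rightarrow> real) \<Rightarrow> (nat \<Rightarrow> real) \<Rightarrow> fn \<Rightarrow> real" where
  "lik n xs Y f = (\<Prod>i<n. std_normal_density (Y i - f (xs i)))"

text \<open>Posterior probability of a set A of functions, for the prior on parameters pushed
  forward by net and restricted (conditioned) to the class Fc (Bayes formula).\<close>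
definition posterior :: "(nat \<Rightarrow> real) measure \<Rightarrow> ((nat \<Rightarrow> real) \<Rightarrow> fn) \<Rightarrow> fn set
     \<Rightarrow> (fn \<Rightarrow> real) \<Rightarrow> fn set \<Rightarrow> real" where
  "posterior prior net Fc L A =
     (\<integral>\<beta>. indicator (A \<inter> Fc) (net \<beta>) * L (net \<beta>) \<partial>prior) /
     (\<integral>\<beta>. indicator Fc (net \<beta>) * L (net \<beta>) \<partial>prior)"

definition emp_norm :: "nat \<Rightarrow> (nat \<Rightarrow> nat \<Rightarrow> real) \<Rightarrow> fn \<Rightarrow> real" where
  "emp_norm n xs g = sqrt ((1 / real n) * (\<Sum>i<n. (g (xs i))\<^sup>2))"

definition data_law :: "fn \<Rightarrow> (nat \<Rightarrow> nat \<Rightarrow> real) \<Rightarrow> nat \<Rightarrow> (nat \<Rightarrow> real) measure" where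
  "data_law f0 xs n = PiM {..<n} (\<lambda>i. density lborel (normal_density (f0 (xs i)) 1))"

end

theory Submission
  imports Defs "HOL-Real_Asymp.Real_Asymp"
begin

text \<open>Approximation: on each cell of a grid with $M^p$ cells, $M$ being $n^{1/(2\alpha+p)}$ up to
  logarithms, $f_0$ is close to its Taylor polynomial. A cell contributes the single unit
  $\max(0, (q + \sum_j I_j - p)/(p+1))$, where $I_j$ indicates that coordinate $j$ lies in the cell and
  $q \in [0,1]$ is the rescaled polynomial, computed with deep approximate multiplication; the sum
  of these units is clipped in the last hidden layer. Since only the empirical norm matters, the
  approximation need only hold at the data points.

  Contraction: the likelihood ratio of $f$ is $\exp(\langle\epsilon, f-f_0\rangle - \|f-f_0\|^2/2)$. Network outputs
  are Lipschitz in the parameters with constant $\exp(O(\log^2 n))$, so a finite set of networks with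
  log-cardinality $O(s \log^2 n)$ represents all sparse networks with parameters up to $n^2$ and, by a
  union bound over Gaussian linear functionals, with high probability the ratio is at most
  $\exp(-c\|f-f_0\|^2)$ for all of them far from $f_0$. Parameters close to those of the approximant have
  prior mass $\exp(-O(s \log^2 n))$, and the ratio is not too small there. All logarithmic losses are
  absorbed by $\delta$.\<close>

subsection \<open>Taylor approximation of Hoelder functions\<close>

text \<open>Two constraints shape the construction. Hidden parameters have the slab Uniform[-1,1],
  so every hidden weight and bias must be at most 1 in modulus: steep ramps come from repeated
  doubling, large thresholds from weighting a computed constant 2^a, and the final rescaling by
  \<open>V\<close> is left to the Gaussian top layer. And the prior is conditioned on a sup norm at
  most F, so the approximant is clipped slightly below F; otherwise a box of parameters around it
  need not lie in the class. The logarithms are counted with X = n^(p/(2\<alpha>+p)) and l = log n.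
  The available width and the always active top layer both have order X/l, and each cell costs O(l)
  parameters. With M about n^(1/(2\<alpha>+p)) / l^2 there are at most X / l^2 cells, which fits
  both budgets for large n whatever the constants. Then n times the squared bias is O(X
  l^(4\<alpha>)), entropy and prior cost are O(X l^2), and E = X l^(4\<alpha>+4) dominates both. As
  E is n times the squared rate, \<delta> = 2\<alpha>+2.\<close>

lemma taylor_holder_1d:
  fixes \<phi> :: "nat \<Rightarrow> real \<Rightarrow> real"
  assumes "\<And>k y. k < m \<Longrightarrow> y \<in> {0..1} \<Longrightarrow> (\<phi> k has_real_derivative \<phi> (Suc k) y) (at y within {0..1})"
    and "\<And>y. y \<in> {0..1} \<Longrightarrow> \<bar>\<phi> m y - \<phi> m c\<bar> \<le> H * \<bar>y - c\<bar> powr b"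
    and "0 < b" "0 \<le> H" "c \<in> {0..1}" "y \<in> {0..1}"
  shows "\<bar>\<phi> 0 y - (\<Sum>k\<le>m. \<phi> k c * (y - c) ^ k / fact k)\<bar> \<le> H * \<bar>y - c\<bar> powr (real m + b)"
  using assms
proof (induction m arbitrary: \<phi> y)
  case 0
  then show ?case by simp
next
  case (Suc m)
  define r where "r = \<bar>y - c\<bar>"
  \<comment> \<open>Within distance \<open>r\<close> of \<open>c\<close> the induction hypothesis
    bounds the derivative of the remainder uniformly. \<open>S\<close> is convex, so the mean value
    inequality gains one factor \<open>r\<close> and leaves \<open>H\<close> unchanged.\<close>
  define S where "S = {0..1} \<inter> {c - r..c + r}"
  define \<psi> where "\<psi> = (\<lambda>t. \<phi> 0 t - (\<Sum>k\<le>Suc m. \<phi> k c * (t - c) ^ k / fact k))"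
  define \<psi>' where "\<psi>' = (\<lambda>t. \<phi> 1 t - (\<Sum>k\<le>m. \<phi> (Suc k) c * (t - c) ^ k / fact k))"
  have psi_alt: "\<psi> = (\<lambda>t. \<phi> 0 t - (\<phi> 0 c + (\<Sum>k\<le>m. \<phi> (Suc k) c * (t - c) ^ Suc k / fact (Suc k))))"
    unfolding \<psi>_def by (subst sum.atMost_Suc_shift) simp
  have IH: "\<bar>\<psi>' t\<bar> \<le> H * \<bar>t - c\<bar> powr (real m + b)" if "t \<in> {0..1}" for t
    using Suc.IH[of "\<lambda>k. \<phi> (Suc k)" t] Suc.prems that unfolding \<psi>'_def by simp
  have der: "(\<psi> has_real_derivative \<psi>' t) (at t within S)" if "t \<in> S" for t
  proof -
    have t: "t \<in> {0..1}" using that S_def by auto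
    have 1: "(\<phi> 0 has_real_derivative \<phi> 1 t) (at t within S)"
      using Suc.prems(1)[of 0 t] t DERIV_subset[of "\<phi> 0" "\<phi> 1 t" t "{0..1}" S] S_def by auto
    have 2: "((\<lambda>t. \<phi> (Suc k) c * (t - c) ^ Suc k / fact (Suc k)) has_real_derivative
        \<phi> (Suc k) c * (t - c) ^ k / fact k) (at t within S)" for k
      by (rule derivative_eq_intros refl | simp)+
    show ?thesis unfolding psi_alt \<psi>'_def
      using DERIV_diff[OF 1 DERIV_add[OF DERIV_const[of "\<phi> 0 c"] DERIV_sum[of "{..m}", OF 2]]] by simp
  qed
  have bnd: "\<bar>\<psi>' t\<bar> \<le> H * r powr (real m + b)" if "t \<in> S" for t
  proof -
    have "\<bar>\<psi>' t\<bar> \<le> H * \<bar>t - c\<bar> powr (real m + b)" using IH that S_def by auto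
    also have "\<dots> \<le> H * r powr (real m + b)"
      using that Suc.prems(3,4) by (intro mult_left_mono powr_mono2) (auto simp: S_def)
    finally show ?thesis .
  qed
  have "norm (\<psi> y - \<psi> c) \<le> H * r powr (real m + b) * norm (y - c)"
    by (rule field_differentiable_bound[of S])
       (use der bnd Suc.prems in \<open>auto simp: S_def r_def intro!: convex_Int\<close>)
  moreover have "\<psi> c = 0" unfolding psi_alt by simp
  moreover have "r powr (real m + b) * r = r powr (real (Suc m) + b)"
    using powr_add[of r "real m + b" 1] by (cases "r = 0") (auto simp: r_def add_ac)
  ultimately show ?case unfolding \<psi>_def r_def by (simp add: mult.assoc)
qed

text \<open>Lists of coordinates replace multi-indices. A monomial then occurs once per ordering,
  which is harmless since coefficients are only bounded, never compared, and the networks can follow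
  the recursion on the list.\<close>

definition monomial_at :: "nat list \<Rightarrow> fn" where
  "monomial_at js z = prod_list (map z js)"

definition index_lists :: "nat \<Rightarrow> nat \<Rightarrow> nat list set" where
  "index_lists p d = {js. set js \<subseteq> {..<p} \<and> length js \<le> d}"

text \<open>The coefficient bound is tracked besides the degree because the networks of all cells
  must share one normalisation. Asking it of every list, also outside the index set, yields
  \<open>D \<ge> 0\<close> for free.\<close>

definition bounded_polys :: "nat \<Rightarrow> nat \<Rightarrow> real \<Rightarrow> fn set" where
  "bounded_polys p d D = {P. \<exists>c. (\<forall>js. \<bar>c js\<bar> \<le> D) \<and>
      P = (\<lambda>z. \<Sum>js\<in>index_lists p d. c js * monomial_at js z)}"

lemma finite_index_lists [simp]: "finite (index_lists p d)"
  unfolding index_lists_def by (rule finite_lists_length_le) simp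

lemma bounded_polys_const: "0 \<le> D \<Longrightarrow> \<bar>a\<bar> \<le> D \<Longrightarrow> (\<lambda>z. a) \<in> bounded_polys p d D"
  unfolding bounded_polys_def
  by (auto intro!: exI[of _ "\<lambda>js. if js = [] then a else 0"] simp: if_distrib[of "\<lambda>t. t * _"]
      sum.delta index_lists_def[symmetric] cong: if_cong)
     (auto simp: index_lists_def monomial_at_def)

lemma bounded_polys_mono:
  assumes "P \<in> bounded_polys p d D" "d \<le> d'" "D \<le> D'"
  shows "P \<in> bounded_polys p d' D'"
proof -
  obtain c where c: "\<forall>js. \<bar>c js\<bar> \<le> D" "P = (\<lambda>z. \<Sum>js\<in>index_lists p d. c js * monomial_at js z)"
    using assms(1) unfolding bounded_polys_def by blast
  have D: "0 \<le> D" using c(1)[rule_format, of "[]"] by simp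
  have "index_lists p d \<subseteq> index_lists p d'" using assms(2) by (auto simp: index_lists_def)
  then have "(\<Sum>js\<in>index_lists p d. c js * monomial_at js z) =
      (\<Sum>js\<in>index_lists p d'. (if js \<in> index_lists p d then c js else 0) * monomial_at js z)" for z
    by (intro sum.mono_neutral_cong_left) auto
  with c D assms(3) show ?thesis unfolding bounded_polys_def
    by (intro CollectI exI[of _ "\<lambda>js. if js \<in> index_lists p d then c js else 0"])
       (auto intro: order_trans)
qed

lemma bounded_polys_add:
  assumes "P \<in> bounded_polys p d D" "Q \<in> bounded_polys p d E"
  shows "(\<lambda>z. P z + Q z) \<in> bounded_polys p d (D + E)"
proof -
  obtain c c' where c: "\<forall>js. \<bar>c js\<bar> \<le> D" "P = (\<lambda>z. \<Sum>js\<in>index_lists p d. c js * monomial_at js z)"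
    "\<forall>js. \<bar>c' js\<bar> \<le> E" "Q = (\<lambda>z. \<Sum>js\<in>index_lists p d. c' js * monomial_at js z)"
    using assms unfolding bounded_polys_def by blast
  have "\<forall>js. \<bar>c js + c' js\<bar> \<le> D + E" using c(1,3) by (meson abs_triangle_ineq add_mono order_trans)
  then show ?thesis unfolding bounded_polys_def
    by (intro CollectI exI[of _ "\<lambda>js. c js + c' js"]) (auto simp: c sum.distrib algebra_simps)
qed

lemma bounded_polys_scale:
  assumes "P \<in> bounded_polys p d D"
  shows "(\<lambda>z. a * P z) \<in> bounded_polys p d (\<bar>a\<bar> * D)"
proof -
  obtain c where c: "\<forall>js. \<bar>c js\<bar> \<le> D" "P = (\<lambda>z. \<Sum>js\<in>index_lists p d. c js * monomial_at js z)"
    using assms unfolding bounded_polys_def by blast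
  then show ?thesis unfolding bounded_polys_def
    by (intro CollectI exI[of _ "\<lambda>js. a * c js"])
       (auto simp: sum_distrib_left abs_mult mult.assoc intro!: mult_left_mono)
qed

lemma bounded_polys_sum:
  assumes "\<And>k. k \<in> A \<Longrightarrow> P k \<in> bounded_polys p d (D k)" "finite A"
  shows "(\<lambda>z. \<Sum>k\<in>A. P k z) \<in> bounded_polys p d (\<Sum>k\<in>A. D k)"
  using assms(2,1)
  by (induction A rule: finite_induct) (auto intro!: bounded_polys_const bounded_polys_add)

lemma bounded_polys_mult_coord:
  assumes "P \<in> bounded_polys p d D" "j < p"
  shows "(\<lambda>z. z j * P z) \<in> bounded_polys p (Suc d) D"
proof -
  obtain c where c: "\<forall>js. \<bar>c js\<bar> \<le> D" "P = (\<lambda>z. \<Sum>js\<in>index_lists p d. c js * monomial_at js z)"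
    using assms unfolding bounded_polys_def by blast
  have D: "0 \<le> D" using c(1)[rule_format, of "[]"] by simp
  define c' where "c' = (\<lambda>js. if js \<noteq> [] \<and> hd js = j then c (tl js) else 0)"
  have "z j * P z = (\<Sum>js\<in>Cons j ` index_lists p d. c' js * monomial_at js z)" for z
    by (subst sum.reindex) (auto simp: c(2) c'_def monomial_at_def sum_distrib_left algebra_simps)
  also have "\<dots> z = (\<Sum>js\<in>index_lists p (Suc d). c' js * monomial_at js z)" for z
  proof (rule sum.mono_neutral_left)
    show "Cons j ` index_lists p d \<subseteq> index_lists p (Suc d)" using assms(2) by (auto simp: index_lists_def)
    show "\<forall>i\<in>index_lists p (Suc d) - Cons j ` index_lists p d. c' i * monomial_at i z = 0"
    proof
      fix i assume i: "i \<in> index_lists p (Suc d) - Cons j ` index_lists p d"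
      then have "\<not> (i \<noteq> [] \<and> hd i = j)"
        by (cases i) (auto simp: index_lists_def)
      then show "c' i * monomial_at i z = 0" by (simp only: c'_def if_False mult_zero_left)
    qed
  qed simp
  finally show ?thesis using c(1) D unfolding bounded_polys_def
    by (intro CollectI exI[of _ c']) (auto simp: c'_def)
qed

lemma bounded_polys_mult_shifted:
  assumes "P \<in> bounded_polys p d D" "j < p" "\<bar>a\<bar> \<le> 1"
  shows "(\<lambda>z. P z * (z j - a)) \<in> bounded_polys p (Suc d) (2 * D)"
proof -
  have D: "0 \<le> D" using assms(1) unfolding bounded_polys_def by (auto dest: order_trans[OF abs_ge_zero])
  have "(\<lambda>z. - a * P z) \<in> bounded_polys p (Suc d) D"
    by (rule bounded_polys_mono[OF bounded_polys_scale[OF assms(1)]])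
       (use assms(3) D in \<open>auto intro: mult_left_le_one_le\<close>)
  from bounded_polys_add[OF bounded_polys_mult_coord[OF assms(1,2)] this]
  show ?thesis by (simp add: algebra_simps)
qed

lemma bounded_polys_mult_power:
  assumes "P \<in> bounded_polys p d D" "j < p" "\<bar>a\<bar> \<le> 1"
  shows "(\<lambda>z. P z * (z j - a) ^ k) \<in> bounded_polys p (d + k) (2 ^ k * D)"
proof (induction k)
  case (Suc k)
  from bounded_polys_mult_shifted[OF this assms(2,3)] show ?case by (simp add: mult_ac)
qed (use assms in simp)

section \<open>Partial derivatives on the cube and Taylor expansion in several variables\<close>

lemma sup_dist_ge: "j < p \<Longrightarrow> \<bar>z j - w j\<bar> \<le> sup_dist p z w"
  unfolding sup_dist_def by (rule Max_ge) auto

lemma sup_dist_nonneg: "p \<ge> 1 \<Longrightarrow> 0 \<le> sup_dist p z w"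
  using sup_dist_ge[of 0 p z w] by linarith

text \<open>Translating the increment into the coordinate itself gives an ordinary derivative within
  [0,1] along a coordinate line, the form that \<open>taylor_holder_1d\<close> takes.\<close>

lemma has_partial_iff:
  assumes "z \<in> cube p" "j < p" "y \<in> {0..1}"
  shows "has_partial j g (z(j := y)) D \<longleftrightarrow> ((\<lambda>t. g (z(j := t))) has_real_derivative D) (at y within {0..1})"
proof -
  have eq: "{t. 0 \<le> y + t \<and> y + t \<le> 1} = (\<lambda>t. t - y) ` {0..1}"
    by (auto simp: image_iff intro!: bexI[of _ "y + _"])
  have "has_partial j g (z(j := y)) D \<longleftrightarrow>
     ((\<lambda>t. g (z(j := y + t))) has_real_derivative D) (at 0 within {t. 0 \<le> y + t \<and> y + t \<le> 1})"
    unfolding has_partial_def by simp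
  also have "\<dots> \<longleftrightarrow> ((\<lambda>t. g (z(j := t))) has_real_derivative D) (at y within {0..1})"
  proof
    assume *: "((\<lambda>t. g (z(j := y + t))) has_real_derivative D) (at 0 within {t. 0 \<le> y + t \<and> y + t \<le> 1})"
    have "((\<lambda>t. g (z(j := y + (t - y)))) has_real_derivative D * 1) (at y within {0..1})"
      by (rule DERIV_image_chain[of "\<lambda>t. g (z(j := y + t))" D "\<lambda>t. t - y" y "{0..1}" 1, unfolded o_def])
         (use * in \<open>auto intro!: derivative_eq_intros simp: eq\<close>)
    then show "((\<lambda>t. g (z(j := t))) has_real_derivative D) (at y within {0..1})" by simp
  next
    assume *: "((\<lambda>t. g (z(j := t))) has_real_derivative D) (at y within {0..1})"
    have im: "(\<lambda>t. y + t) ` {t. 0 \<le> y + t \<and> y + t \<le> 1} = {0..1}"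
      by (auto simp: image_iff intro!: exI[of _ "_ - y"])
    have "((\<lambda>t. g (z(j := y + t))) has_real_derivative D * 1) (at 0 within {t. 0 \<le> y + t \<and> y + t \<le> 1})"
      by (rule DERIV_image_chain[of "\<lambda>t. g (z(j := t))" D "\<lambda>t. y + t" 0 _ 1, unfolded o_def])
         (use * in \<open>auto intro!: derivative_eq_intros simp: im\<close>)
    then show "((\<lambda>t. g (z(j := y + t))) has_real_derivative D) (at 0 within {t. 0 \<le> y + t \<and> y + t \<le> 1})"
      by simp
  qed
  finally show ?thesis .
qed

text \<open>Every point of [0,1] is a limit point of [0,1], so one-sided limits at the boundary are
  unique too. This makes the definite description in \<open>partial\<close> meaningful.\<close>

lemma has_partial_unique:
  assumes "z \<in> cube p" "j < p" "has_partial j g z D" "has_partial j g z E"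
  shows "D = E"
proof -
  have y: "z j \<in> {0..1}" using assms by (auto simp: cube_def)
  have "((\<lambda>t. g (z(j := t))) has_real_derivative D) (at (z j) within {0..1})"
    "((\<lambda>t. g (z(j := t))) has_real_derivative E) (at (z j) within {0..1})"
    using has_partial_iff[OF assms(1,2) y] assms(3,4) by auto
  moreover have "at (z j) within {0..1::real} \<noteq> bot"
    using y by (simp add: trivial_limit_within islimpt_Icc)
  ultimately show ?thesis unfolding has_field_derivative_iff using tendsto_unique by blast
qed

text \<open>The coordinates are expanded one after the other: \<^term>\<open>k\<close> counts those already expanded, the
  others being frozen at the centre. This needs neither total differentiability nor symmetry of
  the mixed partial derivatives.\<close>
lemma taylor_holder_multi:
  fixes f :: fn
  assumes "p \<ge> 1" "0 < b"
    and diff: "\<And>js j z. set js \<subseteq> {..<p} \<Longrightarrow> length js < m \<Longrightarrow> j < p \<Longrightarrow> z \<in> cube p \<Longrightarrow>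
        \<exists>D. has_partial j (pder js f) z D"
    and bound: "\<And>js z. set js \<subseteq> {..<p} \<Longrightarrow> length js \<le> m \<Longrightarrow> z \<in> cube p \<Longrightarrow> \<bar>pder js f z\<bar> \<le> B"
    and hol: "\<And>js z w. set js \<subseteq> {..<p} \<Longrightarrow> length js = m \<Longrightarrow> z \<in> cube p \<Longrightarrow> w \<in> cube p \<Longrightarrow>
        \<bar>pder js f z - pder js f w\<bar> \<le> C * sup_dist p z w powr b"
    and "k \<le> p" "0 \<le> B" "0 \<le> C"
  shows "\<exists>D\<ge>0. \<forall>js. set js \<subseteq> {..<p} \<and> length js \<le> m \<longrightarrow> (\<forall>c\<in>cube p. \<exists>P\<in>bounded_polys p (m - length js) D.
      \<forall>z\<in>cube p. \<bar>pder js f (\<lambda>j. if j < p - k then c j else z j) - P z\<bar>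
        \<le> D * sup_dist p z c powr (real (m - length js) + b))"
  using \<open>k \<le> p\<close>
proof (induction k)
  case 0
  show ?case
  proof (intro exI[of _ B] conjI allI impI ballI)
    fix js c assume js: "set js \<subseteq> {..<p} \<and> length js \<le> m" and c: "c \<in> cube p"
    have "(\<lambda>j. if j < p - 0 then c j else z j) = c" if "z \<in> cube p" for z
      using c that by (auto simp: cube_def)
    then show "\<exists>P\<in>bounded_polys p (m - length js) B. \<forall>z\<in>cube p. \<bar>pder js f (\<lambda>j. if j < p - 0 then c j else z j) - P z\<bar>
        \<le> B * sup_dist p z c powr (real (m - length js) + b)"
      using bound[of js c] js c assms(7)
      by (intro bexI[of _ "\<lambda>_. pder js f c"] bounded_polys_const) auto
  qed (use assms in auto)
next
  case (Suc k)
  then obtain D where D: "D \<ge> 0" and IH: "\<And>js c. set js \<subseteq> {..<p} \<Longrightarrow> length js \<le> m \<Longrightarrow> c \<in> cube p \<Longrightarrow>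
      \<exists>P\<in>bounded_polys p (m - length js) D.
      \<forall>z\<in>cube p. \<bar>pder js f (\<lambda>j. if j < p - k then c j else z j) - P z\<bar>
        \<le> D * sup_dist p z c powr (real (m - length js) + b)" by auto
  define i where "i = p - Suc k"
  have i: "i < p" "p - k = Suc i" using Suc.prems unfolding i_def by auto
  \<comment> \<open>One constant for two purposes: multiplying by the a-th power of
    \<open>z i - c i\<close> costs \<open>2 ^ a\<close> in the coefficients, and the error is
    \<open>C\<close> from the expansion in coordinate \<open>i\<close> plus \<open>D\<close> from
    each replaced coefficient.\<close>
  define E where "E = (\<Sum>a\<le>m. 2 ^ a * D) + C"
  have E: "(\<Sum>a\<le>q. 2 ^ a * D) \<le> E" "C + (\<Sum>a\<le>q. D) \<le> E" if "q \<le> m" for q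
  proof -
    have "(\<Sum>a\<le>q. 2 ^ a * D) \<le> (\<Sum>a\<le>m. 2 ^ a * D)" using that D by (intro sum_mono2) auto
    moreover have "(\<Sum>a\<le>q. D) \<le> (\<Sum>a\<le>q. 2 ^ a * D)" using D by (intro sum_mono) (simp add: mult_le_cancel_right1)
    ultimately show "(\<Sum>a\<le>q. 2 ^ a * D) \<le> E" "C + (\<Sum>a\<le>q. D) \<le> E" using assms(8) unfolding E_def by linarith+
  qed
  show ?case
  proof (intro exI[of _ E] conjI allI impI ballI)
    show "E \<ge> 0" unfolding E_def using D assms(8) by (intro add_nonneg_nonneg sum_nonneg) auto
    fix js c assume js: "set js \<subseteq> {..<p} \<and> length js \<le> m" and c: "c \<in> cube p"
    define q where "q = m - length js"
    \<comment> \<open>\<open>pder\<close> applies the head of the list last, so this differentiates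
      along \<open>js\<close> first and then \<open>a\<close> times in coordinate \<open>i\<close>;
      no exchange of derivatives is needed.\<close>
    define ks where "ks = (\<lambda>a. replicate a i @ js)"
    have ks: "set (ks a) \<subseteq> {..<p}" "length (ks a) = a + length js" for a
      using js i unfolding ks_def by (auto simp: set_replicate_conv_if)
    have "\<forall>a. \<exists>P. a \<le> q \<longrightarrow> P \<in> bounded_polys p (q - a) D \<and> (\<forall>z\<in>cube p.
         \<bar>pder (ks a) f (\<lambda>j. if j < p - k then c j else z j) - P z\<bar>
        \<le> D * sup_dist p z c powr (real (q - a) + b))"
    proof
      fix a show "\<exists>P. a \<le> q \<longrightarrow> P \<in> bounded_polys p (q - a) D \<and> (\<forall>z\<in>cube p.
         \<bar>pder (ks a) f (\<lambda>j. if j < p - k then c j else z j) - P z\<bar>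
        \<le> D * sup_dist p z c powr (real (q - a) + b))"
      proof (cases "a \<le> q")
        case True
        then have "length (ks a) \<le> m" "m - length (ks a) = q - a" using ks[of a] js by (auto simp: q_def)
        then show ?thesis using IH[of "ks a" c] ks[of a] c by metis
      qed auto
    qed
    then obtain P where P: "\<And>a. a \<le> q \<Longrightarrow> P a \<in> bounded_polys p (q - a) D"
      and Pa: "\<And>a z. a \<le> q \<Longrightarrow> z \<in> cube p \<Longrightarrow> \<bar>pder (ks a) f (\<lambda>j. if j < p - k then c j else z j) - P a z\<bar>
        \<le> D * sup_dist p z c powr (real (q - a) + b)" by metis
    have ci: "\<bar>c i\<bar> \<le> 1" "c i \<in> {0..1}" using c i by (auto simp: cube_def)
    \<comment> \<open>The Taylor polynomial in coordinate \<open>i\<close> alone, its coefficients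
      (derivatives at \<open>z i = c i\<close>, still functions of the later coordinates) being
      replaced by their polynomials from the induction hypothesis.\<close>
    define R where "R = (\<lambda>z. \<Sum>a\<le>q. (1 / fact a) * (P a z * (z i - c i) ^ a))"
    have "R \<in> bounded_polys p q (\<Sum>a\<le>q. 2 ^ a * D)" unfolding R_def
    proof (rule bounded_polys_sum)
      fix a assume a: "a \<in> {..q}"
      have "(\<lambda>z. (1 / fact a) * (P a z * (z i - c i) ^ a)) \<in> bounded_polys p (q - a + a) (\<bar>1 / fact a\<bar> * (2 ^ a * D))"
        using a by (intro bounded_polys_scale bounded_polys_mult_power P i ci) auto
      moreover have "\<bar>1 / fact a\<bar> * (2 ^ a * D) \<le> 2 ^ a * D"
        using D by (intro mult_left_le_one_le) (auto simp: fact_ge_1)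
      ultimately show "(\<lambda>z. (1 / fact a) * (P a z * (z i - c i) ^ a)) \<in> bounded_polys p q (2 ^ a * D)"
        using bounded_polys_mono a by fastforce
    qed simp
    then have R: "R \<in> bounded_polys p q E" using bounded_polys_mono E(1)[of q] q_def by fastforce
    have main: "\<bar>pder js f (\<lambda>j. if j < p - Suc k then c j else z j) - R z\<bar>
        \<le> E * sup_dist p z c powr (real q + b)" if z: "z \<in> cube p" for z
    proof -
      define d where "d = sup_dist p z c"
      have d: "0 \<le> d" "\<bar>z i - c i\<bar> \<le> d" unfolding d_def using sup_dist_nonneg sup_dist_ge assms(1) i by auto
      define z' where "z' = (\<lambda>j. if j < p - Suc k then c j else z j)"
      have z': "z' \<in> cube p" "z' i = z i" using z c unfolding z'_def i_def by (auto simp: cube_def)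
      define \<phi> where "\<phi> = (\<lambda>a y. pder (ks a) f (z'(i := y)))"
      have z'y: "z'(i := y) \<in> cube p" if "y \<in> {0..1}" for y using z' that i by (auto simp: cube_def)
      have \<phi>c: "\<phi> a (c i) = pder (ks a) f (\<lambda>j. if j < p - k then c j else z j)" for a
        unfolding \<phi>_def z'_def i(2) using i_def by (intro arg_cong[of _ _ "pder (ks a) f"]) (auto simp: less_Suc_eq)
      have T: "\<bar>\<phi> 0 (z i) - (\<Sum>a\<le>q. \<phi> a (c i) * (z i - c i) ^ a / fact a)\<bar> \<le> C * \<bar>z i - c i\<bar> powr (real q + b)"
      proof (rule taylor_holder_1d[where \<phi> = \<phi>])
        fix a y assume a: "a < q" and y: "y \<in> {0..1::real}"
        obtain D' where D': "has_partial i (pder (ks a) f) (z'(i := y)) D'"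
          using diff[of "ks a" i "z'(i := y)", OF ks(1) _ i(1) z'y[OF y]] ks(2)[of a] a
        unfolding q_def by (metis less_diff_conv)
        have "partial i (pder (ks a) f) (z'(i := y)) = D'"
          unfolding partial_def using D' has_partial_unique[OF z'y[OF y] i(1)] by blast
        moreover have "pder (ks (Suc a)) f = partial i (pder (ks a) f)" by (simp add: ks_def)
        ultimately show "(\<phi> a has_real_derivative \<phi> (Suc a) y) (at y within {0..1})"
          using has_partial_iff[OF z'(1) i(1) y] D' unfolding \<phi>_def by simp
      next
        fix y assume y: "y \<in> {0..1::real}"
        have "\<bar>\<phi> q y - \<phi> q (c i)\<bar> \<le> C * sup_dist p (z'(i := y)) (z'(i := c i)) powr b"
          unfolding \<phi>_def using ks[of q] js by (intro hol z'y y ci) (auto simp: q_def)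
        moreover have "sup_dist p (z'(i := y)) (z'(i := c i)) \<le> \<bar>y - c i\<bar>"
          unfolding sup_dist_def using i by (intro Max.boundedI) auto
        ultimately show "\<bar>\<phi> q y - \<phi> q (c i)\<bar> \<le> C * \<bar>y - c i\<bar> powr b"
          using assms sup_dist_nonneg
          by (meson mult_left_mono order_trans powr_mono2 less_imp_le)
      qed (use assms z i ci in \<open>auto simp: cube_def\<close>)
      have 1: "\<phi> 0 (z i) = pder js f z'" unfolding \<phi>_def ks_def using z' by (simp add: fun_upd_idem)
      have "\<bar>(\<Sum>a\<le>q. \<phi> a (c i) * (z i - c i) ^ a / fact a) - R z\<bar>
          = \<bar>\<Sum>a\<le>q. (\<phi> a (c i) - P a z) * ((z i - c i) ^ a / fact a)\<bar>"
        unfolding R_def by (simp add: sum_subtractf[symmetric] algebra_simps diff_divide_distrib)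
      also have "\<dots> \<le> (\<Sum>a\<le>q. D * d powr (real q + b))"
      proof (intro order_trans[OF sum_abs] sum_mono)
        fix a assume a: "a \<in> {..q}"
        have "\<bar>(z i - c i) ^ a / fact a\<bar> \<le> d ^ a"
        proof -
          have "\<bar>(z i - c i) ^ a / fact a\<bar> = \<bar>z i - c i\<bar> ^ a / fact a" by (simp add: power_abs)
          also have "\<dots> \<le> \<bar>z i - c i\<bar> ^ a" by (simp add: divide_le_eq mult_le_cancel_left1 fact_ge_1)
          also have "\<dots> \<le> d ^ a" using d by (intro power_mono) auto
          finally show ?thesis .
        qed
        moreover have "\<bar>\<phi> a (c i) - P a z\<bar> \<le> D * d powr (real (q - a) + b)"
          using Pa[of a z] a z unfolding \<phi>c d_def by auto
        ultimately have "\<bar>\<phi> a (c i) - P a z\<bar> * \<bar>(z i - c i) ^ a / fact a\<bar> \<le> D * d powr (real (q - a) + b) * d ^ a"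
          using D d by (intro mult_mono) auto
        also have "\<dots> = D * d powr (real q + b)"
        proof (cases "d = 0")
          case False
          then have "d ^ a = d powr real a" using d by (simp add: powr_realpow)
          then show ?thesis using a by (simp add: mult.assoc powr_add[symmetric] of_nat_diff)
        qed (use assms in auto)
        finally show "\<bar>(\<phi> a (c i) - P a z) * ((z i - c i) ^ a / fact a)\<bar> \<le> D * d powr (real q + b)"
          by (simp add: abs_mult)
      qed
      finally have 2: "\<bar>(\<Sum>a\<le>q. \<phi> a (c i) * (z i - c i) ^ a / fact a) - R z\<bar> \<le> (\<Sum>a\<le>q. D) * d powr (real q + b)"
        by simp
      have 3: "C * \<bar>z i - c i\<bar> powr (real q + b) \<le> C * d powr (real q + b)"
        using d assms by (intro mult_left_mono powr_mono2) auto
      have "\<bar>pder js f z' - R z\<bar> \<le> (C + (\<Sum>a\<le>q. D)) * d powr (real q + b)"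
        using T 1 2 3 by (simp only: distrib_right)
      also have "\<dots> \<le> E * d powr (real q + b)" using E(2)[of q] by (intro mult_right_mono) (auto simp: q_def)
      finally show ?thesis unfolding z'_def d_def .
    qed
    show "\<exists>P\<in>bounded_polys p (m - length js) E. \<forall>z\<in>cube p. \<bar>pder js f (\<lambda>j. if j < p - Suc k then c j else z j) - P z\<bar>
        \<le> E * sup_dist p z c powr (real (m - length js) + b)"
      using R main unfolding q_def by blast
  qed
qed

lemma holder_smooth_local_polynomial:
  assumes "p \<ge> 1" "0 < \<alpha>" "holder_smooth p \<alpha> f"
  shows "\<exists>m D. D \<ge> 0 \<and> (\<forall>c\<in>cube p. \<exists>P\<in>bounded_polys p m D. \<forall>z\<in>cube p. \<bar>f z - P z\<bar> \<le> D * sup_dist p z c powr \<alpha>)"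
proof -
  \<comment> \<open>The largest integer strictly below \<alpha>, so that the exponent \<alpha> - m
    is positive for integer \<alpha> as well.\<close>
  define m where "m = nat (\<lceil>\<alpha>\<rceil> - 1)"
  have "\<lceil>\<alpha>\<rceil> \<ge> 1" using assms(2) by linarith
  then have "real m = of_int \<lceil>\<alpha>\<rceil> - 1" unfolding m_def by simp
  then have m: "real m < \<alpha>" by linarith
  obtain B C where *: "\<forall>js. set js \<subseteq> {..<p} \<and> length js < m \<longrightarrow>
           (\<forall>j<p. \<forall>z\<in>cube p. \<exists>D. has_partial j (pder js f) z D)"
    "\<forall>js. set js \<subseteq> {..<p} \<and> length js \<le> m \<longrightarrow> (\<forall>z\<in>cube p. \<bar>pder js f z\<bar> \<le> B)"
    "\<forall>js. set js \<subseteq> {..<p} \<and> length js = m \<longrightarrow> (\<forall>z\<in>cube p. \<forall>w\<in>cube p.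
              \<bar>pder js f z - pder js f w\<bar> \<le> C * sup_dist p z w powr (\<alpha> - real m))"
    using assms(3) unfolding holder_smooth_def Let_def m_def[symmetric] by blast
  \<comment> \<open>With \<open>k = p\<close> all coordinates are expanded and none is frozen; the
    written \<open>p - p\<close> keeps the shape of \<open>taylor_holder_multi\<close>.\<close>
  have "\<exists>D\<ge>0. \<forall>js. set js \<subseteq> {..<p} \<and> length js \<le> m \<longrightarrow> (\<forall>c\<in>cube p. \<exists>P\<in>bounded_polys p (m - length js) D.
      \<forall>z\<in>cube p. \<bar>pder js f (\<lambda>j. if j < p - p then c j else z j) - P z\<bar>
        \<le> D * sup_dist p z c powr (real (m - length js) + (\<alpha> - real m)))"
  proof (rule taylor_holder_multi[where B = "\<bar>B\<bar>" and C = "\<bar>C\<bar>"])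
    fix js z assume "set js \<subseteq> {..<p}" "length js \<le> m" "z \<in> cube p"
    then show "\<bar>pder js f z\<bar> \<le> \<bar>B\<bar>" using *(2) by fastforce
  next
    fix js z w assume "set js \<subseteq> {..<p}" "length js = m" "z \<in> cube p" "w \<in> cube p"
    then have "\<bar>pder js f z - pder js f w\<bar> \<le> C * sup_dist p z w powr (\<alpha> - real m)" using *(3) by blast
    also have "\<dots> \<le> \<bar>C\<bar> * sup_dist p z w powr (\<alpha> - real m)" by (intro mult_right_mono) auto
    finally show "\<bar>pder js f z - pder js f w\<bar> \<le> \<bar>C\<bar> * sup_dist p z w powr (\<alpha> - real m)" .
  qed (use assms m *(1) in auto)
  then obtain D where D: "D \<ge> 0" and "\<forall>js. set js \<subseteq> {..<p} \<and> length js \<le> m \<longrightarrow> (\<forall>c\<in>cube p. \<exists>P\<in>bounded_polys p (m - length js) D.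
      \<forall>z\<in>cube p. \<bar>pder js f (\<lambda>j. if j < p - p then c j else z j) - P z\<bar>
        \<le> D * sup_dist p z c powr (real (m - length js) + (\<alpha> - real m)))" by blast
  from this(2)[rule_format, of "[]"] have "\<forall>c\<in>cube p. \<exists>P\<in>bounded_polys p m D.
      \<forall>z\<in>cube p. \<bar>f z - P z\<bar> \<le> D * sup_dist p z c powr \<alpha>" by simp
  then show ?thesis using D by blast
qed

subsection \<open>Networks as lists of units\<close>

definition affine_comb :: "real list \<Rightarrow> real \<Rightarrow> fn list \<Rightarrow> fn" where
  "affine_comb ws b fs z = sum_list (map2 (\<lambda>w f. w * f z) ws fs) + b"

text \<open>The bound 1 is that of the uniform slab on hidden parameters. \<open>c\<close> is a
  budget for nonzero parameters, the bias included.\<close>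

definition relu_unit :: "fn list \<Rightarrow> nat \<Rightarrow> fn \<Rightarrow> bool" where
  "relu_unit fs c g \<longleftrightarrow> (\<exists>ws b. length ws = length fs \<and> (\<forall>w\<in>set (b # ws). \<bar>w\<bar> \<le> 1) \<and>
     length (filter (\<lambda>w. w \<noteq> 0) (b # ws)) \<le> c \<and> g = (\<lambda>z. max (affine_comb ws b fs z) 0))"

fun relu_layer :: "fn list \<Rightarrow> nat \<Rightarrow> fn list \<Rightarrow> bool" where
  "relu_layer fs c [] = True"
| "relu_layer fs c (g # gs) = (\<exists>a c'. relu_unit fs a g \<and> relu_layer fs c' gs \<and> a + c' \<le> c)"

definition coordinates :: "nat \<Rightarrow> fn list" where
  "coordinates p = map (\<lambda>j z. z j) [0..<p]"

text \<open>Outputs of the last of \<open>d\<close> hidden layers, each of width at most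
  \<open>w\<close>, with at most \<open>c\<close> nonzero parameters in all. Keeping networks as
  lists of functions makes parallel composition an append; indices of a flat parameter vector enter
  only in \<open>relu_layers_params\<close>.\<close>

fun relu_layers :: "nat \<Rightarrow> nat \<Rightarrow> nat \<Rightarrow> nat \<Rightarrow> fn list \<Rightarrow> bool" where
  "relu_layers p w 0 c gs \<longleftrightarrow> gs = coordinates p"
| "relu_layers p w (Suc d) c gs \<longleftrightarrow> length gs \<le> w \<and>
     (\<exists>fs c1 c2. relu_layers p w d c1 fs \<and> relu_layer fs c2 gs \<and> c1 + c2 \<le> c)"

lemma affine_comb_append:
  "length ws = length fs \<Longrightarrow> affine_comb (ws @ ws') b (fs @ fs') z = affine_comb ws b fs z + affine_comb ws' 0 fs' z"
  by (simp add: affine_comb_def)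

lemma affine_comb_zeros: "affine_comb (replicate n 0) b fs z = b"
proof (induction fs arbitrary: n)
  case (Cons f fs)
  then show ?case by (cases n) (auto simp: affine_comb_def)
qed (simp add: affine_comb_def)

lemma affine_comb_Nil [simp]: "affine_comb [] b fs z = b" "affine_comb ws b [] z = b"
  by (auto simp: affine_comb_def)

lemma affine_comb_Cons [simp]: "affine_comb (w # ws) b (f # fs) z = w * f z + affine_comb ws b fs z"
  by (simp add: affine_comb_def)

lemma affine_comb_sum:
  "length ws = length fs \<Longrightarrow> affine_comb ws b fs z = (\<Sum>i<length fs. ws ! i * (fs ! i) z) + b"
  by (simp add: affine_comb_def sum_list_sum_nth atLeast0LessThan)

lemma relu_unit_append1:
  assumes "relu_unit fs c g" shows "relu_unit (fs @ fs') c g"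
proof -
  obtain ws b where *: "length ws = length fs" "\<forall>w\<in>set (b # ws). \<bar>w\<bar> \<le> 1"
    "length (filter (\<lambda>w. w \<noteq> 0) (b # ws)) \<le> c" "g = (\<lambda>z. max (affine_comb ws b fs z) 0)"
    using assms unfolding relu_unit_def by blast
  show ?thesis unfolding relu_unit_def
    by (rule exI[of _ "ws @ replicate (length fs') 0"], rule exI[of _ b])
       (use * in \<open>auto simp: affine_comb_append affine_comb_zeros split: if_splits\<close>)
qed

lemma relu_unit_append2:
  assumes "relu_unit fs' c g" shows "relu_unit (fs @ fs') c g"
proof -
  obtain ws b where *: "length ws = length fs'" "\<forall>w\<in>set (b # ws). \<bar>w\<bar> \<le> 1"
    "length (filter (\<lambda>w. w \<noteq> 0) (b # ws)) \<le> c" "g = (\<lambda>z. max (affine_comb ws b fs' z) 0)"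
    using assms unfolding relu_unit_def by blast
  have "affine_comb (replicate (length fs) 0 @ ws) b (fs @ fs') z = affine_comb ws b fs' z" for z
    using affine_comb_zeros[of "length fs" 0 fs z] by (simp add: affine_comb_def)
  then show ?thesis unfolding relu_unit_def
    by (intro exI[of _ "replicate (length fs) 0 @ ws"] exI[of _ b])
       (use * in \<open>auto split: if_splits\<close>)
qed

lemma relu_layer_mono: "relu_layer fs c gs \<Longrightarrow> c \<le> c' \<Longrightarrow> relu_layer fs c' gs"
  by (cases gs) (auto intro: order_trans)

lemma relu_layer_append1: "relu_layer fs c gs \<Longrightarrow> relu_layer (fs @ fs') c gs"
proof (induction gs arbitrary: c)
  case (Cons g gs)
  then show ?case by simp (blast intro: relu_unit_append1)
qed simp

lemma relu_layer_append2: "relu_layer fs' c gs \<Longrightarrow> relu_layer (fs @ fs') c gs"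
proof (induction gs arbitrary: c)
  case (Cons g gs)
  then show ?case by simp (blast intro: relu_unit_append2)
qed simp

lemma relu_layer_append:
  "relu_layer fs c gs \<Longrightarrow> relu_layer fs c' gs' \<Longrightarrow> relu_layer fs (c + c') (gs @ gs')"
proof (induction gs arbitrary: c)
  case Nil
  then show ?case using relu_layer_mono by fastforce
next
  case (Cons g gs)
  then obtain a b where "relu_unit fs a g" "relu_layer fs b gs" "a + b \<le> c" by auto
  with Cons.IH[of b] Cons.prems(2) show ?case
    by (simp, intro exI[of _ a] exI[of _ "b + c'"]) auto
qed

lemma relu_layers_mono:
  "relu_layers p w d c gs \<Longrightarrow> w \<le> w' \<Longrightarrow> c \<le> c' \<Longrightarrow> relu_layers p w' d c' gs"
proof (induction d arbitrary: c c' gs)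
  case (Suc d)
  then show ?case by (simp, meson order_refl order_trans)
qed simp

text \<open>Two networks side by side: widths and budgets add. The depth must be positive because at
  depth 0 the list is the shared input, which is not duplicated.\<close>

lemma relu_layers_append:
  "relu_layers p w (Suc d) c gs \<Longrightarrow> relu_layers p w' (Suc d) c' gs' \<Longrightarrow>
   relu_layers p (w + w') (Suc d) (c + c') (gs @ gs')"
proof (induction d arbitrary: c c' gs gs')
  case 0
  then obtain a a' where "relu_layer (coordinates p) a gs" "relu_layer (coordinates p) a' gs'" "a \<le> c" "a' \<le> c'"
    by (auto intro: relu_layer_mono)
  then have "relu_layer (coordinates p) (c + c') (gs @ gs')"
    by (intro relu_layer_append) (auto intro: relu_layer_mono)
  moreover have "length gs \<le> w" "length gs' \<le> w'" using 0 by auto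
  ultimately show ?case by (simp only: relu_layers.simps)
      (intro conjI exI[of _ "coordinates p"] exI[of _ "0::nat"] exI[of _ "c + c'"]; simp)
next
  case (Suc d)
  from Suc.prems obtain fs c1 c2 where 1: "relu_layers p w (Suc d) c1 fs" "relu_layer fs c2 gs" "c1 + c2 \<le> c" "length gs \<le> w"
    by (subst (asm) relu_layers.simps(2)) blast
  from Suc.prems obtain fs' c1' c2' where 2: "relu_layers p w' (Suc d) c1' fs'" "relu_layer fs' c2' gs'" "c1' + c2' \<le> c'" "length gs' \<le> w'"
    by (subst (asm) (2) relu_layers.simps(2)) blast
  have "relu_layer (fs @ fs') (c2 + c2') (gs @ gs')"
    using 1 2 by (intro relu_layer_append relu_layer_append1 relu_layer_append2)
  with Suc.IH[OF 1(1) 2(1)] 1 2 show ?case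
    by (subst relu_layers.simps(2)) (intro conjI exI[of _ "fs @ fs'"] exI[of _ "c1 + c1'"] exI[of _ "c2 + c2'"]; simp del: relu_layers.simps)
qed

lemma relu_layers_Suc:
  "relu_layers p w d c fs \<Longrightarrow> relu_layer fs c2 gs \<Longrightarrow> length gs \<le> w \<Longrightarrow> relu_layers p w (Suc d) (c + c2) gs"
  by auto

lemma relu_layers_Nil: "relu_layers p 0 (Suc d) 0 []"
  by (induction d) (auto intro!: exI[of _ "[]"])

lemma relu_layers_concat:
  assumes "\<And>f. f \<in> set fs \<Longrightarrow> relu_layers p w (Suc d) c [f]"
  shows "relu_layers p (length fs * w) (Suc d) (length fs * c) fs"
  using assms
proof (induction fs)
  case Nil
  then show ?case using relu_layers_Nil by simp
next
  case (Cons f fs)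
  have "relu_layers p (w + length fs * w) (Suc d) (c + length fs * c) ([f] @ fs)"
    by (rule relu_layers_append) (use Cons in auto)
  then show ?case by simp
qed

lemma relu_unitI:
  assumes "length ws = length fs" "\<forall>w\<in>set (b # ws). \<bar>w\<bar> \<le> 1" "length fs + 1 \<le> c"
    "g = (\<lambda>z. max (affine_comb ws b fs z) 0)"
  shows "relu_unit fs c g"
proof -
  have "length (filter (\<lambda>w. w \<noteq> 0) (b # ws)) \<le> c"
    using order_trans[OF length_filter_le[of _ "b # ws"]] assms(1,3) by fastforce
  then show ?thesis unfolding relu_unit_def using assms by blast
qed

lemma relu_layer_uniform: "(\<And>g. g \<in> set gs \<Longrightarrow> relu_unit fs a g) \<Longrightarrow> length gs * a \<le> c \<Longrightarrow> relu_layer fs c gs"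
proof (induction gs arbitrary: c)
  case (Cons g gs)
  have "relu_layer fs (length gs * a) gs" by (rule Cons.IH) (use Cons.prems in auto)
  with Cons.prems show ?case by (simp, intro exI[of _ a] exI[of _ "length gs * a"]) auto
qed simp

lemma relu_unit_nonneg: "relu_unit fs c g \<Longrightarrow> 0 \<le> g z"
  by (auto simp: relu_unit_def)

lemma relu_layer_nonneg: "relu_layer fs c gs \<Longrightarrow> g \<in> set gs \<Longrightarrow> 0 \<le> g z"
  by (induction gs arbitrary: c) (auto dest: relu_unit_nonneg)

lemma relu_layers_nonneg: "relu_layers p w (Suc d) c gs \<Longrightarrow> g \<in> set gs \<Longrightarrow> 0 \<le> g z"
  by (auto dest: relu_layer_nonneg)

text \<open>ReLU is the identity on nonnegative values, so one weight 1 per unit carries a layer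
  unchanged.\<close>

lemma relu_layer_carry:
  assumes "\<And>g z. g \<in> set gs \<Longrightarrow> 0 \<le> g z"
  shows "relu_layer gs (length gs) gs"
proof -
  have "relu_layer gs (length hs) hs" if "set hs \<subseteq> set gs" for hs
    using that
  proof (induction hs)
    case (Cons h hs)
    then obtain i where i: "i < length gs" "gs ! i = h" by (auto simp: in_set_conv_nth)
    define us where "us = take i gs" define vs where "vs = drop (Suc i) gs"
    have gs: "gs = us @ [h] @ vs" unfolding us_def vs_def using i id_take_nth_drop by fastforce
    have "relu_unit [h] 1 h" unfolding relu_unit_def
      using assms[of h] Cons.prems by (intro exI[of _ "[1]"] exI[of _ 0]) (auto simp: fun_eq_iff)
    then have "relu_unit gs 1 h" unfolding gs by (intro relu_unit_append1 relu_unit_append2)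
    with Cons show ?case by (simp, intro exI[of _ "1::nat"]) auto
  qed simp
  then show ?thesis by blast
qed

text \<open>Parallel composition needs equal depths; shallower networks are prolonged by carrying
  their outputs, at one parameter per output and layer.\<close>

lemma relu_layers_pad:
  assumes "relu_layers p w (Suc d) c gs"
  shows "relu_layers p w (Suc d + k) (c + k * length gs) gs"
proof (induction k)
  case (Suc k)
  have "\<And>g z. g \<in> set gs \<Longrightarrow> 0 \<le> g z" using relu_layers_nonneg assms by blast
  then have "relu_layers p w (Suc (Suc d + k)) (c + k * length gs + length gs) gs"
    by (intro relu_layers_Suc[OF Suc relu_layer_carry]) (use assms in auto)
  then show ?case by (simp add: algebra_simps del: relu_layers.simps)
qed (use assms in simp)

section \<open>Networks with one output and bounded width\<close>

declare relu_layers.simps(2) [simp del]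

text \<open>\<kappa> is both the width and the average number of nonzero parameters per layer. In
  the applications it depends on \<open>p\<close> and the polynomial degree only, while the depth
  grows with the accuracy.\<close>

definition narrow_net :: "nat \<Rightarrow> nat \<Rightarrow> nat \<Rightarrow> fn \<Rightarrow> bool" where
  "narrow_net p \<kappa> d f \<longleftrightarrow> d \<ge> 1 \<and> relu_layers p \<kappa> d (\<kappa> * d) [f]"

lemma narrow_net_mono: "narrow_net p \<kappa> d f \<Longrightarrow> \<kappa> \<le> \<kappa>' \<Longrightarrow> narrow_net p \<kappa>' d f"
  by (auto simp: narrow_net_def intro: relu_layers_mono)

lemma narrow_net_nonneg: "narrow_net p \<kappa> d f \<Longrightarrow> 0 \<le> f z"
  by (cases d) (auto simp: narrow_net_def simp del: relu_layers.simps intro: relu_layers_nonneg)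

lemma narrow_net_width: "narrow_net p \<kappa> d f \<Longrightarrow> 1 \<le> \<kappa>"
  by (cases d) (auto simp: narrow_net_def relu_layers.simps(2))

lemma narrow_net_pad:
  assumes "narrow_net p \<kappa> d f" "d \<le> d'"
  shows "narrow_net p \<kappa> d' f"
proof -
  obtain e where e: "d = Suc e" using assms by (cases d) (auto simp: narrow_net_def)
  obtain k where k: "d' = Suc e + k" using assms e le_Suc_ex by blast
  have "relu_layers p \<kappa> (Suc e + k) (\<kappa> * d + k * length [f]) [f]"
    by (rule relu_layers_pad) (use assms e in \<open>auto simp: narrow_net_def simp del: relu_layers.simps\<close>)
  moreover have "\<kappa> * d + k * length [f] \<le> \<kappa> * (Suc e + k)"
    using narrow_net_width[OF assms(1)] e by (simp add: add_mult_distrib2)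
  ultimately show ?thesis unfolding narrow_net_def k by (auto intro: relu_layers_mono simp del: relu_layers.simps)
qed

lemma narrow_net_concat:
  assumes "\<And>f. f \<in> set fs \<Longrightarrow> narrow_net p \<kappa> d f" "d \<ge> 1"
  shows "relu_layers p (length fs * \<kappa>) d (length fs * (\<kappa> * d)) fs"
proof -
  obtain e where "d = Suc e" using assms(2) by (cases d) auto
  then show ?thesis using relu_layers_concat[of fs p \<kappa> e "\<kappa> * d"] assms by (auto simp: narrow_net_def simp del: relu_layers.simps)
qed

lemma relu_layers_unit:
  assumes "relu_layers p w d c fs" "length ws = length fs" "\<forall>w\<in>set (b # ws). \<bar>w\<bar> \<le> 1" "1 \<le> w"
  shows "relu_layers p w (Suc d) (c + (length fs + 1)) [\<lambda>z. max (affine_comb ws b fs z) 0]"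
proof -
  have "relu_unit fs (length fs + 1) (\<lambda>z. max (affine_comb ws b fs z) 0)"
    by (rule relu_unitI) (use assms in auto)
  then show ?thesis using assms by (intro relu_layers_Suc) auto
qed

lemma narrow_net_unit:
  assumes "\<And>f. f \<in> set fs \<Longrightarrow> narrow_net p \<kappa> d f" "d \<ge> 1" "length ws = length fs" "\<forall>w\<in>set (b # ws). \<bar>w\<bar> \<le> 1"
    "length fs * \<kappa> + length fs + 1 \<le> \<kappa>'"
  shows "narrow_net p \<kappa>' (Suc d) (\<lambda>z. max (affine_comb ws b fs z) 0)"
proof -
  have "relu_layers p \<kappa>' (Suc d) (length fs * (\<kappa> * d) + (length fs + 1)) [\<lambda>z. max (affine_comb ws b fs z) 0]"
    by (rule relu_layers_unit[OF relu_layers_mono[OF narrow_net_concat]]) (use assms in auto)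
  moreover have "length fs * (\<kappa> * d) + (length fs + 1) \<le> \<kappa>' * Suc d"
  proof -
    have "length fs * (\<kappa> * d) + (length fs + 1) \<le> (length fs * \<kappa> + length fs + 1) * Suc d"
      by (simp add: algebra_simps)
    also have "\<dots> \<le> \<kappa>' * Suc d" using assms(5) by (rule mult_right_mono) simp
    finally show ?thesis .
  qed
  ultimately show ?thesis unfolding narrow_net_def using relu_layers_mono by auto
qed

lemma narrow_net_input:
  assumes "length ws = p" "\<forall>w\<in>set (b # ws). \<bar>w\<bar> \<le> 1" "p + 1 \<le> \<kappa>"
  shows "narrow_net p \<kappa> 1 (\<lambda>z. max (affine_comb ws b (coordinates p) z) 0)"
proof -
  have "relu_layers p \<kappa> (Suc 0) (0 + (length (coordinates p) + 1)) [\<lambda>z. max (affine_comb ws b (coordinates p) z) 0]"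
    by (rule relu_layers_unit) (use assms in \<open>auto simp: coordinates_def\<close>)
  then show ?thesis unfolding narrow_net_def using assms relu_layers_mono
    by (auto simp: coordinates_def simp del: relu_layers.simps)
qed

lemma narrow_net_one: "p + 1 \<le> \<kappa> \<Longrightarrow> narrow_net p \<kappa> 1 (\<lambda>z. 1)"
  using narrow_net_input[of "replicate p 0" p 1 \<kappa>] by (auto simp: affine_comb_zeros)

lemma narrow_net_coordinate:
  assumes "p + 1 \<le> \<kappa>" "j < p" shows "narrow_net p \<kappa> 1 (\<lambda>z. max (z j) 0)"
proof -
  have "affine_comb (map (\<lambda>i. if i = j then 1 else 0) [0..<p]) 0 (coordinates p) z = z j" for z
    using assms(2) by (subst affine_comb_sum) (auto simp: coordinates_def if_distrib[of "\<lambda>t. t * _"] cong: if_cong)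
  then show ?thesis
    using narrow_net_input[of "map (\<lambda>i. if i = j then 1 else 0) [0..<p]" p 0 \<kappa>] assms by auto
qed

lemma relu_layers_hd: "relu_layers p w (Suc d) c (g # gs) \<Longrightarrow> relu_layers p w (Suc d) c [g]"
  unfolding relu_layers.simps(2) by (simp, meson add_leE add_mono le_refl order_trans le0 le_add1)

text \<open>As weights are bounded by 1, doubling is done by adding two copies of the same unit.\<close>
lemma narrow_net_amplify:
  assumes "narrow_net p \<kappa> d f" "\<kappa> + 6 \<le> \<kappa>'"
  shows "narrow_net p \<kappa>' (d + a + 1) (\<lambda>z. 2 ^ a * f z)"
proof -
  have d: "d \<ge> 1" using assms by (simp add: narrow_net_def)
  have nn: "0 \<le> f z" for z using narrow_net_nonneg[OF assms(1)] .
  have pair: "relu_layers p \<kappa>' (d + a + 1) (\<kappa> * d + 6 * (a + 1)) [\<lambda>z. 2 ^ a * f z, \<lambda>z. 2 ^ a * f z]"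
  proof (induction a)
    case 0
    have "relu_unit [f] 2 f" by (rule relu_unitI[of "[1]" _ 0]) (use nn in \<open>auto simp: fun_eq_iff\<close>)
    then have "relu_layer [f] 6 [f, f]" by (intro relu_layer_uniform[where a = 2]) auto
    from relu_layers_Suc[OF _ this, of p \<kappa>' d "\<kappa> * d"] show ?case
      using assms relu_layers_mono[of p \<kappa> d "\<kappa> * d" "[f]" \<kappa>' "\<kappa> * d"] by (auto simp: narrow_net_def simp del: relu_layers.simps)
  next
    case (Suc a)
    define g where "g = (\<lambda>z. 2 ^ a * f z)"
    have "relu_unit [g, g] 3 (\<lambda>z. 2 ^ Suc a * f z)"
      by (rule relu_unitI[of "[1,1]" _ 0]) (use nn in \<open>auto simp: fun_eq_iff g_def\<close>)
    then have "relu_layer [g, g] 6 [\<lambda>z. 2 ^ Suc a * f z, \<lambda>z. 2 ^ Suc a * f z]" by (intro relu_layer_uniform[where a = 3]) auto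
    from relu_layers_Suc[OF Suc[folded g_def] this] show ?case using assms
      by (simp add: algebra_simps del: relu_layers.simps)
  qed
  have "\<kappa> * d + 6 * (a + 1) \<le> \<kappa>' * (d + a + 1)"
    using add_mono[OF mult_le_mono1[of \<kappa> \<kappa>' d] mult_le_mono1[of 6 \<kappa>' "a + 1"]] assms(2) by (simp add: algebra_simps)
  with relu_layers_hd[of p \<kappa>' "d + a"] pair show ?thesis unfolding narrow_net_def
    by (auto intro: relu_layers_mono simp del: relu_layers.simps)
qed

subsection \<open>Approximate multiplication\<close>

text \<open>Writing $t$ for the tent map on $[0,1]$, $y(1-y) = \sum_{i\ge1} 4^{-i} t^i(y)$. The state after $k$ steps
  is $(u,v,a)$ with $u-v = 4^{-(k+1)} t^{k+1}(y)$ and $a$ the partial sum of the first $k$ terms.\<close>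
fun tent_state :: "nat \<Rightarrow> real \<Rightarrow> real \<times> real \<times> real" where
  "tent_state 0 y = (max (y / 2) 0, max (y - 1 / 2) 0, 0)"
| "tent_state (Suc k) y = (case tent_state k y of (u, v, a) \<Rightarrow>
     (max ((u - v) / 2) 0, max (u - v - 2 / 4 ^ (k + 2)) 0, max (u - v + a) 0))"

definition tent_sum :: "nat \<Rightarrow> real \<Rightarrow> real" where
  "tent_sum k y = snd (snd (tent_state k y))"

text \<open>With x = \<open>4 ^ Suc k * (u - v)\<close>, the k+1-fold tent iterate, and g(x) =
  x(1-x), the last summand is (x + g(x)) / \<open>4 ^ Suc k\<close>. The induction step is the
  self-similarity g(x) = (t(x) + g(t(x))) / 4, checked on each branch of the tent map.\<close>

lemma tent_state_invariant:
  assumes "0 \<le> y" "y \<le> 1" "tent_state k y = (u, v, a)"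
  shows "0 \<le> u - v \<and> 4 ^ Suc k * (u - v) \<le> 1 \<and> 0 \<le> a \<and>
    y * (1 - y) = a + (u - v) * (2 - 4 ^ Suc k * (u - v))"
  using assms
proof (induction k arbitrary: u v a)
  case 0
  then have "u = y / 2" "v = max (y - 1 / 2) 0" "a = 0" by auto
  moreover have "y * (1 - y) = (y / 2 - (y - 1 / 2)) * (2 - 4 * (y / 2 - (y - 1 / 2)))"
    "y * (1 - y) = y / 2 * (2 - 4 * (y / 2))" by (simp_all add: field_simps)
  ultimately show ?case using 0(1,2) by (cases "y \<le> 1 / 2") auto
next
  case (Suc k)
  obtain u' v' a' where st: "tent_state k y = (u', v', a')" by (cases "tent_state k y") auto
  define z where "z = u' - v'"
  define q where "q = (4::real) ^ Suc k"
  have q: "q > 0" unfolding q_def by simp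
  have IH: "0 \<le> z" "q * z \<le> 1" "0 \<le> a'" "y * (1 - y) = a' + z * (2 - q * z)"
    using Suc.IH[OF Suc.prems(1,2) st] unfolding z_def q_def by auto
  have uva: "u = z / 2" "v = max (z - 1 / (2 * q)) 0" "a = z + a'"
    using Suc.prems(3) st IH unfolding z_def q_def by (auto simp: max_def field_simps)
  show ?case
  proof (cases "z \<le> 1 / (2 * q)")
    case True
    then have "v = 0" "q * z * 2 \<le> 1" using uva q by (auto simp: field_simps)
    then show ?thesis using IH uva q unfolding q_def[symmetric] power_Suc[of _ "Suc k"]
      by (auto simp: algebra_simps)
  next
    case False
    then have v: "u - v = 1 / (2 * q) - z / 2" using uva by auto
    have 1: "4 * q * (u - v) = 2 - 2 * (q * z)" using q unfolding v by (simp add: field_simps)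
    have "a + (u - v) * (2 - 4 * q * (u - v)) = a' + z * (2 - q * z)"
      unfolding 1 uva(3) v using q by (simp add: field_simps)
    moreover have "0 \<le> u - v" using IH(2) q unfolding v by (simp add: field_simps)
    moreover have "1 \<le> q * z * 2" using False q by (simp add: field_simps)
    ultimately show ?thesis using IH uva 1 unfolding q_def[symmetric] power_Suc[of _ "Suc k"] by auto
  qed
qed

text \<open>The remainder z(2 - qz) in the invariant is nonnegative as qz lies in [0,1], and at most
  1/q by completing the square. So the sum always approximates from below.\<close>

lemma tent_sum_bounds:
  assumes "0 \<le> y" "y \<le> 1"
  shows "tent_sum k y \<le> y * (1 - y)" "y * (1 - y) \<le> tent_sum k y + 1 / 4 ^ k"
proof -
  obtain u v a where st: "tent_state k y = (u, v, a)" by (cases "tent_state k y") auto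
  define z where "z = u - v"
  define q where "q = (4::real) ^ Suc k"
  have *: "0 \<le> z" "q * z \<le> 1" "y * (1 - y) = a + z * (2 - q * z)" "q > 0"
    using tent_state_invariant[OF assms st] unfolding z_def q_def by auto
  have "0 \<le> z * (2 - q * z)" using * by (intro mult_nonneg_nonneg) auto
  then show "tent_sum k y \<le> y * (1 - y)" unfolding tent_sum_def st using * by simp
  have "q * (z * (2 - q * z)) = 1 - (1 - q * z)\<^sup>2" by (simp add: power2_eq_square algebra_simps)
  then have "q * (z * (2 - q * z)) \<le> 1" by simp
  then have "z * (2 - q * z) \<le> 1 / q" using *(4) by (simp add: field_simps)
  also have "\<dots> \<le> 1 / 4 ^ k" unfolding q_def by (intro divide_left_mono) auto
  finally show "y * (1 - y) \<le> tent_sum k y + 1 / 4 ^ k" unfolding tent_sum_def st using * by simp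
qed

lemma narrow_net_tent_sum:
  assumes "narrow_net p \<kappa> d y" "\<kappa> + 12 \<le> \<kappa>'"
  shows "narrow_net p \<kappa>' (d + k + 1) (\<lambda>z. tent_sum k (y z))"
proof -
  define U where "U = (\<lambda>k z. fst (tent_state k (y z)))"
  define V where "V = (\<lambda>k z. fst (snd (tent_state k (y z))))"
  define A where "A = (\<lambda>k z. tent_sum k (y z))"
  have base: "relu_layer [y] 12 [A 0, U 0, V 0]"
  proof -
    have "relu_unit [y] 4 (A 0)" by (rule relu_unitI[of "[0]" _ 0]) (auto simp: A_def tent_sum_def fun_eq_iff)
    moreover have "relu_unit [y] 4 (U 0)" by (rule relu_unitI[of "[1/2]" _ 0]) (auto simp: U_def fun_eq_iff)
    moreover have "relu_unit [y] 4 (V 0)" by (rule relu_unitI[of "[1]" _ "-1/2"]) (auto simp: V_def fun_eq_iff)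
    ultimately show ?thesis by (intro relu_layer_uniform[where a = 4]) auto
  qed
  have step: "relu_layer [A k, U k, V k] 12 [A (Suc k), U (Suc k), V (Suc k)]" for k
  proof -
    have "2 \<le> (4::real) ^ (k + 2)" using one_le_power[of "4::real" k] by (simp del: one_le_power)
    then have p4: "2 / 4 ^ (k + 2) \<le> (1::real)" by (simp add: divide_le_eq del: power_add power_Suc)
    have "relu_unit [A k, U k, V k] 4 (A (Suc k))"
      by (rule relu_unitI[of "[1, 1, -1]" _ 0])
         (auto simp: U_def V_def A_def tent_sum_def fun_eq_iff split: prod.split)
    moreover have "relu_unit [A k, U k, V k] 4 (U (Suc k))"
      by (rule relu_unitI[of "[0, 1/2, -1/2]" _ 0])
         (auto simp: U_def V_def A_def tent_sum_def fun_eq_iff field_simps split: prod.split)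
    moreover have "relu_unit [A k, U k, V k] 4 (V (Suc k))"
      by (rule relu_unitI[of "[0, 1, -1]" _ "- 2 / 4 ^ (k + 2)"])
         (use p4 in \<open>auto simp: U_def V_def A_def tent_sum_def fun_eq_iff split: prod.split\<close>)
    ultimately show ?thesis by (intro relu_layer_uniform[where a = 4]) auto
  qed
  \<comment> \<open>Three units with at most four parameters each give 12 per layer. The accumulator
    stands first because \<open>relu_layers_hd\<close> keeps the head.\<close>
  have "relu_layers p \<kappa>' (d + k + 1) (\<kappa> * d + 12 * (k + 1)) [A k, U k, V k]"
  proof (induction k)
    case 0
    have "relu_layers p \<kappa>' d (\<kappa> * d) [y]" using assms by (auto simp: narrow_net_def intro: relu_layers_mono)
    from relu_layers_Suc[OF this base] show ?case using assms by simp
  next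
    case (Suc k)
    from relu_layers_Suc[OF Suc step] show ?case using assms by (simp add: algebra_simps)
  qed
  then have "relu_layers p \<kappa>' (d + k + 1) (\<kappa> * d + 12 * (k + 1)) [A k]"
    using relu_layers_hd[of p \<kappa>' "d + k"] by simp
  moreover have "\<kappa> * d + 12 * (k + 1) \<le> \<kappa>' * (d + k + 1)"
    using add_mono[OF mult_le_mono1[of \<kappa> \<kappa>' d] mult_le_mono1[of 12 \<kappa>' "k + 1"]] assms(2) by (simp add: algebra_simps)
  ultimately show ?thesis unfolding narrow_net_def A_def using relu_layers_mono by auto
qed

text \<open>Polarization: with $g(y) = y(1-y)$, $ab = g(\frac{a-b+1}2) - g(\frac{a+b}2) + \frac{a+b}2 - \frac14$. The extra
  $4^{-(k+1)}$ keeps the approximate product below the true one, hence in $[0,1]$.\<close>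
definition approx_mult :: "nat \<Rightarrow> real \<Rightarrow> real \<Rightarrow> real" where
  "approx_mult k a b = max (tent_sum (Suc k) (max ((a - b + 1) / 2) 0) - tent_sum (Suc k) (max ((a + b) / 2) 0)
     + max ((a + b) / 2) 0 - (1 / 4 + 1 / 4 ^ Suc k)) 0"

lemma approx_mult_bounds:
  assumes "0 \<le> a" "a \<le> 1" "0 \<le> b" "b \<le> 1"
  shows "0 \<le> approx_mult k a b" "approx_mult k a b \<le> a * b" "a * b \<le> approx_mult k a b + 1 / 4 ^ k"
proof -
  define y1 where "y1 = (a - b + 1) / 2"
  define y2 where "y2 = (a + b) / 2"
  have y: "0 \<le> y1" "y1 \<le> 1" "0 \<le> y2" "y2 \<le> 1" unfolding y1_def y2_def using assms by auto
  have ab: "a * b = y1 * (1 - y1) - y2 * (1 - y2) + y2 - 1 / 4"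
    unfolding y1_def y2_def by (simp add: field_simps)
  have am: "approx_mult k a b = max (tent_sum (Suc k) y1 - tent_sum (Suc k) y2 + y2 - (1 / 4 + 1 / 4 ^ Suc k)) 0"
    unfolding approx_mult_def using y by (simp add: y1_def[symmetric] y2_def[symmetric])
  note b = tent_sum_bounds[OF y(1,2), of "Suc k"] tent_sum_bounds[OF y(3,4), of "Suc k"]
  have ab0: "0 \<le> a * b" using assms by simp
  show "0 \<le> approx_mult k a b" "approx_mult k a b \<le> a * b" using b ab ab0 unfolding am by auto
  \<comment> \<open>One error term comes from the first tent sum and one from the downward shift;
    the second tent sum, being subtracted, errs in the favourable direction here.\<close>
  have "a * b \<le> approx_mult k a b + 2 * (1 / 4 ^ Suc k)" using b ab unfolding am by linarith
  also have "\<dots> \<le> approx_mult k a b + 1 / 4 ^ k" by (simp add: divide_right_mono field_simps)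
  finally show "a * b \<le> approx_mult k a b + 1 / 4 ^ k" .
qed

lemma narrow_net_approx_mult:
  assumes "narrow_net p \<kappa> d f" "narrow_net p \<kappa> d g" "6 * \<kappa> + 50 \<le> \<kappa>'"
  shows "narrow_net p \<kappa>' (d + k + 4) (\<lambda>z. approx_mult k (f z) (g z))"
proof -
  have d: "d \<ge> 1" using assms by (simp add: narrow_net_def)
  define y1 where "y1 = (\<lambda>z. max ((f z - g z + 1) / 2) 0)"
  define y2 where "y2 = (\<lambda>z. max ((f z + g z) / 2) 0)"
  have 1: "narrow_net p (2 * \<kappa> + 3) (Suc d) y1"
    using narrow_net_unit[of "[f, g]" p \<kappa> d "[1/2, -1/2]" "1/2" "2 * \<kappa> + 3"] assms d unfolding y1_def
    by (auto simp: field_simps)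
  have 2: "narrow_net p (2 * \<kappa> + 3) (Suc d) y2"
    using narrow_net_unit[of "[f, g]" p \<kappa> d "[1/2, 1/2]" "0" "2 * \<kappa> + 3"] assms d unfolding y2_def
    by (auto simp: field_simps)
  define e where "e = Suc d + Suc k + 1"
  define T1 where "T1 = (\<lambda>z. tent_sum (Suc k) (y1 z))"
  define T2 where "T2 = (\<lambda>z. tent_sum (Suc k) (y2 z))"
  have t: "narrow_net p (2 * \<kappa> + 15) e T1" "narrow_net p (2 * \<kappa> + 15) e T2"
    unfolding e_def T1_def T2_def by (intro narrow_net_tent_sum[OF 1] narrow_net_tent_sum[OF 2], simp)+
  have t2: "narrow_net p (2 * \<kappa> + 15) e y2"
    by (rule narrow_net_mono[OF narrow_net_pad[OF 2]]) (auto simp: e_def)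
  have p4: "1 / 4 ^ Suc k \<le> (1/4::real)" using one_le_power[of "4::real" k] by (simp add: field_simps)
  have b: "\<bar>- (1 / 4 + 1 / 4 ^ Suc k :: real)\<bar> \<le> 1" 
    using p4 zero_le_power[of "1/4::real" "Suc k"] unfolding power_one_over by linarith
  have "narrow_net p \<kappa>' (Suc e) (\<lambda>z. max (affine_comb [1, -1, 1] (- (1 / 4 + 1 / 4 ^ Suc k)) [T1, T2, y2] z) 0)"
    by (rule narrow_net_unit[where \<kappa> = "2 * \<kappa> + 15"]) (use t t2 assms b in \<open>auto simp: e_def simp del: power_Suc\<close>)
  moreover have "(\<lambda>z. max (affine_comb [1, -1, 1] (- (1 / 4 + 1 / 4 ^ Suc k)) [T1, T2, y2] z) 0) = (\<lambda>z. approx_mult k (f z) (g z))"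
    unfolding approx_mult_def T1_def T2_def y1_def y2_def
    by (intro ext arg_cong2[of _ _ _ _ max]) (simp_all del: power_Suc)
  ultimately show ?thesis by (simp add: e_def numeral_eq_Suc del: power_Suc)
qed

text \<open>\<open>max (z j) 0\<close> is the coordinate as it leaves a first ReLU layer; on the
  cube it equals \<open>z j\<close>.\<close>

fun approx_monomial :: "nat \<Rightarrow> nat list \<Rightarrow> fn" where
  "approx_monomial k [] z = 1"
| "approx_monomial k (j # js) z = approx_mult k (max (z j) 0) (approx_monomial k js z)"

lemma approx_monomial_bounds:
  assumes "z \<in> cube p" "set js \<subseteq> {..<p}"
  \<comment> \<open>As approximate products stay in [0,1], each further multiplication has
    admissible arguments. A factor \<open>z j \<le> 1\<close> does not amplify the earlier error, so
    errors just add up, one \<open>1 / 4 ^ k\<close> per factor.\<close>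
  shows "0 \<le> approx_monomial k js z" "approx_monomial k js z \<le> 1"
    "\<bar>approx_monomial k js z - monomial_at js z\<bar> \<le> real (length js) / 4 ^ k"
proof -
  have "0 \<le> approx_monomial k js z \<and> approx_monomial k js z \<le> 1 \<and>
    \<bar>approx_monomial k js z - monomial_at js z\<bar> \<le> real (length js) / 4 ^ k"
    using assms(2)
  proof (induction js)
    case Nil
    then show ?case by (simp add: monomial_at_def)
  next
    case (Cons j js)
    define m where "m = approx_monomial k js z"
    have z: "0 \<le> z j" "z j \<le> 1" using assms(1) Cons.prems by (auto simp: cube_def)
    have m: "0 \<le> m" "m \<le> 1" "\<bar>m - monomial_at js z\<bar> \<le> real (length js) / 4 ^ k" using Cons unfolding m_def by auto
    note b = approx_mult_bounds[OF z m(1,2), of k]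
    have "z j * m \<le> 1" using z m by (simp add: mult_le_one)
    moreover have "\<bar>z j * m - z j * monomial_at js z\<bar> \<le> real (length js) / 4 ^ k"
    proof -
      have "\<bar>z j * m - z j * monomial_at js z\<bar> = z j * \<bar>m - monomial_at js z\<bar>"
        using z by (simp add: right_diff_distrib[symmetric] abs_mult)
      also have "\<dots> \<le> \<bar>m - monomial_at js z\<bar>" using z by (intro mult_left_le_one_le) auto
      finally show ?thesis using m by linarith
    qed
    moreover have "monomial_at (j # js) z = z j * monomial_at js z" by (simp add: monomial_at_def)
    moreover have "approx_monomial k (j # js) z = approx_mult k (z j) m" using z by (simp add: m_def)
    ultimately show ?case using b by (simp add: add_divide_distrib)
  qed
  then show "0 \<le> approx_monomial k js z" "approx_monomial k js z \<le> 1"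
    "\<bar>approx_monomial k js z - monomial_at js z\<bar> \<le> real (length js) / 4 ^ k" by auto
qed

text \<open>The order of quantifiers is the point: \<kappa> is fixed before the accuracy
  \<open>k\<close>, which affects only the depth.\<close>

lemma narrow_net_approx_monomial:
  "\<exists>\<kappa>. \<forall>k js. set js \<subseteq> {..<p} \<and> length js \<le> m \<longrightarrow> narrow_net p \<kappa> (1 + m * (k + 4)) (approx_monomial k js)"
proof (induction m)
  case 0
  have "approx_monomial k [] = (\<lambda>z. 1)" for k by auto
  then show ?case using narrow_net_one[of p "p + 1"] by (intro exI[of _ "p + 1"]) auto
next
  case (Suc m)
  then obtain \<kappa> where \<kappa>: "\<And>k js. set js \<subseteq> {..<p} \<Longrightarrow> length js \<le> m \<Longrightarrow>
    narrow_net p \<kappa> (1 + m * (k + 4)) (approx_monomial k js)" by blast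
  define \<kappa>' where "\<kappa>' = 6 * (\<kappa> + p + 1) + 50"
  have "narrow_net p \<kappa>' (1 + Suc m * (k + 4)) (approx_monomial k js)" if js: "set js \<subseteq> {..<p}" "length js \<le> Suc m" for k js
  proof (cases "length js \<le> m")
    case True
    show ?thesis
      by (rule narrow_net_mono[OF narrow_net_pad[OF \<kappa>[OF js(1) True]]]) (auto simp: \<kappa>'_def)
  next
    case False
    then obtain j ks where jk: "js = j # ks" using js by (cases js) auto
    have "narrow_net p (\<kappa> + p + 1) (1 + m * (k + 4)) (\<lambda>z. max (z j) 0)"
      by (rule narrow_net_pad[OF narrow_net_coordinate]) (use js jk in auto)
    moreover have "narrow_net p (\<kappa> + p + 1) (1 + m * (k + 4)) (approx_monomial k ks)"
      by (rule narrow_net_mono[OF \<kappa>]) (use js jk in auto)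
    ultimately have "narrow_net p \<kappa>' (1 + m * (k + 4) + k + 4) (\<lambda>z. approx_mult k (max (z j) 0) (approx_monomial k ks z))"
      by (rule narrow_net_approx_mult) (simp add: \<kappa>'_def)
    moreover have "(\<lambda>z. approx_mult k (max (z j) 0) (approx_monomial k ks z)) = approx_monomial k js"
      using jk by auto
    ultimately show ?thesis by (simp add: algebra_simps)
  qed
  then show ?case by blast
qed

subsection \<open>Localization\<close>

text \<open>A continuous stand-in for the indicator of y > t, exact outside an interval of length
  2^-a to the right of \<open>t\<close>; the difference of two ramps then stands for the indicator
  of a grid interval.\<close>

definition ramp :: "nat \<Rightarrow> real \<Rightarrow> real \<Rightarrow> real" where
  "ramp a t y = max (2 ^ a * y - 2 ^ a * t) 0 - max (2 ^ a * y - 2 ^ a * t - 1) 0"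

definition window :: "nat \<Rightarrow> real \<Rightarrow> real \<Rightarrow> real \<Rightarrow> real" where
  "window a t t' y = max (ramp a t y - ramp a t' y) 0"

lemma ramp_simps:
  "y \<le> t \<Longrightarrow> ramp a t y = 0" "t + 1 / 2 ^ a \<le> y \<Longrightarrow> ramp a t y = 1"
proof -
  assume "y \<le> t"
  then have "2 ^ a * y - 2 ^ a * t \<le> 0" by simp
  then show "ramp a t y = 0" unfolding ramp_def by linarith
next
  assume "t + 1 / 2 ^ a \<le> y"
  then have "2 ^ a * (t + 1 / 2 ^ a) \<le> 2 ^ a * y" by (intro mult_left_mono) auto
  then show "ramp a t y = 1" by (simp add: ramp_def algebra_simps)
qed

lemma narrow_net_window:
  assumes "j < p" "\<bar>t\<bar> \<le> 1" "\<bar>t'\<bar> \<le> 1"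
  shows "narrow_net p (16 * p + 200) (a + 4) (\<lambda>z. window a t t' (max (z j) 0))"
proof -
  define y where "y = (\<lambda>z. 2 ^ a * max (z j) (0::real))"
  \<comment> \<open>A threshold \<open>2 ^ a * t\<close> is too large for a bias, so the constant
    \<open>2 ^ a\<close> is itself computed by doubling and enters with weight
    \<open>- t\<close>.\<close>
  define c where "c = (\<lambda>z::nat \<Rightarrow> real. 2 ^ a * (1::real))"
  have y: "narrow_net p (p + 7) (a + 2) y" unfolding y_def
    using narrow_net_amplify[OF narrow_net_coordinate[of p "p + 1" j], of "p + 7" a] assms by simp
  have c: "narrow_net p (p + 7) (a + 2) c" unfolding c_def
    using narrow_net_amplify[OF narrow_net_one[of p "p + 1"], of "p + 7" a] by simp
  define u where "u = (\<lambda>s b z. max (affine_comb [1, - s] b [y, c] z) 0)"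
  have u: "narrow_net p (2 * p + 17) (Suc (a + 2)) (u s b)" if "\<bar>s\<bar> \<le> 1" "\<bar>b\<bar> \<le> 1" for s b
    unfolding u_def by (rule narrow_net_unit[where \<kappa> = "p + 7"]) (use y c that in auto)
  have "narrow_net p (16 * p + 200) (Suc (Suc (a + 2))) (\<lambda>z. max (affine_comb [1, -1, -1, 1] 0 [u t 0, u t (-1), u t' 0, u t' (-1)] z) 0)"
    by (rule narrow_net_unit[where \<kappa> = "2 * p + 17"]) (use u assms in auto)
  moreover have "(\<lambda>z. max (affine_comb [1, -1, -1, 1] 0 [u t 0, u t (-1), u t' 0, u t' (-1)] z) 0) = (\<lambda>z. window a t t' (max (z j) 0))"
    by (simp add: fun_eq_iff window_def ramp_def u_def y_def c_def algebra_simps)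
  ultimately show ?thesis by (simp add: numeral_eq_Suc)
qed

subsection \<open>Approximation by sparse networks\<close>

text \<open>Pigeonhole: n + 1 disjoint open intervals of length \<open>h\<close> cannot all contain
  one of n points.\<close>

lemma avoid_points:
  fixes x :: "nat \<Rightarrow> real"
  assumes "h > 0"
  shows "\<exists>c\<le>n. \<forall>i<n. x i \<le> c0 + real c * h \<or> c0 + (real c + 1) * h \<le> x i"
proof (rule ccontr)
  assume "\<not> ?thesis"
  then have "\<forall>c. \<exists>i. c \<le> n \<longrightarrow> i < n \<and> c0 + real c * h < x i \<and> x i < c0 + (real c + 1) * h"
    by (meson not_le)
  then obtain i where i: "\<And>c. c \<le> n \<Longrightarrow> i c < n \<and> c0 + real c * h < x (i c) \<and> x (i c) < c0 + (real c + 1) * h"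
    by metis
  have "inj_on i {..n}"
  proof (rule linorder_inj_onI)
    fix c c' assume c: "c < c'" "c \<in> {..n}" "c' \<in> {..n}"
    have "(real c + 1) * h \<le> real c' * h" using c assms by (intro mult_right_mono) auto
    then show "i c \<noteq> i c'" using i[of c] i[of c'] c by fastforce
  qed auto
  then have "card {..n} \<le> card {..<n}" using i by (intro card_inj_on_le[of i]) auto
  then show False by simp
qed

text \<open>Only the values at the data points matter, so the thresholds are shifted off the grid such
  that no data point falls on a ramp; cell indicators are then exact there.\<close>
lemma thresholds_exist:
  fixes y :: "nat \<Rightarrow> real"
  assumes "M \<ge> 1" "(n + 1) * M \<le> 2 ^ a" "\<And>i. i < n \<Longrightarrow> 0 \<le> y i \<and> y i \<le> 1"
  shows "\<exists>t. (\<forall>l\<le>M. \<bar>t l\<bar> \<le> 1) \<and> (\<forall>i<n. \<exists>l<M. \<bar>y i - real l / real M\<bar> \<le> 2 / real M \<and>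
     (\<forall>l'\<le>M. ramp a (t l') (y i) = (if l' \<le> l then 1 else 0)))"
proof -
  define h where "h = 1 / (2::real) ^ a"
  have h: "h > 0" unfolding h_def by simp
  have "real ((n + 1) * M) \<le> 2 ^ a" using assms(2) of_nat_mono by fastforce
  \<comment> \<open>All n + 1 candidate positions of a ramp fit inside one grid interval.\<close>
  then have nh: "(real n + 1) * h \<le> 1 / real M" using assms(1) unfolding h_def by (simp add: field_simps)
  have h1: "h \<le> 1" unfolding h_def by simp
  have "\<forall>l. \<exists>c\<le>n. \<forall>i<n. y i \<le> real l / real M + real c * h \<or> real l / real M + (real c + 1) * h \<le> y i"
    using avoid_points[OF h] by blast
  then obtain c where c: "\<And>l. c l \<le> n" "\<And>l i. i < n \<Longrightarrow>
     y i \<le> real l / real M + real (c l) * h \<or> real l / real M + (real (c l) + 1) * h \<le> y i" by metis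
  \<comment> \<open>The outer thresholds need no search: every data coordinate lies to the right of
    the ramp starting at \<open>- h\<close> and to the left of the one starting at 1.\<close>
  define t where "t = (\<lambda>l. if l = 0 then - h else if l = M then 1 else real l / real M + real (c l) * h)"
  have cb: "0 \<le> real (c l) * h" "(real (c l) + 1) * h \<le> 1 / real M" for l
  proof -
    have "(real (c l) + 1) * h \<le> (real n + 1) * h" using c(1)[of l] h by (intro mult_right_mono) auto
    then show "(real (c l) + 1) * h \<le> 1 / real M" using nh by linarith
  qed (use h in auto)
  have up: "t l + h \<le> (real l + 1) / real M" if "l < M" for l
    using cb[of l] that h by (auto simp: t_def add_divide_distrib algebra_simps)
  have low: "real l / real M \<le> t l" if "0 < l" "l \<le> M" for l
    using cb[of l] that by (auto simp: t_def)
  have avoid: "y i \<le> t l \<or> t l + h \<le> y i" if "l \<le> M" "i < n" for l i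
    using c(2)[OF that(2), of l] assms(3)[OF that(2)] h by (auto simp: t_def algebra_simps)
  have mono: "t l' \<le> t l" if "l' \<le> l" "l \<le> M" for l' l
  proof (cases "l' = l")
    case False
    then have l: "l' < l" using that by auto
    have "t l' + h \<le> (real l' + 1) / real M" using up l that by auto
    also have "\<dots> \<le> real l / real M" using l by (intro divide_right_mono) auto
    also have "\<dots> \<le> t l" using low l that by auto
    finally show ?thesis using h by simp
  qed simp
  show ?thesis
  proof (intro exI[of _ t] conjI allI impI)
    fix l assume l: "l \<le> M"
    have "t l \<le> t M" "t 0 \<le> t l" using mono l by auto
    then show "\<bar>t l\<bar> \<le> 1" using h1 h assms(1) by (auto simp: t_def)
  next
    fix i assume i: "i < n"
    \<comment> \<open>Indices of the ramps already completed at \<open>y i\<close>. The largest one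
      names the cell; index 0 is always present and \<open>M\<close> is excluded, as its ramp never
      starts.\<close>
    define A where "A = {l. l < M \<and> t l + h \<le> y i}"
    have A: "finite A" "0 \<in> A" using assms(1) assms(3)[OF i] by (auto simp: A_def t_def)
    define l where "l = Max A"
    have l: "l < M" "t l + h \<le> y i" using Max_in[of A] A unfolding l_def[symmetric] by (auto simp: A_def)
    have above: "y i \<le> t l'" if "l < l'" "l' \<le> M" for l'
    proof (cases "l' = M")
      case True
      then show ?thesis using assms(1) assms(3)[OF i] by (auto simp: t_def)
    next
      case False
      then have "l' \<notin> A" using that Max_ge[OF A(1), of l'] unfolding l_def by auto
      then show ?thesis using avoid[of l' i] that False i by (auto simp: A_def)
    qed
    have "real l / real M \<le> y i"
      using low[of l] l h assms(3)[OF i] by (cases "l = 0") auto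
    \<comment> \<open>Thresholds are shifted right by up to one grid width, so the point may lie one
      interval further than the index suggests; hence 2 instead of 1.\<close>
    moreover have "y i \<le> real l / real M + 2 / real M"
    proof (cases "Suc l = M")
      case True
      then have "1 = real l / real M + 1 / real M" using assms(1) by (auto simp: add_divide_distrib[symmetric])
      moreover have "1 / real M \<le> 2 / real M" by (intro divide_right_mono) auto
      ultimately show ?thesis using assms(3)[OF i] by linarith
    next
      case False
      then have "Suc l < M" using l by auto
      then have "y i + h \<le> (real (Suc l) + 1) / real M" using above[of "Suc l"] up[of "Suc l"] by auto
      then show ?thesis using h by (simp add: add_divide_distrib)
    qed
    moreover have "ramp a (t l') (y i) = (if l' \<le> l then 1 else 0)" if "l' \<le> M" for l'
    proof (cases "l' \<le> l")
      case True
      then have "t l' + h \<le> y i" using mono[of l' l] l by auto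
      then show ?thesis using True unfolding h_def by (simp add: ramp_simps)
    next
      case False
      then show ?thesis using above[of l'] that by (simp add: ramp_simps)
    qed
    ultimately show "\<exists>l<M. \<bar>y i - real l / real M\<bar> \<le> 2 / real M \<and>
     (\<forall>l'\<le>M. ramp a (t l') (y i) = (if l' \<le> l then 1 else 0))" using l(1) by (intro exI[of _ l]) auto
  qed
qed

lemma window_eq_indicator:
  assumes "\<forall>l'\<le>M. ramp a (t l') y = (if l' \<le> l then 1 else 0)" "l' < M"
  shows "window a (t l') (t (Suc l')) y = (if l' = l then 1 else 0)"
  using assms(1)[rule_format, of l'] assms(1)[rule_format, of "Suc l'"] assms(2)
  by (auto simp: window_def)

lemma affine_comb_map: "affine_comb (map w xs) b (map g xs) z = (\<Sum>x\<leftarrow>xs. w x * g x z) + b"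
  by (induction xs) auto

definition clip :: "real \<Rightarrow> real \<Rightarrow> real" where "clip K y = max (- K) (min K y)"

lemma clip_error: "0 \<le> K \<Longrightarrow> K \<le> F \<Longrightarrow> \<bar>v\<bar> \<le> F \<Longrightarrow> \<bar>clip K y - v\<bar> \<le> \<bar>y - v\<bar> + (F - K)"
  by (auto simp: clip_def)

text \<open>Each of the \<open>M ^ p\<close> cells has its own narrow network, whence the width and
  the cost. \<kappa> and \<open>V\<close> depend on \<open>p\<close>, \<alpha>, \<open>f\<close> and
  \<open>F\<close> only. The output is an affine function of two final hidden units, and the large
  factor \<open>V\<close> is allowed there because top parameters are Gaussian. \<open>F'\<close> is
  left free so that it can be chosen slightly below \<open>F\<close>.\<close>

theorem holder_relu_approximation:
  assumes "p \<ge> 1" "0 < \<alpha>" "holder_smooth p \<alpha> f" "F > 0" "\<forall>z\<in>cube p. \<bar>f z\<bar> \<le> F"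
  shows "\<exists>\<kappa>::nat. \<exists>V. \<kappa> \<ge> 1 \<and> V \<ge> 0 \<and> (\<forall>n M k a d w pts F'. (\<forall>i<n. pts i \<in> cube p) \<longrightarrow> M \<ge> 1 \<longrightarrow> (n + 1) * M \<le> 2 ^ a \<longrightarrow>
     0 \<le> F' \<longrightarrow> F' \<le> F \<longrightarrow> \<kappa> * (k + a + 1) \<le> d \<longrightarrow> \<kappa> * M ^ p \<le> w \<longrightarrow>
     (\<exists>u v. relu_layers p w d (\<kappa> * M ^ p * d) [u, v] \<and> (\<forall>z. \<bar>V * (u z - v z) - F'\<bar> \<le> F') \<and>
       (\<forall>i<n. \<bar>V * (u (pts i) - v (pts i)) - F' - f (pts i)\<bar>
          \<le> real \<kappa> * (1 / 4 ^ k + (1 / real M) powr \<alpha>) + (F - F'))))"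
proof -
  obtain m D where D: "D \<ge> 0" "\<And>c. c \<in> cube p \<Longrightarrow>
      \<exists>P\<in>bounded_polys p m D. \<forall>z\<in>cube p. \<bar>f z - P z\<bar> \<le> D * sup_dist p z c powr \<alpha>"
    using holder_smooth_local_polynomial[OF assms(1-3)] by blast
  obtain \<kappa>1 where \<kappa>1: "\<And>k js. set js \<subseteq> {..<p} \<Longrightarrow> length js \<le> m \<Longrightarrow>
      narrow_net p \<kappa>1 (1 + m * (k + 4)) (approx_monomial k js)"
    using narrow_net_approx_monomial[of p m] by blast
  obtain Js where Js: "set Js = index_lists p m" "distinct Js" using finite_distinct_list[of "index_lists p m"] by auto
  define J where "J = length Js"
  have J: "card (index_lists p m) = J" using Js unfolding J_def by (metis distinct_card)
  \<comment> \<open>The three summands are needed in turn to bound the local polynomials (so that q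
    lies in [0,1]), to make the lower clipping threshold nonnegative, and to bound the coefficients
    divided by \<open>V\<close> by 1.\<close>
  define \<Lambda> where "\<Lambda> = D * real J + F + D"
  have \<Lambda>: "\<Lambda> > 0" "F \<le> \<Lambda>" "D \<le> \<Lambda>" "D * real J \<le> \<Lambda>" 
    using D(1) assms(4) mult_nonneg_nonneg[OF D(1), of "real J"] by (auto simp: \<Lambda>_def simp del: mult_nonneg_nonneg)
  define p1 where "p1 = real p + 1"
  have p1: "p1 \<ge> 1" unfolding p1_def by simp
  \<comment> \<open>An active unit equals (1/2 + poly / (2 \<Lambda>)) / p1, so \<open>V\<close>
    times its value minus \<Lambda> recovers the polynomial.\<close>
  define V where "V = 2 * \<Lambda> * p1"
  have V: "V > 0" unfolding V_def using \<Lambda> p1 by simp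
  define \<kappa>2 where "\<kappa>2 = (p + J) * (\<kappa>1 + 16 * p + 200) + (p + J) + 1"
  define \<kappa> where "\<kappa> = \<kappa>2 + 10 + 5 * m + nat \<lceil>D * real J * real m\<rceil> + nat \<lceil>D * 2 powr \<alpha>\<rceil>"
  have \<kappa>: "\<kappa> \<ge> 1" "\<kappa>2 + 10 + 5 * m \<le> \<kappa>" "D * real J * real m \<le> real \<kappa>" "D * 2 powr \<alpha> \<le> real \<kappa>"
  proof -
    show "D * real J * real m \<le> real \<kappa>" "D * 2 powr \<alpha> \<le> real \<kappa>"
      unfolding \<kappa>_def by linarith+
  qed (auto simp: \<kappa>_def)
  show ?thesis
  proof (intro exI[of _ \<kappa>] exI[of _ V] conjI allI impI)
    fix n M k a d w pts F'
    assume pts: "\<forall>i<n. pts i \<in> cube p" and M: "M \<ge> 1" and a: "(n + 1) * M \<le> 2 ^ a"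
      and F': "0 \<le> F'" "F' \<le> F" and d: "\<kappa> * (k + a + 1) \<le> d" and w: "\<kappa> * M ^ p \<le> w"
    have "\<forall>j. \<exists>t. j < p \<longrightarrow> (\<forall>l\<le>M. \<bar>t l\<bar> \<le> 1) \<and> (\<forall>i<n. \<exists>l<M. \<bar>pts i j - real l / real M\<bar> \<le> 2 / real M \<and>
     (\<forall>l'\<le>M. ramp a (t l') (pts i j) = (if l' \<le> l then 1 else 0)))"
    proof
      fix j
      show "\<exists>t. j < p \<longrightarrow> (\<forall>l\<le>M. \<bar>t l\<bar> \<le> 1) \<and> (\<forall>i<n. \<exists>l<M. \<bar>pts i j - real l / real M\<bar> \<le> 2 / real M \<and>
     (\<forall>l'\<le>M. ramp a (t l') (pts i j) = (if l' \<le> l then 1 else 0)))"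
        using thresholds_exist[OF M a, of "\<lambda>i. pts i j"] pts by (cases "j < p") (auto simp: cube_def)
    qed
    then obtain t where t: "\<And>j l. j < p \<Longrightarrow> l \<le> M \<Longrightarrow> \<bar>t j l\<bar> \<le> 1"
      and tl: "\<And>j i. j < p \<Longrightarrow> i < n \<Longrightarrow> \<exists>l<M. \<bar>pts i j - real l / real M\<bar> \<le> 2 / real M \<and>
     (\<forall>l'\<le>M. ramp a (t j l') (pts i j) = (if l' \<le> l then 1 else 0))" by metis
    have "\<forall>j i. \<exists>l. j < p \<longrightarrow> i < n \<longrightarrow> l < M \<and> \<bar>pts i j - real l / real M\<bar> \<le> 2 / real M \<and>
     (\<forall>l'\<le>M. ramp a (t j l') (pts i j) = (if l' \<le> l then 1 else 0))" using tl by blast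
    then obtain cell where cell: "\<And>j i. j < p \<Longrightarrow> i < n \<Longrightarrow> cell j i < M \<and> \<bar>pts i j - real (cell j i) / real M\<bar> \<le> 2 / real M \<and>
     (\<forall>l'\<le>M. ramp a (t j l') (pts i j) = (if l' \<le> cell j i then 1 else 0))" by metis
    define corner where "corner = (\<lambda>ks j. if j < p then real (ks ! j) / real M else 0)"
    define cells where "cells = List.n_lists p [0..<M]"
    have cells: "distinct cells" "length cells = M ^ p" "\<And>ks. ks \<in> set cells \<longleftrightarrow> length ks = p \<and> set ks \<subseteq> {..<M}"
      unfolding cells_def by (auto simp: distinct_n_lists length_n_lists set_n_lists lessThan_atLeast0)
    have ksM: "ks ! j < M" if "ks \<in> set cells" "j < p" for ks j
      using that cells(3) by (metis lessThan_iff nth_mem subsetD)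
    have corner: "corner ks \<in> cube p" if "ks \<in> set cells" for ks
      using ksM[OF that] M by (auto simp: corner_def cube_def divide_le_eq less_imp_le)
    have "\<forall>ks. \<exists>c. ks \<in> set cells \<longrightarrow> (\<forall>js. \<bar>c js\<bar> \<le> D) \<and>
      (\<forall>z\<in>cube p. \<bar>f z - (\<Sum>js\<in>index_lists p m. c js * monomial_at js z)\<bar> \<le> D * sup_dist p z (corner ks) powr \<alpha>)"
      using D(2)[OF corner] unfolding bounded_polys_def by fastforce
    then obtain c where c: "\<And>ks js. ks \<in> set cells \<Longrightarrow> \<bar>c ks js\<bar> \<le> D"
      and ca: "\<And>ks z. ks \<in> set cells \<Longrightarrow> z \<in> cube p \<Longrightarrow>
        \<bar>f z - (\<Sum>js\<in>index_lists p m. c ks js * monomial_at js z)\<bar> \<le> D * sup_dist p z (corner ks) powr \<alpha>" by metis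
    define poly where "poly = (\<lambda>ks z. \<Sum>js\<in>index_lists p m. c ks js * approx_monomial k js z)"
    define win where "win = (\<lambda>ks j z. window a (t j (ks ! j)) (t j (Suc (ks ! j))) (max (z j) 0))"
    \<comment> \<open>Everything is divided by p + 1 to bring the bias, which collects - p and the
      1/2 of q = 1/2 + poly / (2 \<Lambda>), into [-1,1].\<close>
    define ws where "ws = (\<lambda>ks. map (\<lambda>j. 1 / p1) [0..<p] @ map (\<lambda>js. c ks js / V) Js)"
    define fs where "fs = (\<lambda>ks. map (win ks) [0..<p] @ map (approx_monomial k) Js)"
    define b where "b = (1 / 2 - real p) / p1"
    define r where "r = (\<lambda>ks z. max (affine_comb (ws ks) b (fs ks) z) 0)"
    define d0 where "d0 = a + 4 + (1 + m * (k + 4))"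
    have r_net: "narrow_net p \<kappa>2 (Suc d0) (r ks)" if ks: "ks \<in> set cells" for ks
      unfolding r_def
    proof (rule narrow_net_unit[where \<kappa> = "\<kappa>1 + 16 * p + 200"])
      fix g assume "g \<in> set (fs ks)"
      then consider j where "j < p" "g = win ks j" | js where "js \<in> index_lists p m" "g = approx_monomial k js"
        using Js by (auto simp: fs_def)
      then show "narrow_net p (\<kappa>1 + 16 * p + 200) d0 g"
      proof cases
        case 1
        show ?thesis unfolding 1(2) win_def
          by (rule narrow_net_mono[OF narrow_net_pad[OF narrow_net_window]])
             (use 1 t ksM[OF ks] in \<open>auto simp: d0_def Suc_le_eq less_imp_le\<close>)
      next
        case 2
        show ?thesis unfolding 2(2)
          by (rule narrow_net_mono[OF narrow_net_pad[OF \<kappa>1]]) (use 2 in \<open>auto simp: d0_def index_lists_def\<close>)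
      qed
    next
      have "\<bar>c ks js / V\<bar> \<le> 1" for js
      proof -
        have "\<Lambda> * 1 \<le> \<Lambda> * (2 * p1)" using \<Lambda> p1 by (intro mult_left_mono) auto
        then have "\<Lambda> \<le> V" unfolding V_def by (simp only: mult_1_right mult_ac)
        then have "\<bar>c ks js\<bar> \<le> V" using c[OF ks, of js] \<Lambda>(3) by linarith
        then show ?thesis using V by (simp add: abs_divide)
      qed
      moreover have "\<bar>b\<bar> \<le> 1" unfolding b_def p1_def using assms(1) by (auto simp: abs_if field_simps)
      ultimately show "\<forall>w\<in>set (b # ws ks). \<bar>w\<bar> \<le> 1" using p1 by (auto simp: ws_def)
    qed (auto simp: ws_def fs_def \<kappa>2_def J_def d0_def)
    have r_eq: "r ks z = max (((\<Sum>j<p. win ks j z) - real p + (1 / 2 + poly ks z / (2 * \<Lambda>))) / p1) 0" for ks z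
    proof -
      have "affine_comb (ws ks) b (fs ks) z = (\<Sum>j<p. 1 / p1 * win ks j z) + (\<Sum>js\<in>index_lists p m. c ks js / V * approx_monomial k js z) + b"
        unfolding ws_def fs_def
        by (subst affine_comb_append) (simp_all only: affine_comb_map length_map sum_list_distinct_conv_sum_set Js
            distinct_upt set_upt atLeast0LessThan add_0_right)
      also have "\<dots> = (\<Sum>j<p. win ks j z) / p1 + poly ks z / V + b"
        unfolding poly_def by (simp add: sum_divide_distrib)
      also have "\<dots> = ((\<Sum>j<p. win ks j z) - real p + (1 / 2 + poly ks z / (2 * \<Lambda>))) / p1"
        unfolding b_def V_def using p1 \<Lambda> by (simp add: field_simps)
      finally show ?thesis unfolding r_def by simp
    qed
    define G where "G = (\<lambda>z. \<Sum>ks\<in>set cells. r ks z)"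
    \<comment> \<open>Clipping V G - \<Lambda> to [-F', F'] is the difference of two ReLUs of
      \<open>G\<close> with thresholds \<open>lo\<close> and \<open>hi\<close>, shifted by F'. The
      clipping holds for every input, not just at the data points, which membership in the class
      requires.\<close>
    define lo where "lo = (\<Lambda> - F') / V"
    define hi where "hi = (\<Lambda> + F') / V"
    define u where "u = (\<lambda>z. max (G z - lo) 0)"
    define v where "v = (\<lambda>z. max (G z - hi) 0)"
    have G0: "0 \<le> G z" for z unfolding G_def r_def by (intro sum_nonneg) auto
    have "2 * \<Lambda> \<le> V" using mult_left_mono[OF p1, of "2 * \<Lambda>"] \<Lambda> unfolding V_def by simp
    then have lohi: "0 \<le> lo" "lo \<le> 1" "0 \<le> hi" "hi \<le> 1" "lo \<le> hi"
      unfolding lo_def hi_def using F' \<Lambda> V by (auto simp: divide_le_eq divide_right_mono)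
    have uv: "V * (u z - v z) - F' = clip F' (V * G z - \<Lambda>)" for z
    proof -
      have "V * lo = \<Lambda> - F'" "V * hi = \<Lambda> + F'" unfolding lo_def hi_def using V by auto
      moreover have "V * (u z - v z) = max (V * G z - V * lo) 0 - max (V * G z - V * hi) 0"
        unfolding u_def v_def using V by (simp add: right_diff_distrib max_mult_distrib_left)
      ultimately show ?thesis using F' unfolding clip_def by auto
    qed
    have K1: "1 \<le> M ^ p" using M by simp
    have "relu_layers p w d (\<kappa> * M ^ p * d) [u, v]"
    proof -
      have w2: "M ^ p * \<kappa>2 \<le> w" "1 \<le> w" "2 \<le> w"
      proof -
        have "M ^ p * (\<kappa>2 + 10) \<le> M ^ p * \<kappa>" using \<kappa> by (intro mult_left_mono) auto
        then have "M ^ p * \<kappa>2 + M ^ p * 10 \<le> w" using w by (simp add: algebra_simps)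
        then show "M ^ p * \<kappa>2 \<le> w" "1 \<le> w" "2 \<le> w" using K1 by linarith+
      qed
      have "relu_layers p (length (map r cells) * \<kappa>2) (Suc d0) (length (map r cells) * (\<kappa>2 * Suc d0)) (map r cells)"
        by (rule narrow_net_concat) (use r_net in auto)
      then have 1: "relu_layers p w (Suc d0) (M ^ p * (\<kappa>2 * Suc d0)) (map r cells)"
        using relu_layers_mono w2 cells(2) by (metis length_map order_refl)
      have "relu_layers p w (Suc (Suc d0)) (M ^ p * (\<kappa>2 * Suc d0) + (length (map r cells) + 1))
         [\<lambda>z. max (affine_comb (map (\<lambda>_. 1) cells) 0 (map r cells) z) 0]"
        by (rule relu_layers_unit[OF 1]) (use w2 in auto)
      moreover have "(\<lambda>z. max (affine_comb (map (\<lambda>_. 1) cells) 0 (map r cells) z) 0) = G"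
      proof
        fix z
        have "affine_comb (map (\<lambda>_. 1) cells) 0 (map r cells) z = G z"
          unfolding G_def by (simp only: affine_comb_map sum_list_distinct_conv_sum_set[OF cells(1)] mult_1_left add_0_right)
        then show "max (affine_comb (map (\<lambda>_. 1) cells) 0 (map r cells) z) 0 = G z" using G0[of z] by simp
      qed
      ultimately have 2: "relu_layers p w (Suc (Suc d0)) (M ^ p * (\<kappa>2 * Suc d0) + (M ^ p + 1)) [G]"
        by (simp add: cells(2))
      have "relu_unit [G] 2 u" unfolding u_def by (rule relu_unitI[of "[1]" _ "- lo"]) (use lohi in auto)
      moreover have "relu_unit [G] 2 v" unfolding v_def by (rule relu_unitI[of "[1]" _ "- hi"]) (use lohi in auto)
      ultimately have "relu_layer [G] 4 [u, v]" by (intro relu_layer_uniform[where a = 2]) auto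
      from relu_layers_Suc[OF 2 this] have 3: "relu_layers p w (Suc (Suc (Suc d0))) (M ^ p * (\<kappa>2 * Suc d0) + (M ^ p + 1) + 4) [u, v]"
        using w2 by simp
      have "Suc (Suc (Suc d0)) \<le> (10 + 5 * m) * (k + a + 1)" unfolding d0_def by (simp add: algebra_simps)
      also have "\<dots> \<le> \<kappa> * (k + a + 1)" using \<kappa>(2) by (intro mult_right_mono) auto
      finally have "Suc (Suc (Suc d0)) \<le> d" using d by simp
      \<comment> \<open>Surplus layers only carry the pair \<open>u\<close>, \<open>v\<close>, two
        parameters each.\<close>
      then obtain e where e: "d = Suc (Suc (Suc d0)) + e" using le_Suc_ex by blast
      from relu_layers_pad[OF 3, of e] have "relu_layers p w d (M ^ p * (\<kappa>2 * Suc d0) + (M ^ p + 1) + 4 + e * 2) [u, v]"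
        unfolding e by (simp add: algebra_simps)
      moreover have "M ^ p * (\<kappa>2 * Suc d0) + (M ^ p + 1) + 4 + e * 2 \<le> \<kappa> * M ^ p * d"
      proof -
        have "M ^ p * (\<kappa>2 * Suc d0) \<le> M ^ p * (\<kappa>2 * d)" unfolding e by (intro mult_left_mono) auto
        moreover have "(M ^ p + 1) + 4 + e * 2 \<le> M ^ p * 10 * d"
        proof -
          have "(M ^ p + 1) + 4 + e * 2 \<le> M ^ p * 6 + M ^ p * (2 * e)" using K1 mult_le_mono1[OF K1, of "2 * e"] by linarith
          also have "\<dots> = M ^ p * (6 + 2 * e)" by (simp add: algebra_simps)
          also have "\<dots> \<le> M ^ p * (10 * d)" unfolding e by (intro mult_left_mono) auto
          finally show ?thesis by (simp add: mult.assoc)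
        qed
        moreover have "M ^ p * (\<kappa>2 * d) + M ^ p * 10 * d = (\<kappa>2 + 10) * M ^ p * d" by (simp add: algebra_simps)
        moreover have "(\<kappa>2 + 10) * M ^ p * d \<le> \<kappa> * M ^ p * d" using \<kappa>(2) by (intro mult_right_mono) auto
        ultimately show ?thesis by linarith
      qed
      ultimately show ?thesis using relu_layers_mono by blast
    qed
    moreover have "\<bar>V * (u z - v z) - F'\<bar> \<le> F'" for z
      unfolding uv clip_def using F' by auto
    moreover have "\<bar>V * (u (pts i) - v (pts i)) - F' - f (pts i)\<bar>
          \<le> real \<kappa> * (1 / 4 ^ k + (1 / real M) powr \<alpha>) + (F - F')" if i: "i < n" for i
    proof -
      define z where "z = pts i"
      have z: "z \<in> cube p" using pts i unfolding z_def by auto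
      define k0 where "k0 = map (\<lambda>j. cell j i) [0..<p]"
      have k0: "k0 \<in> set cells" unfolding cells k0_def using cell[OF _ i] by auto
      have winz: "win ks j z = (if ks ! j = k0 ! j then 1 else 0)" if "ks \<in> set cells" "j < p" for ks j
      proof -
        have "max (z j) 0 = z j" using z that by (auto simp: cube_def)
        moreover have "\<forall>l'\<le>M. ramp a (t j l') (z j) = (if l' \<le> cell j i then 1 else 0)"
          using cell[OF that(2) i] unfolding z_def by blast
        ultimately show ?thesis unfolding win_def
          using window_eq_indicator[of M a "t j" "z j" "cell j i" "ks ! j"] ksM[OF that] that by (simp add: k0_def)
      qed
      have polyb: "\<bar>poly ks z\<bar> \<le> D * real J" if "ks \<in> set cells" for ks
      proof -
        have "\<bar>poly ks z\<bar> \<le> (\<Sum>js\<in>index_lists p m. D)" unfolding poly_def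
        proof (intro order_trans[OF sum_abs] sum_mono)
          fix js assume "js \<in> index_lists p m"
          then have "0 \<le> approx_monomial k js z" "approx_monomial k js z \<le> 1"
            using approx_monomial_bounds[OF z, of js k] by (auto simp: index_lists_def)
          then have "\<bar>c ks js\<bar> * \<bar>approx_monomial k js z\<bar> \<le> D * 1"
            using c[OF that, of js] D by (intro mult_mono) auto
          then show "\<bar>c ks js * approx_monomial k js z\<bar> \<le> D" by (simp add: abs_mult)
        qed
        then show ?thesis by (simp add: J mult.commute)
      qed
      have q: "0 \<le> 1 / 2 + poly ks z / (2 * \<Lambda>)" "1 / 2 + poly ks z / (2 * \<Lambda>) \<le> 1" if "ks \<in> set cells" for ks
      proof -
        have "- \<Lambda> \<le> poly ks z" "poly ks z \<le> \<Lambda>" using polyb[OF that] \<Lambda> by auto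
        then show "0 \<le> 1 / 2 + poly ks z / (2 * \<Lambda>)" "1 / 2 + poly ks z / (2 * \<Lambda>) \<le> 1" using \<Lambda>(1) by (auto simp: field_simps)
      qed
      \<comment> \<open>A single wrong coordinate lowers the sum of the windows to at most p - 1,
        and q \<le> 1 cannot make the preactivation positive again.\<close>
      have r0: "r ks z = 0" if "ks \<in> set cells" "ks \<noteq> k0" for ks
      proof -
        have "\<exists>j<p. ks ! j \<noteq> k0 ! j" using that k0 cells(3) nth_equalityI by metis
        then obtain j where j: "j < p" "ks ! j \<noteq> k0 ! j" by auto
        have "(\<Sum>j<p. win ks j z) = (\<Sum>j\<in>{..<p} - {j}. win ks j z)"
          using j winz[OF that(1) j(1)] by (subst sum.remove[of _ j]) auto
        also have "\<dots> \<le> (\<Sum>j\<in>{..<p} - {j}. 1)" using winz[OF that(1)] by (intro sum_mono) auto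
        also have "\<dots> = real p - 1" using j by (simp add: of_nat_diff)
        finally show ?thesis unfolding r_eq using q(2)[OF that(1)] p1 by (auto simp: max_def divide_le_0_iff intro: antisym)
      qed
      have "(\<Sum>j<p. win k0 j z) = real p" using winz[OF k0] by simp
      then have "r k0 z = (1 / 2 + poly k0 z / (2 * \<Lambda>)) / p1" unfolding r_eq using q(1)[OF k0] p1 by simp
      moreover have "G z = r k0 z" unfolding G_def using r0 k0 by (subst sum.remove[of _ k0]) auto
      ultimately have Gz: "V * G z - \<Lambda> = poly k0 z" unfolding V_def using p1 \<Lambda> by (simp add: field_simps)
      have "\<bar>f z\<bar> \<le> F" using assms(5) z by auto
      then have "\<bar>V * (u z - v z) - F' - f z\<bar> \<le> \<bar>poly k0 z - f z\<bar> + (F - F')"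
        unfolding uv Gz by (rule clip_error[OF F'])
      moreover have "\<bar>poly k0 z - (\<Sum>js\<in>index_lists p m. c k0 js * monomial_at js z)\<bar> \<le> real \<kappa> * (1 / 4 ^ k)"
      proof -
        have "\<bar>poly k0 z - (\<Sum>js\<in>index_lists p m. c k0 js * monomial_at js z)\<bar>
           = \<bar>\<Sum>js\<in>index_lists p m. c k0 js * (approx_monomial k js z - monomial_at js z)\<bar>"
          unfolding poly_def by (simp add: sum_subtractf right_diff_distrib)
        also have "\<dots> \<le> (\<Sum>js\<in>index_lists p m. D * (real m / 4 ^ k))"
        proof (intro order_trans[OF sum_abs] sum_mono)
          fix js assume js: "js \<in> index_lists p m"
          have "\<bar>approx_monomial k js z - monomial_at js z\<bar> \<le> real (length js) / 4 ^ k"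
            using approx_monomial_bounds[OF z, of js k] js by (auto simp: index_lists_def)
          also have "\<dots> \<le> real m / 4 ^ k" using js by (intro divide_right_mono) (auto simp: index_lists_def)
          finally have "\<bar>c k0 js\<bar> * \<bar>approx_monomial k js z - monomial_at js z\<bar> \<le> D * (real m / 4 ^ k)"
            using c[OF k0, of js] D by (intro mult_mono) auto
          then show "\<bar>c k0 js * (approx_monomial k js z - monomial_at js z)\<bar> \<le> D * (real m / 4 ^ k)" by (simp add: abs_mult)
        qed
        also have "\<dots> = D * real J * real m * (1 / 4 ^ k)" by (simp add: J)
        also have "\<dots> \<le> real \<kappa> * (1 / 4 ^ k)" using \<kappa>(3) by (intro mult_right_mono) auto
        finally show ?thesis .
      qed
      moreover have "\<bar>f z - (\<Sum>js\<in>index_lists p m. c k0 js * monomial_at js z)\<bar> \<le> real \<kappa> * (1 / real M) powr \<alpha>"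
      proof -
        have "sup_dist p z (corner k0) \<le> 2 / real M"
          unfolding sup_dist_def using assms(1) cell[OF _ i] by (intro Max.boundedI) (auto simp: corner_def k0_def z_def lessThan_empty_iff)
        then have "D * sup_dist p z (corner k0) powr \<alpha> \<le> D * (2 / real M) powr \<alpha>"
          using D assms sup_dist_nonneg by (intro mult_left_mono powr_mono2) auto
        also have "\<dots> = D * 2 powr \<alpha> * (1 / real M) powr \<alpha>"
          using powr_mult[of 2 "1 / real M" \<alpha>] by simp
        also have "\<dots> \<le> real \<kappa> * (1 / real M) powr \<alpha>" using \<kappa>(4) by (intro mult_right_mono) auto
        finally show ?thesis using ca[OF k0 z] by linarith
      qed
      ultimately show ?thesis unfolding z_def[symmetric] distrib_left by linarith
    qed
    ultimately show "\<exists>u v. relu_layers p w d (\<kappa> * M ^ p * d) [u, v] \<and> (\<forall>z. \<bar>V * (u z - v z) - F'\<bar> \<le> F') \<and>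
       (\<forall>i<n. \<bar>V * (u (pts i) - v (pts i)) - F' - f (pts i)\<bar>
          \<le> real \<kappa> * (1 / 4 ^ k + (1 / real M) powr \<alpha>) + (F - F'))" by blast
  qed (use \<kappa> V in auto)
qed

subsection \<open>Flat parameter vectors\<close>

lemma layer_off_Suc: "layer_off ps (Suc k) = layer_off ps k + ps ! Suc k * (ps ! k + 1)"
  by (simp add: layer_off_def)

lemma layer_off_mono: "k \<le> l \<Longrightarrow> layer_off ps k \<le> layer_off ps l"
  by (induction rule: dec_induct) (auto simp: layer_off_Suc)

lemma row_major_less:
  assumes "i < (m::nat)" "j < n" shows "i * n + j < m * n"
proof -
  have "i * n + j < Suc i * n" using assms by simp
  also have "\<dots> \<le> m * n" using assms by (intro mult_right_mono) auto
  finally show ?thesis .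
qed

lemma weight_index_less:
  assumes "i < ps ! Suc k" "j < ps ! k"
  shows "layer_off ps k + i * ps ! k + j < layer_off ps (Suc k)"
  using row_major_less[OF assms] by (simp add: layer_off_Suc)

lemma bias_index_less:
  "i < ps ! Suc k \<Longrightarrow> layer_off ps k + ps ! Suc k * ps ! k + i < layer_off ps (Suc k)"
  by (simp add: layer_off_Suc)

text \<open>Layer \<open>d\<close> reads only the blocks below its offset, so a parameter vector can
  be extended block by block.\<close>

lemma hidden_cong:
  assumes "\<And>j. j < layer_off ps d \<Longrightarrow> \<beta> j = \<beta>' j" "i < ps ! d"
  shows "hidden ps \<beta> z d i = hidden ps \<beta>' z d i"
  using assms
proof (induction d arbitrary: i)
  case (Suc d)
  have "hidden ps \<beta> z d j = hidden ps \<beta>' z d j" if "j < ps ! d" for j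
    by (rule Suc.IH) (use Suc.prems that layer_off_mono[of d "Suc d" ps] in auto)
  moreover have "wt ps \<beta> d i j = wt ps \<beta>' d i j" if "j < ps ! d" for j
    unfolding wt_def by (rule Suc.prems(1)) (use weight_index_less Suc.prems that in auto)
  moreover have "bs ps \<beta> d i = bs ps \<beta>' d i"
    unfolding bs_def by (rule Suc.prems(1)) (use bias_index_less Suc.prems in auto)
  ultimately show ?case by simp
qed simp

lemma relu_layer_units:
  assumes "relu_layer fs c gs"
  shows "\<exists>ws b. (\<forall>i<length gs. length (ws i) = length fs \<and> (\<forall>w\<in>set (b i # ws i). \<bar>w\<bar> \<le> 1) \<and>
      gs ! i = (\<lambda>z. max (affine_comb (ws i) (b i) fs z) 0)) \<and>
    (\<Sum>i<length gs. length (filter (\<lambda>w. w \<noteq> 0) (b i # ws i))) \<le> c"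
  using assms
proof (induction gs arbitrary: c)
  case (Cons g gs)
  then obtain a c' where ac: "relu_unit fs a g" "relu_layer fs c' gs" "a + c' \<le> c" by auto
  from Cons.IH[OF ac(2)] obtain ws b where IH: "\<forall>i<length gs. length (ws i) = length fs \<and> (\<forall>w\<in>set (b i # ws i). \<bar>w\<bar> \<le> 1) \<and>
      gs ! i = (\<lambda>z. max (affine_comb (ws i) (b i) fs z) 0)"
    "(\<Sum>i<length gs. length (filter (\<lambda>w. w \<noteq> 0) (b i # ws i))) \<le> c'" by blast
  from ac(1) obtain ws0 b0 where 0: "length ws0 = length fs" "\<forall>w\<in>set (b0 # ws0). \<bar>w\<bar> \<le> 1"
     "length (filter (\<lambda>w. w \<noteq> 0) (b0 # ws0)) \<le> a" "g = (\<lambda>z. max (affine_comb ws0 b0 fs z) 0)"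
    unfolding relu_unit_def by blast
  show ?case
  proof (intro exI[of _ "case_nat ws0 ws"] exI[of _ "case_nat b0 b"] conjI allI impI)
    fix i assume "i < length (g # gs)"
    then show "length (case i of 0 \<Rightarrow> ws0 | Suc x \<Rightarrow> ws x) = length fs"
      "\<forall>w\<in>set ((case i of 0 \<Rightarrow> b0 | Suc x \<Rightarrow> b x) # (case i of 0 \<Rightarrow> ws0 | Suc x \<Rightarrow> ws x)). \<bar>w\<bar> \<le> 1"
      "(g # gs) ! i = (\<lambda>z. max (affine_comb (case i of 0 \<Rightarrow> ws0 | Suc x \<Rightarrow> ws x) (case i of 0 \<Rightarrow> b0 | Suc x \<Rightarrow> b x) fs z) 0)"
      using 0 IH(1) by (auto split: nat.splits)
  next
    show "(\<Sum>i<length (g # gs). length (filter (\<lambda>w. w \<noteq> 0) ((case i of 0 \<Rightarrow> b0 | Suc x \<Rightarrow> b x) # (case i of 0 \<Rightarrow> ws0 | Suc x \<Rightarrow> ws x)))) \<le> c"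
      unfolding length_Cons sum.lessThan_Suc_shift nat.case using 0(3) IH(2) ac(3) by linarith
  qed
qed auto

text \<open>The architecture prescribes the width, so surplus units are switched off by zero
  parameters: they output 0 and cost nothing. Each step keeps the earlier parameters and appends one
  block.\<close>

lemma relu_layers_params:
  assumes "relu_layers p w d c gs" "ps ! 0 = p" "\<And>k. 1 \<le> k \<Longrightarrow> k \<le> d \<Longrightarrow> w \<le> ps ! k"
  shows "\<exists>\<beta>. (\<forall>j. \<bar>\<beta> j\<bar> \<le> 1) \<and> (\<forall>j\<ge>layer_off ps d. \<beta> j = 0) \<and> card {j. j < layer_off ps d \<and> \<beta> j \<noteq> 0} \<le> c \<and>
     (\<forall>z. \<forall>i<ps ! d. hidden ps \<beta> z d i = (if i < length gs then (gs ! i) z else 0)) \<and> length gs \<le> ps ! d"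
  using assms(1,3)
proof (induction d arbitrary: c gs)
  case 0
  then show ?case using assms(2) by (intro exI[of _ "\<lambda>_. 0"]) (auto simp: coordinates_def layer_off_def)
next
  case (Suc d)
  from Suc.prems(1) obtain fs c1 c2 where fs: "length gs \<le> w" "relu_layers p w d c1 fs" "relu_layer fs c2 gs" "c1 + c2 \<le> c"
    by (auto simp: relu_layers.simps(2))
  from Suc.IH[OF fs(2)] Suc.prems(2) obtain \<beta> where \<beta>: "\<forall>j. \<bar>\<beta> j\<bar> \<le> 1" "\<forall>j\<ge>layer_off ps d. \<beta> j = 0"
    "card {j. j < layer_off ps d \<and> \<beta> j \<noteq> 0} \<le> c1" "length fs \<le> ps ! d"
    "\<And>z i. i < ps ! d \<Longrightarrow> hidden ps \<beta> z d i = (if i < length fs then (fs ! i) z else 0)" by auto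
  from relu_layer_units[OF fs(3)] obtain ws b where
    u: "\<And>i. i < length gs \<Longrightarrow> length (ws i) = length fs" "\<And>i w. i < length gs \<Longrightarrow> w\<in>set (b i # ws i) \<Longrightarrow> \<bar>w\<bar> \<le> 1"
      "\<And>i. i < length gs \<Longrightarrow> gs ! i = (\<lambda>z. max (affine_comb (ws i) (b i) fs z) 0)" and
    count: "(\<Sum>i<length gs. length (filter (\<lambda>w. w \<noteq> 0) (b i # ws i))) \<le> c2" by blast
  define q where "q = ps ! d"
  define r where "r = ps ! Suc d"
  define off where "off = layer_off ps d"
  have gr: "length gs \<le> r" using fs(1) Suc.prems(2)[of "Suc d"] by (simp add: r_def)
  define W where "W = (\<lambda>i j. if i < length gs \<and> j < length fs then ws i ! j else 0)"
  define B where "B = (\<lambda>i. if i < length gs then b i else 0)"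
  define \<gamma> where "\<gamma> = (\<lambda>x. if x < off then \<beta> x else if x < off + r * q then W ((x - off) div q) ((x - off) mod q)
     else if x < off + r * q + r then B (x - (off + r * q)) else 0)"
  have off': "layer_off ps (Suc d) = off + r * q + r" by (simp add: layer_off_Suc off_def r_def q_def)
  have W1: "\<bar>W i j\<bar> \<le> 1" "\<bar>B i\<bar> \<le> 1" for i j
    using u(2)[of i] u(1)[of i] by (auto simp: W_def B_def)
  have wt: "wt ps \<gamma> d i j = W i j" if "i < r" "j < q" for i j
    using row_major_less[OF that] that by (simp add: wt_def \<gamma>_def off_def[symmetric] q_def[symmetric])
  have bs: "bs ps \<gamma> d i = B i" if "i < r" for i
    using that by (simp add: bs_def \<gamma>_def off_def[symmetric] q_def[symmetric] r_def[symmetric])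
  have hid: "hidden ps \<gamma> z d i = (if i < length fs then (fs ! i) z else 0)" if "i < q" for z i
    using hidden_cong[of ps d \<gamma> \<beta> i z] \<beta>(5)[of i z] that by (simp add: \<gamma>_def off_def q_def)
  have "hidden ps \<gamma> z (Suc d) i = (if i < length gs then (gs ! i) z else 0)" if i: "i < r" for z i
  proof -
    have "hidden ps \<gamma> z (Suc d) i = max ((\<Sum>j<q. W i j * (if j < length fs then (fs ! j) z else 0)) + B i) 0"
      using i by (simp add: q_def[symmetric] wt bs hid)
    also have "(\<Sum>j<q. W i j * (if j < length fs then (fs ! j) z else 0)) = (\<Sum>j<length fs. W i j * (fs ! j) z)"
      using \<beta>(4) unfolding q_def[symmetric] by (intro sum.mono_neutral_cong_right) auto
    also have "max ((\<Sum>j<length fs. W i j * (fs ! j) z) + B i) 0 = (if i < length gs then (gs ! i) z else 0)"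
      using u(1,3)[of i] by (simp add: W_def B_def affine_comb_sum)
    finally show ?thesis .
  qed
  moreover have "card {j. j < layer_off ps (Suc d) \<and> \<gamma> j \<noteq> 0} \<le> c"
  proof -
    \<comment> \<open>Positions of the nonzero parameters of unit \<open>i\<close> in the new block:
      its row of weights and its bias.\<close>
    define E where "E = (\<lambda>i. (\<lambda>j. off + i * q + j) ` {j. j < length fs \<and> ws i ! j \<noteq> 0} \<union> (if b i \<noteq> 0 then {off + r * q + i} else {}))"
    have "{j. j < layer_off ps (Suc d) \<and> \<gamma> j \<noteq> 0} \<subseteq> {j. j < off \<and> \<beta> j \<noteq> 0} \<union> (\<Union>i<length gs. E i)"
    proof
      fix x assume x: "x \<in> {j. j < layer_off ps (Suc d) \<and> \<gamma> j \<noteq> 0}"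
      consider "x < off" | "off \<le> x" "x < off + r * q" | "off + r * q \<le> x" "x < off + r * q + r"
        using x unfolding off' by fastforce
      then show "x \<in> {j. j < off \<and> \<beta> j \<noteq> 0} \<union> (\<Union>i<length gs. E i)"
      proof cases
        case 1 then show ?thesis using x by (auto simp: \<gamma>_def)
      next
        case 2
        define i where "i = (x - off) div q" define j where "j = (x - off) mod q"
        have "W i j \<noteq> 0" using x 2 by (auto simp: \<gamma>_def i_def j_def)
        then have ij: "i < length gs" "j < length fs" "ws i ! j \<noteq> 0" by (auto simp: W_def split: if_splits)
        have "x = off + i * q + j" using 2 by (simp add: i_def j_def)
        then have "x \<in> E i" using ij unfolding E_def by blast
        then show ?thesis using ij by blast
      next
        case 3
        define i where "i = x - (off + r * q)"
        have "B i \<noteq> 0" using x 3 by (auto simp: \<gamma>_def i_def)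
        then have "i < length gs" "b i \<noteq> 0" by (auto simp: B_def split: if_splits)
        moreover have "x = off + r * q + i" using 3 by (simp add: i_def)
        ultimately have "x \<in> E i" unfolding E_def by simp
        then show ?thesis using \<open>i < length gs\<close> by blast
      qed
    qed
    then have "card {j. j < layer_off ps (Suc d) \<and> \<gamma> j \<noteq> 0} \<le> card ({j. j < off \<and> \<beta> j \<noteq> 0} \<union> (\<Union>i<length gs. E i))"
      by (intro card_mono) (auto simp: E_def)
    also have "\<dots> \<le> card {j. j < off \<and> \<beta> j \<noteq> 0} + card (\<Union>i<length gs. E i)" by (rule card_Un_le)
    also have "card (\<Union>i<length gs. E i) \<le> (\<Sum>i<length gs. card (E i))" by (rule card_UN_le) simp
    also have "\<dots> \<le> (\<Sum>i<length gs. length (filter (\<lambda>w. w \<noteq> 0) (b i # ws i)))"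
    proof (rule sum_mono)
      fix i assume "i \<in> {..<length gs}"
      then have l: "length (ws i) = length fs" using u(1) by auto
      have "card (E i) \<le> card ((\<lambda>j. off + i * q + j) ` {j. j < length fs \<and> ws i ! j \<noteq> 0}) + card (if b i \<noteq> 0 then {off + r * q + i} else {})"
        unfolding E_def by (rule card_Un_le)
      also have "card ((\<lambda>j. off + i * q + j) ` {j. j < length fs \<and> ws i ! j \<noteq> 0}) \<le> card {j. j < length fs \<and> ws i ! j \<noteq> 0}"
        by (rule card_image_le) simp
      also have "\<dots> = length (filter (\<lambda>w. w \<noteq> 0) (ws i))" by (simp add: length_filter_conv_card l)
      finally show "card (E i) \<le> length (filter (\<lambda>w. w \<noteq> 0) (b i # ws i))" by (simp split: if_splits)
    qed
    finally show ?thesis using \<beta>(3) count fs(4) unfolding off_def by linarith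
  qed
  moreover have "\<forall>j. \<bar>\<gamma> j\<bar> \<le> 1" using \<beta>(1) W1 by (auto simp: \<gamma>_def)
  moreover have "\<forall>j\<ge>layer_off ps (Suc d). \<gamma> j = 0" unfolding off' by (auto simp: \<gamma>_def)
  ultimately show ?case using gr unfolding r_def by blast
qed

lemma arch_widths_nth:
  "arch_widths p L N ! 0 = p" "1 \<le> k \<Longrightarrow> k \<le> L \<Longrightarrow> arch_widths p L N ! k = 12 * p * N"
  "arch_widths p L N ! Suc L = 1"
  by (auto simp: arch_widths_def nth_append nth_Cons' )

lemma n_params_eq: "n_params (arch_widths p L N) L = layer_off (arch_widths p L N) L + top_size (arch_widths p L N) L"
  by (simp add: n_params_def layer_off_Suc top_size_def arch_widths_nth)

text \<open>The top layer has weights V, -V and bias B. Sparsity and the bound 1 are claimed only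
  below \<open>layer_off ps L\<close>, since the prior keeps the whole top layer active and
  Gaussian.\<close>

lemma relu_net_params_exist:
  assumes "relu_layers p w L c [u, v]" "w \<le> 12 * p * N" "1 \<le> L" "\<bar>V\<bar> \<le> V'" "\<bar>B\<bar> \<le> V'" "1 \<le> V'"
  defines "ps \<equiv> arch_widths p L N"
  shows "\<exists>\<beta>. (\<forall>j<layer_off ps L. \<bar>\<beta> j\<bar> \<le> 1) \<and> (\<forall>j. \<bar>\<beta> j\<bar> \<le> V') \<and> card {j. j < layer_off ps L \<and> \<beta> j \<noteq> 0} \<le> c \<and>
     (\<forall>z. relu_net L ps \<beta> z = V * (u z - v z) + B)"
proof -
  obtain \<beta> where \<beta>: "\<forall>j. \<bar>\<beta> j\<bar> \<le> 1" "card {j. j < layer_off ps L \<and> \<beta> j \<noteq> 0} \<le> c"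
    "\<And>z i. i < ps ! L \<Longrightarrow> hidden ps \<beta> z L i = (if i < length [u, v] then ([u, v] ! i) z else 0)" "length [u, v] \<le> ps ! L"
    using relu_layers_params[OF assms(1), of ps] assms(2,3) by (auto simp: ps_def arch_widths_nth)
  define q where "q = ps ! L"
  define off where "off = layer_off ps L"
  have psS: "ps ! Suc L = 1" by (simp add: ps_def arch_widths_nth)
  have q2: "2 \<le> q" using \<beta>(4) by (simp add: q_def)
  define \<gamma> where "\<gamma> = (\<lambda>x. if x < off then \<beta> x else if x = off then V else if x = off + 1 then - V else if x = off + q then B else 0)"
  have hid: "hidden ps \<gamma> z L i = (if i < 2 then ([u, v] ! i) z else 0)" if "i < q" for z i
    using hidden_cong[of ps L \<gamma> \<beta> i z] \<beta>(3)[of i z] that by (simp add: \<gamma>_def off_def q_def)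
  have "relu_net L ps \<gamma> z = V * (u z - v z) + B" for z
  proof -
    have "(\<Sum>j<q. wt ps \<gamma> L 0 j * hidden ps \<gamma> z L j) = (\<Sum>j<2. wt ps \<gamma> L 0 j * hidden ps \<gamma> z L j)"
      using q2 hid by (intro sum.mono_neutral_right) auto
    also have "\<dots> = V * u z - V * v z"
      using q2 hid by (simp add: numeral_2_eq_2 wt_def off_def[symmetric] \<gamma>_def)
    moreover have "bs ps \<gamma> L 0 = B"
      using q2 psS by (simp add: bs_def off_def[symmetric] q_def[symmetric] \<gamma>_def)
    ultimately show ?thesis unfolding relu_net_def q_def[symmetric] by (simp add: algebra_simps)
  qed
  moreover have "{j. j < off \<and> \<gamma> j \<noteq> 0} = {j. j < off \<and> \<beta> j \<noteq> 0}" by (auto simp: \<gamma>_def)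
  moreover have "\<forall>j<off. \<bar>\<gamma> j\<bar> \<le> 1" "\<forall>j. \<bar>\<gamma> j\<bar> \<le> V'"
    using \<beta>(1) assms(4-6) by (auto simp: \<gamma>_def intro: order_trans)
  ultimately show ?thesis using \<beta>(2) unfolding off_def by (intro exI[of _ \<gamma>]) auto
qed

subsection \<open>Lipschitz dependence on the parameters\<close>

lemma affine_perturbation:
  fixes a a' h h' :: "nat \<Rightarrow> real"
  assumes "\<And>j. j < q \<Longrightarrow> \<bar>a j\<bar> \<le> R \<and> \<bar>a' j\<bar> \<le> R \<and> \<bar>a j - a' j\<bar> \<le> \<eta>" "\<bar>b\<bar> \<le> R" "\<bar>b - b'\<bar> \<le> \<eta>"
    "\<And>j. j < q \<Longrightarrow> \<bar>h j\<bar> \<le> H \<and> \<bar>h j - h' j\<bar> \<le> \<Delta>" "q \<le> w" "1 \<le> H" "0 \<le> \<Delta>" "0 \<le> R"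
  shows "\<bar>(\<Sum>j<q. a j * h j) + b\<bar> \<le> (real w + 1) * R * H"
    "\<bar>((\<Sum>j<q. a j * h j) + b) - ((\<Sum>j<q. a' j * h' j) + b')\<bar> \<le> (real w + 1) * \<eta> * H + (real w + 1) * R * \<Delta>"
proof -
  have \<eta>: "0 \<le> \<eta>" using assms(3) by linarith
  have "\<bar>\<Sum>j<q. a j * h j\<bar> \<le> (\<Sum>j<q. R * H)"
    by (intro order_trans[OF sum_abs] sum_mono) (use assms in \<open>auto simp: abs_mult intro!: mult_mono\<close>)
  also have "\<dots> \<le> real w * (R * H)" using assms by (auto intro!: mult_right_mono)
  finally have 1: "\<bar>\<Sum>j<q. a j * h j\<bar> \<le> real w * (R * H)" .
  have "R * 1 \<le> R * H" using assms by (intro mult_left_mono) auto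
  then show "\<bar>(\<Sum>j<q. a j * h j) + b\<bar> \<le> (real w + 1) * R * H" using 1 assms(2) by (simp add: algebra_simps)
  have "\<bar>\<Sum>j<q. a j * h j - a' j * h' j\<bar> \<le> (\<Sum>j<q. \<eta> * H + R * \<Delta>)"
  proof (intro order_trans[OF sum_abs] sum_mono)
    fix j assume "j \<in> {..<q}"
    then have j: "j < q" by auto
    have "a j * h j - a' j * h' j = (a j - a' j) * h j + a' j * (h j - h' j)" by (simp add: algebra_simps)
    also have "\<bar>\<dots>\<bar> \<le> \<bar>a j - a' j\<bar> * \<bar>h j\<bar> + \<bar>a' j\<bar> * \<bar>h j - h' j\<bar>"
      by (rule order_trans[OF abs_triangle_ineq]) (simp add: abs_mult)
    also have "\<dots> \<le> \<eta> * H + R * \<Delta>" using assms(1)[OF j] assms(4)[OF j] \<eta> assms(8) by (intro add_mono mult_mono) auto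
    finally show "\<bar>a j * h j - a' j * h' j\<bar> \<le> \<eta> * H + R * \<Delta>" .
  qed
  also have "\<dots> \<le> real w * (\<eta> * H + R * \<Delta>)" using assms \<eta> by (auto intro!: mult_right_mono add_nonneg_nonneg mult_nonneg_nonneg)
  finally have "\<bar>(\<Sum>j<q. a j * h j) - (\<Sum>j<q. a' j * h' j)\<bar> \<le> real w * (\<eta> * H + R * \<Delta>)" by (simp add: sum_subtractf)
  moreover have "\<eta> * 1 \<le> \<eta> * H" "0 \<le> R * \<Delta>" using mult_left_mono[OF assms(6) \<eta>] assms(7,8) by auto
  ultimately show "\<bar>((\<Sum>j<q. a j * h j) + b) - ((\<Sum>j<q. a' j * h' j) + b')\<bar> \<le> (real w + 1) * \<eta> * H + (real w + 1) * R * \<Delta>"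
    using assms(3) by (simp add: algebra_simps)
qed

text \<open>Size and error are propagated together. An affine layer expands by at most
  \<open>Q\<close> and ReLU is 1-Lipschitz, so a layer multiplies the old error by \<open>Q\<close>
  and adds at most \<eta> times the next power of \<open>Q\<close>.\<close>

lemma hidden_perturbation:
  assumes "\<And>j. j < layer_off ps d \<Longrightarrow> \<bar>\<beta> j\<bar> \<le> R \<and> \<bar>\<beta>' j\<bar> \<le> R \<and> \<bar>\<beta> j - \<beta>' j\<bar> \<le> \<eta>"
    "\<And>k. k \<le> d \<Longrightarrow> ps ! k \<le> w" "ps ! 0 = p" "z \<in> cube p" "1 \<le> R" "0 \<le> \<eta>" "i < ps ! d"
  defines "Q \<equiv> (real w + 1) * R"
  shows "\<bar>hidden ps \<beta> z d i\<bar> \<le> Q ^ d \<and> \<bar>hidden ps \<beta> z d i - hidden ps \<beta>' z d i\<bar> \<le> real d * \<eta> * Q ^ d"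
  using assms(1-2,7)
proof (induction d arbitrary: i)
  case 0
  then show ?case using assms(3,4) by (auto simp: cube_def)
next
  case (Suc d)
  have Q: "1 \<le> Q" using assms(5) mult_mono[of 1 "real w + 1" 1 R] unfolding Q_def by simp
  have IH: "\<bar>hidden ps \<beta> z d j\<bar> \<le> Q ^ d \<and> \<bar>hidden ps \<beta> z d j - hidden ps \<beta>' z d j\<bar> \<le> real d * \<eta> * Q ^ d" if "j < ps ! d" for j
    by (rule Suc.IH) (use Suc.prems that layer_off_mono[of d "Suc d" ps] in auto)
  have w: "\<bar>wt ps \<beta> d i j\<bar> \<le> R \<and> \<bar>wt ps \<beta>' d i j\<bar> \<le> R \<and> \<bar>wt ps \<beta> d i j - wt ps \<beta>' d i j\<bar> \<le> \<eta>" if "j < ps ! d" for j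
    unfolding wt_def using Suc.prems(1) weight_index_less Suc.prems(3) that by blast
  have b: "\<bar>bs ps \<beta> d i\<bar> \<le> R" "\<bar>bs ps \<beta> d i - bs ps \<beta>' d i\<bar> \<le> \<eta>"
    unfolding bs_def using Suc.prems(1)[OF bias_index_less[OF Suc.prems(3)]] by auto
  define A where "A = (\<Sum>j<ps ! d. wt ps \<beta> d i j * hidden ps \<beta> z d j) + bs ps \<beta> d i"
  define A' where "A' = (\<Sum>j<ps ! d. wt ps \<beta>' d i j * hidden ps \<beta>' z d j) + bs ps \<beta>' d i"
  have A: "\<bar>A\<bar> \<le> (real w + 1) * R * Q ^ d"
    "\<bar>A - A'\<bar> \<le> (real w + 1) * \<eta> * Q ^ d + (real w + 1) * R * (real d * \<eta> * Q ^ d)"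
    unfolding A_def A'_def
    by (rule affine_perturbation[where a' = "wt ps \<beta>' d i" and b' = "bs ps \<beta>' d i" and h' = "hidden ps \<beta>' z d"
          and \<eta> = \<eta> and \<Delta> = "real d * \<eta> * Q ^ d"]; use w b IH Suc.prems(2)[of d] assms(5,6) Q in auto)+
  have "(real w + 1) * \<eta> * Q ^ d \<le> Q * \<eta> * Q ^ d"
    using assms(5,6) Q mult_left_mono[of 1 R "real w + 1"] unfolding Q_def[symmetric]
    by (intro mult_right_mono) (auto simp: Q_def)
  then have "\<bar>A - A'\<bar> \<le> real (Suc d) * \<eta> * Q ^ Suc d" using A(2) unfolding Q_def[symmetric] by (simp add: algebra_simps)
  moreover have "\<bar>A\<bar> \<le> Q ^ Suc d" using A(1) unfolding Q_def[symmetric] by simp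
  ultimately show ?case unfolding hidden.simps A_def[symmetric] A'_def[symmetric] by auto
qed

lemma relu_net_perturbation:
  assumes "\<And>j. j < n_params ps L \<Longrightarrow> \<bar>\<beta> j\<bar> \<le> R \<and> \<bar>\<beta>' j\<bar> \<le> R \<and> \<bar>\<beta> j - \<beta>' j\<bar> \<le> \<eta>"
    "\<And>k. k \<le> L \<Longrightarrow> ps ! k \<le> w" "ps ! 0 = p" "ps ! Suc L = 1" "z \<in> cube p" "1 \<le> R" "0 \<le> \<eta>"
  defines "Q \<equiv> (real w + 1) * R"
  shows "\<bar>relu_net L ps \<beta> z - relu_net L ps \<beta>' z\<bar> \<le> real (Suc L) * \<eta> * Q ^ Suc L"
proof -
  have Q: "1 \<le> Q" using assms(6) mult_mono[of 1 "real w + 1" 1 R] unfolding Q_def by simp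
  have h: "\<bar>hidden ps \<beta> z L j\<bar> \<le> Q ^ L \<and> \<bar>hidden ps \<beta> z L j - hidden ps \<beta>' z L j\<bar> \<le> real L * \<eta> * Q ^ L" if "j < ps ! L" for j
    unfolding Q_def
    by (rule hidden_perturbation[where p = p]) (use assms that layer_off_mono[of L "Suc L" ps] in \<open>auto simp: n_params_def\<close>)
  have w: "\<bar>wt ps \<beta> L 0 j\<bar> \<le> R \<and> \<bar>wt ps \<beta>' L 0 j\<bar> \<le> R \<and> \<bar>wt ps \<beta> L 0 j - wt ps \<beta>' L 0 j\<bar> \<le> \<eta>" if "j < ps ! L" for j
    unfolding wt_def using assms(1) weight_index_less[of 0 ps L j] assms(4) that by (auto simp: n_params_def)
  have b: "\<bar>bs ps \<beta> L 0\<bar> \<le> R" "\<bar>bs ps \<beta> L 0 - bs ps \<beta>' L 0\<bar> \<le> \<eta>"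
    unfolding bs_def using assms(1) bias_index_less[of 0 ps L] assms(4) by (auto simp: n_params_def)
  have "\<bar>relu_net L ps \<beta> z - relu_net L ps \<beta>' z\<bar> \<le> (real w + 1) * \<eta> * Q ^ L + (real w + 1) * R * (real L * \<eta> * Q ^ L)"
    unfolding relu_net_def
    by (rule affine_perturbation(2)) (use w b h assms Q in auto)
  moreover have "(real w + 1) * \<eta> * Q ^ L \<le> Q * \<eta> * Q ^ L"
    using assms(6,7) Q mult_left_mono[of 1 R "real w + 1"] by (intro mult_right_mono) (auto simp: Q_def)
  ultimately show ?thesis unfolding Q_def[symmetric] by (simp add: algebra_simps)
qed

subsection \<open>The regression model\<close>

text \<open>Exponential tilting: the factor exp(t(y - m)) moves the mean to m + t at the price of
  the constant exp(t^2/2).\<close>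

lemma nn_integral_exp_gaussian:
  "(\<integral>\<^sup>+ y. ennreal (exp (t * (y - m))) \<partial>density lborel (normal_density m 1)) = ennreal (exp (t\<^sup>2 / 2))"
proof -
  have eq: "normal_density m 1 y * exp (t * (y - m)) = exp (t\<^sup>2 / 2) * normal_density (m + t) 1 y" for y
    by (simp add: normal_density_def exp_add[symmetric] field_simps power2_eq_square)
  have one: "(\<integral>\<^sup>+ y. ennreal (normal_density (m + t) 1 y) \<partial>lborel) = 1"
    using prob_space.emeasure_space_1[OF prob_space_normal_density[of 1 "m + t"]] by (simp add: emeasure_density)
  have "(\<integral>\<^sup>+ y. ennreal (exp (t * (y - m))) \<partial>density lborel (normal_density m 1))
     = (\<integral>\<^sup>+ y. ennreal (exp (t\<^sup>2 / 2)) * ennreal (normal_density (m + t) 1 y) \<partial>lborel)"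
    by (subst nn_integral_density) (auto simp: ennreal_mult'[symmetric] eq)
  also have "\<dots> = ennreal (exp (t\<^sup>2 / 2))" by (subst nn_integral_cmult) (auto simp: one)
  finally show ?thesis .
qed

lemma prob_space_data_law: "prob_space (data_law f xs n)"
  unfolding data_law_def by (intro prob_space_PiM prob_space_normal_density) simp

lemma sets_data_law [measurable_cong]: "sets (data_law f xs n) = sets (PiM {..<n} (\<lambda>_. borel))"
  unfolding data_law_def by (intro sets_PiM_cong) auto

text \<open>Exponential Markov inequality with parameter 1; other parameters are obtained by
  rescaling \<open>g\<close> and \<open>c\<close>.\<close>

lemma data_law_chernoff:
  "{Y \<in> space (data_law f xs n). c \<le> (\<Sum>i<n. g i * (Y i - f (xs i)))} \<in> sets (data_law f xs n)"
  "measure (data_law f xs n) {Y \<in> space (data_law f xs n). c \<le> (\<Sum>i<n. g i * (Y i - f (xs i)))}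
     \<le> exp ((\<Sum>i<n. (g i)\<^sup>2) / 2 - c)"
proof -
  let ?P = "data_law f xs n"
  interpret P: prob_space ?P by (rule prob_space_data_law)
  interpret S: product_sigma_finite "\<lambda>i. density lborel (normal_density (f (xs i)) 1)"
    unfolding product_sigma_finite_def by (auto intro!: prob_space_imp_sigma_finite prob_space_normal_density)
  let ?A = "{Y \<in> space ?P. c \<le> (\<Sum>i<n. g i * (Y i - f (xs i)))}"
  show A: "?A \<in> sets ?P" by measurable
  have "emeasure ?P ?A = (\<integral>\<^sup>+ Y. indicator ?A Y \<partial>?P)" using A by simp
  also have "\<dots> \<le> (\<integral>\<^sup>+ Y. ennreal (exp (- c)) * (\<Prod>i<n. ennreal (exp (g i * (Y i - f (xs i))))) \<partial>?P)"
  proof (rule nn_integral_mono)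
    fix Y
    have "indicator ?A Y \<le> ennreal (exp ((\<Sum>i<n. g i * (Y i - f (xs i))) - c))"
      by (auto simp: indicator_def)
    also have "exp ((\<Sum>i<n. g i * (Y i - f (xs i))) - c) = exp (- c) * (\<Prod>i<n. exp (g i * (Y i - f (xs i))))"
      by (simp add: exp_sum[symmetric] exp_add[symmetric])
    finally show "indicator ?A Y \<le> ennreal (exp (- c)) * (\<Prod>i<n. ennreal (exp (g i * (Y i - f (xs i)))))"
      by (simp add: ennreal_mult' prod_ennreal)
  qed
  also have "\<dots> = ennreal (exp (- c)) * (\<integral>\<^sup>+ Y. (\<Prod>i<n. ennreal (exp (g i * (Y i - f (xs i))))) \<partial>?P)"
    by (rule nn_integral_cmult) measurable
  also have "(\<integral>\<^sup>+ Y. (\<Prod>i<n. ennreal (exp (g i * (Y i - f (xs i))))) \<partial>?P)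
     = (\<Prod>i<n. \<integral>\<^sup>+ y. ennreal (exp (g i * (y - f (xs i)))) \<partial>density lborel (normal_density (f (xs i)) 1))"
    unfolding data_law_def
    by (rule S.product_nn_integral_prod[of "{..<n}" "\<lambda>i y. ennreal (exp (g i * (y - f (xs i))))"]) auto
  also have "ennreal (exp (- c)) * \<dots> = ennreal (exp ((\<Sum>i<n. (g i)\<^sup>2) / 2 - c))"
    by (simp add: nn_integral_exp_gaussian prod_ennreal ennreal_mult'[symmetric] exp_sum[symmetric]
        exp_add[symmetric] sum_divide_distrib[symmetric])
  finally show "measure ?P ?A \<le> exp ((\<Sum>i<n. (g i)\<^sup>2) / 2 - c)"
    by (simp add: P.emeasure_eq_measure)
qed

section \<open>Likelihood ratios and the noise events that control them\<close>

definition loglik_ratio :: "nat \<Rightarrow> (nat \<Rightarrow> nat \<Rightarrow> real) \<Rightarrow> fn \<Rightarrow> (nat \<Rightarrow> real) \<Rightarrow> fn \<Rightarrow> real" where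
  "loglik_ratio n xs f0 Y f = (\<Sum>i<n. (Y i - f0 (xs i)) * (f (xs i) - f0 (xs i))) - (\<Sum>i<n. (f (xs i) - f0 (xs i))\<^sup>2) / 2"

lemma lik_eq: "lik n xs Y f = lik n xs Y f0 * exp (loglik_ratio n xs f0 Y f)"
proof -
  have "loglik_ratio n xs f0 Y f = (\<Sum>i<n. (Y i - f0 (xs i)) * (f (xs i) - f0 (xs i)) - (f (xs i) - f0 (xs i))\<^sup>2 / 2)"
    by (simp add: loglik_ratio_def sum_subtractf sum_divide_distrib)
  then have "lik n xs Y f0 * exp (loglik_ratio n xs f0 Y f) =
    (\<Prod>i<n. std_normal_density (Y i - f0 (xs i)) * exp ((Y i - f0 (xs i)) * (f (xs i) - f0 (xs i)) - (f (xs i) - f0 (xs i))\<^sup>2 / 2))"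
    by (simp add: lik_def exp_sum prod.distrib)
  also have "\<dots> = lik n xs Y f"
    unfolding lik_def std_normal_density_def
    by (intro prod.cong) (auto simp: mult.assoc exp_add[symmetric] field_simps power2_eq_square)
  finally show ?thesis by simp
qed

lemma lik_pos: "0 < lik n xs Y f"
  unfolding lik_def by (intro prod_pos) (auto simp: normal_density_pos)

text \<open>The crude bound on each error serves to move between a function and a nearby net point,
  and off the sieve. The second condition protects the denominator of the posterior, with
  \<open>g\<close> the approximant; the third controls the numerator on the finite net
  \<open>N\<close>.\<close>

definition good_noise :: "nat \<Rightarrow> (nat \<Rightarrow> nat \<Rightarrow> real) \<Rightarrow> fn \<Rightarrow> fn \<Rightarrow> fn set \<Rightarrow> real \<Rightarrow> real \<Rightarrow> (nat \<Rightarrow> real) \<Rightarrow> bool" where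
  "good_noise n xs f0 g N E X Y \<longleftrightarrow> (\<forall>i<n. \<bar>Y i - f0 (xs i)\<bar> \<le> real n) \<and>
     - E \<le> (\<Sum>i<n. (Y i - f0 (xs i)) * (g (xs i) - f0 (xs i))) \<and>
     (\<forall>h\<in>N. X \<le> (\<Sum>i<n. (h (xs i) - f0 (xs i))\<^sup>2) \<longrightarrow>
        (\<Sum>i<n. (Y i - f0 (xs i)) * (h (xs i) - f0 (xs i))) \<le> (\<Sum>i<n. (h (xs i) - f0 (xs i))\<^sup>2) / 4)"

text \<open>A measurable exceptional set is produced because the later event about the posterior is
  not shown to be measurable; inclusion in \<open>Z\<close> is enough.\<close>

lemma good_noise_prob:
  assumes "finite N" "(\<Sum>i<n. (g (xs i) - f0 (xs i))\<^sup>2) \<le> E"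
  defines "P \<equiv> data_law f0 xs n"
  shows "\<exists>Z\<in>sets P. measure P Z \<le> 2 * real n * exp (- (real n)\<^sup>2 / 2) + exp (- E / 2) + real (card N) * exp (- X / 32) \<and>
     (\<forall>Y\<in>space P - Z. good_noise n xs f0 g N E X Y)"
proof -
  interpret P: prob_space P unfolding P_def by (rule prob_space_data_law)
  define C where "C = (\<lambda>v c. {Y \<in> space P. c \<le> (\<Sum>i<n. v i * (Y i - f0 (xs i)))})"
  have C: "C v c \<in> sets P" "measure P (C v c) \<le> exp ((\<Sum>i<n. (v i)\<^sup>2) / 2 - c)" for v c
    unfolding C_def P_def by (rule data_law_chernoff)+
  define S where "S = (\<lambda>h::fn. \<Sum>i<n. (h (xs i) - f0 (xs i))\<^sup>2)"
  \<comment> \<open>Coefficient n and threshold n^2 express that the i-th error is at least n, with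
    the Chernoff bound exp(-n^2/2).\<close>
  define Z1 where "Z1 = (\<Union>i<n. C (\<lambda>j. if j = i then real n else 0) ((real n)\<^sup>2) \<union> C (\<lambda>j. if j = i then - real n else 0) ((real n)\<^sup>2))"
  define Z2 where "Z2 = C (\<lambda>i. - (g (xs i) - f0 (xs i))) E"
  define N' where "N' = {h \<in> N. X \<le> S h}"
  \<comment> \<open>The event is that the correlation is at least S/4. Scaling by 1/4 is the best
    exponential parameter and leaves S/32 - S/16 = -S/32.\<close>
  define Z3 where "Z3 = (\<Union>h\<in>N'. C (\<lambda>i. (h (xs i) - f0 (xs i)) / 4) (S h / 16))"
  have fin: "finite N'" using assms(1) by (simp add: N'_def)
  have Z: "Z1 \<in> sets P" "Z2 \<in> sets P" "Z3 \<in> sets P"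
    unfolding Z1_def Z2_def Z3_def using C(1) fin by (auto intro!: sets.finite_UN sets.Un)
  have s1: "(\<Sum>i<n. 2 * exp (- (real n)\<^sup>2 / 2)) = 2 * real n * exp (- (real n)\<^sup>2 / 2)" by simp
  have "measure P Z1 \<le> (\<Sum>i<n. 2 * exp (- (real n)\<^sup>2 / 2))"
    unfolding Z1_def
  proof (intro order_trans[OF P.finite_measure_subadditive_finite] sum_mono)
    fix i assume i: "i \<in> {..<n}"
    have "measure P (C (\<lambda>j. if j = i then v else 0) ((real n)\<^sup>2)) \<le> exp (- (real n)\<^sup>2 / 2)" if "v\<^sup>2 = (real n)\<^sup>2" for v
    proof -
      have "(\<Sum>j<n. (if j = i then v else 0)\<^sup>2) = (real n)\<^sup>2" using i that by (simp add: if_distrib[of "\<lambda>t. t\<^sup>2"] cong: if_cong)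
      then show ?thesis using C(2)[of "\<lambda>j. if j = i then v else 0" "(real n)\<^sup>2"] by simp
    qed
    from this[of "real n"] this[of "- real n"]
    have "measure P (C (\<lambda>j. if j = i then real n else 0) ((real n)\<^sup>2)) + measure P (C (\<lambda>j. if j = i then - real n else 0) ((real n)\<^sup>2))
       \<le> 2 * exp (- (real n)\<^sup>2 / 2)" by simp
    then show "measure P (C (\<lambda>j. if j = i then real n else 0) ((real n)\<^sup>2) \<union> C (\<lambda>j. if j = i then - real n else 0) ((real n)\<^sup>2)) \<le> 2 * exp (- (real n)\<^sup>2 / 2)"
      using measure_Un_le[OF C(1) C(1)] order_trans by blast
  qed (use C(1) in auto)
  moreover have "measure P Z2 \<le> exp (- E / 2)"
    unfolding Z2_def by (rule order_trans[OF C(2)]) (use assms(2) in \<open>simp add: power2_commute\<close>)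
  moreover have "measure P Z3 \<le> (\<Sum>h\<in>N'. exp (- X / 32))"
    unfolding Z3_def
  proof (intro order_trans[OF P.finite_measure_subadditive_finite] sum_mono)
    fix h assume "h \<in> N'"
    then have h: "X \<le> S h" by (simp add: N'_def)
    have "(\<Sum>i<n. ((h (xs i) - f0 (xs i)) / 4)\<^sup>2) = S h / 16"
      unfolding S_def by (simp add: power_divide sum_divide_distrib)
    then have "(\<Sum>i<n. ((h (xs i) - f0 (xs i)) / 4)\<^sup>2) / 2 - S h / 16 \<le> - X / 32" using h by simp
    then show "measure P (C (\<lambda>i. (h (xs i) - f0 (xs i)) / 4) (S h / 16)) \<le> exp (- X / 32)"
      by (intro order_trans[OF C(2)]) simp
  qed (use C(1) fin in auto)
  moreover have "(\<Sum>h\<in>N'. exp (- X / 32)) \<le> real (card N) * exp (- X / 32)"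
    using assms(1) by (auto simp: N'_def intro!: mult_right_mono card_mono)
  moreover have "measure P (Z1 \<union> Z2 \<union> Z3) \<le> measure P Z1 + measure P Z2 + measure P Z3"
    
    using measure_Un_le[of "Z1 \<union> Z2" P Z3] measure_Un_le[of Z1 P Z2] Z by auto
  ultimately have "measure P (Z1 \<union> Z2 \<union> Z3) \<le> 2 * real n * exp (- (real n)\<^sup>2 / 2) + exp (- E / 2) + real (card N) * exp (- X / 32)"
    using s1 by linarith
  moreover have "good_noise n xs f0 g N E X Y" if Y: "Y \<in> space P - (Z1 \<union> Z2 \<union> Z3)" for Y
    unfolding good_noise_def
  proof (intro conjI allI impI ballI)
    fix i assume i: "i < n"
    have "Y \<notin> C (\<lambda>j. if j = i then v else 0) ((real n)\<^sup>2)" if "v = real n \<or> v = - real n" for v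
      using Y i that unfolding Z1_def by auto
    then have "v * (Y i - f0 (xs i)) < (real n)\<^sup>2" if "v = real n \<or> v = - real n" for v
      using that Y i by (force simp: C_def if_distrib[of "\<lambda>t. t * _"] not_le cong: if_cong)
    from this[of "real n"] this[of "- real n"]
    have "real n * \<bar>Y i - f0 (xs i)\<bar> < real n * real n" by (auto simp: abs_if power2_eq_square algebra_simps)
    then show "\<bar>Y i - f0 (xs i)\<bar> \<le> real n" using i by simp
  next
    have "Y \<notin> Z2" using Y by auto
    then show "- E \<le> (\<Sum>i<n. (Y i - f0 (xs i)) * (g (xs i) - f0 (xs i)))"
      using Y unfolding Z2_def C_def by (simp add: sum_negf[symmetric] algebra_simps not_le)
         (simp add: sum_subtractf sum.distrib algebra_simps)
  next
    fix h assume "h \<in> N" "X \<le> (\<Sum>i<n. (h (xs i) - f0 (xs i))\<^sup>2)"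
    then have "Y \<notin> C (\<lambda>i. (h (xs i) - f0 (xs i)) / 4) (S h / 16)" using Y by (auto simp: Z3_def N'_def S_def)
    then have "(\<Sum>i<n. (h (xs i) - f0 (xs i)) / 4 * (Y i - f0 (xs i))) < S h / 16" using Y by (auto simp: C_def)
    moreover have "(\<Sum>i<n. (h (xs i) - f0 (xs i)) / 4 * (Y i - f0 (xs i))) = (\<Sum>i<n. (Y i - f0 (xs i)) * (h (xs i) - f0 (xs i))) / 4"
      by (simp add: sum_divide_distrib mult.commute)
    ultimately show "(\<Sum>i<n. (Y i - f0 (xs i)) * (h (xs i) - f0 (xs i))) \<le> (\<Sum>i<n. (h (xs i) - f0 (xs i))\<^sup>2) / 4"
      unfolding S_def by simp
  qed
  ultimately show ?thesis using Z by (intro bexI[of _ "Z1 \<union> Z2 \<union> Z3"]) auto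
qed

lemma noise_correlation_close:
  fixes f h :: fn
  assumes "\<forall>i<n. \<bar>Y i - f0 (xs i)\<bar> \<le> real n" "\<forall>i<n. \<bar>f (xs i) - h (xs i)\<bar> \<le> \<tau>" "(real n)\<^sup>2 * \<tau> \<le> 1"
  shows "\<bar>(\<Sum>i<n. (Y i - f0 (xs i)) * (f (xs i) - f0 (xs i))) - (\<Sum>i<n. (Y i - f0 (xs i)) * (h (xs i) - f0 (xs i)))\<bar> \<le> 1"
proof -
  have "(\<Sum>i<n. (Y i - f0 (xs i)) * (f (xs i) - f0 (xs i))) - (\<Sum>i<n. (Y i - f0 (xs i)) * (h (xs i) - f0 (xs i)))
     = (\<Sum>i<n. (Y i - f0 (xs i)) * (f (xs i) - h (xs i)))"
    by (simp add: sum_subtractf[symmetric] algebra_simps)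
  also have "\<bar>\<dots>\<bar> \<le> (\<Sum>i<n. real n * \<tau>)"
    using assms(1,2) by (intro order_trans[OF sum_abs] sum_mono) (auto simp: abs_mult intro!: mult_mono)
  also have "\<dots> \<le> 1" using assms(3) by (simp add: power2_eq_square)
  finally show ?thesis .
qed

lemma square_weighted: "0 < c \<Longrightarrow> (a + b)\<^sup>2 \<le> (1 + c) * a\<^sup>2 + (1 + 1 / c) * (b::real)\<^sup>2"
proof -
  assume c: "0 < c"
  have "0 \<le> (c * a - b)\<^sup>2 / c" using c by simp
  then show ?thesis using c by (simp add: field_simps power2_eq_square)
qed

lemma sum_squares_close:
  fixes f h f0 :: fn
  assumes "\<forall>i<n. \<bar>f (xs i) - h (xs i)\<bar> \<le> \<tau>" "real n * \<tau>\<^sup>2 \<le> 1" "0 < c"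
  shows "(\<Sum>i<n. (f (xs i) - f0 (xs i))\<^sup>2) \<le> (1 + c) * (\<Sum>i<n. (h (xs i) - f0 (xs i))\<^sup>2) + (1 + 1 / c)"
proof -
  have "(\<Sum>i<n. (f (xs i) - f0 (xs i))\<^sup>2) \<le> (\<Sum>i<n. (1 + c) * (h (xs i) - f0 (xs i))\<^sup>2 + (1 + 1 / c) * \<tau>\<^sup>2)"
  proof (rule sum_mono)
    fix i assume "i \<in> {..<n}"
    then have "(f (xs i) - h (xs i))\<^sup>2 \<le> \<tau>\<^sup>2" using assms(1) by (metis abs_le_square_iff abs_of_nonneg abs_ge_zero lessThan_iff order_trans)
    then have "(1 + 1 / c) * (f (xs i) - h (xs i))\<^sup>2 \<le> (1 + 1 / c) * \<tau>\<^sup>2" using assms(3) by (intro mult_left_mono) auto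
    then show "(f (xs i) - f0 (xs i))\<^sup>2 \<le> (1 + c) * (h (xs i) - f0 (xs i))\<^sup>2 + (1 + 1 / c) * \<tau>\<^sup>2"
      using square_weighted[OF assms(3), of "h (xs i) - f0 (xs i)" "f (xs i) - h (xs i)"] by simp
  qed
  also have "\<dots> = (1 + c) * (\<Sum>i<n. (h (xs i) - f0 (xs i))\<^sup>2) + (1 + 1 / c) * (real n * \<tau>\<^sup>2)"
    by (simp add: sum.distrib sum_distrib_left)
  also have "(1 + 1 / c) * (real n * \<tau>\<^sup>2) \<le> (1 + 1 / c) * 1" using assms by (intro mult_left_mono) auto
  finally show ?thesis by simp
qed

text \<open>The noise at \<open>g\<close> contributes -E, the passage from \<open>g\<close> to
  \<open>f\<close> contributes -1, and half the squared distance is at most (2E + 2)/2.\<close>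

lemma loglik_ratio_lower:
  assumes "good_noise n xs f0 g N E X Y" "\<forall>i<n. \<bar>f (xs i) - g (xs i)\<bar> \<le> \<tau>" "(real n)\<^sup>2 * \<tau> \<le> 1"
    "real n * \<tau>\<^sup>2 \<le> 1" "(\<Sum>i<n. (g (xs i) - f0 (xs i))\<^sup>2) \<le> E"
  shows "- (2 * E + 2) \<le> loglik_ratio n xs f0 Y f"
  using noise_correlation_close[of n Y f0 xs f g \<tau>] sum_squares_close[of n f xs g \<tau> 1 f0] assms
  unfolding good_noise_def loglik_ratio_def by auto

text \<open>With S the squared distance of \<open>f\<close>, the correlation is at most 1 + (5/4 S +
  5)/4, so the ratio is at most 9/4 - 3/16 S. Inserting S \<ge> 2X + 2 gives 3/8. The weight 1/4 in
  the square comparison keeps 5/16 below 1/2.\<close>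

lemma loglik_ratio_upper:
  assumes "good_noise n xs f0 g N E X Y" "h \<in> N" "\<forall>i<n. \<bar>f (xs i) - h (xs i)\<bar> \<le> \<tau>" "(real n)\<^sup>2 * \<tau> \<le> 1"
    "real n * \<tau>\<^sup>2 \<le> 1" "2 * X + 2 \<le> (\<Sum>i<n. (f (xs i) - f0 (xs i))\<^sup>2)"
  shows "loglik_ratio n xs f0 Y f \<le> 3 - 3 / 8 * X"
proof -
  have "(\<Sum>i<n. (f (xs i) - f0 (xs i))\<^sup>2) \<le> 2 * (\<Sum>i<n. (h (xs i) - f0 (xs i))\<^sup>2) + 2"
    using sum_squares_close[of n f xs h \<tau> 1 f0] assms by simp
  then have "X \<le> (\<Sum>i<n. (h (xs i) - f0 (xs i))\<^sup>2)" using assms(6) by simp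
  then have 1: "(\<Sum>i<n. (Y i - f0 (xs i)) * (h (xs i) - f0 (xs i))) \<le> (\<Sum>i<n. (h (xs i) - f0 (xs i))\<^sup>2) / 4"
    using assms(1,2) unfolding good_noise_def by blast
  have 2: "(\<Sum>i<n. (h (xs i) - f0 (xs i))\<^sup>2) \<le> 5 / 4 * (\<Sum>i<n. (f (xs i) - f0 (xs i))\<^sup>2) + 5"
    using sum_squares_close[of n h xs f \<tau> "1/4" f0] assms by (simp add: abs_minus_commute)
  have 3: "\<bar>(\<Sum>i<n. (Y i - f0 (xs i)) * (f (xs i) - f0 (xs i))) - (\<Sum>i<n. (Y i - f0 (xs i)) * (h (xs i) - f0 (xs i)))\<bar> \<le> 1"
    by (rule noise_correlation_close) (use assms in \<open>auto simp: good_noise_def\<close>)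
  show ?thesis unfolding loglik_ratio_def using 1 2 3 assms(6) by linarith
qed

text \<open>By e d - d^2/2 \<le> e^2/2, whatever the deviation d of \<open>f\<close>. This is the
  bound where no net point is at hand.\<close>

lemma loglik_ratio_crude:
  assumes "\<forall>i<n. \<bar>Y i - f0 (xs i)\<bar> \<le> real n"
  shows "loglik_ratio n xs f0 Y f \<le> real n ^ 3 / 2"
proof -
  have "loglik_ratio n xs f0 Y f = (\<Sum>i<n. (Y i - f0 (xs i)) * (f (xs i) - f0 (xs i)) - (f (xs i) - f0 (xs i))\<^sup>2 / 2)"
    by (simp add: loglik_ratio_def sum_subtractf sum_divide_distrib)
  also have "\<dots> \<le> (\<Sum>i<n. (real n)\<^sup>2 / 2)"
  proof (rule sum_mono)
    fix i assume "i \<in> {..<n}"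
    then have "(Y i - f0 (xs i))\<^sup>2 \<le> (real n)\<^sup>2" using assms by (metis abs_le_square_iff abs_of_nat lessThan_iff)
    moreover have "e * d - d\<^sup>2 / 2 \<le> e\<^sup>2 / 2" for e d :: real
      using zero_le_power2[of "e - d"] by (simp add: power2_diff)
    ultimately show "(Y i - f0 (xs i)) * (f (xs i) - f0 (xs i)) - (f (xs i) - f0 (xs i))\<^sup>2 / 2 \<le> (real n)\<^sup>2 / 2"
      by (meson divide_right_mono order_trans zero_le_numeral)
  qed
  also have "\<dots> = real n ^ 3 / 2" by (simp add: power2_eq_square power3_eq_cube)
  finally show ?thesis .
qed

text \<open>No measurability of the class is needed: the posterior is 0 by convention as soon as one of
  its two integrands is not integrable. Off the sieve the likelihood ratio is only bounded by
  $\exp(n^3/2)$, which the Gaussian tails of the top layer have to absorb.\<close>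
lemma posterior_bound:
  assumes "prob_space Q" "Sv \<in> sets Q" "B \<in> sets Q" "0 < b" "b \<le> measure Q B"
    and good: "good_noise n xs f0 g N E X Y" and \<tau>: "(real n)\<^sup>2 * \<tau> \<le> 1" "real n * \<tau>\<^sup>2 \<le> 1"
    and gE: "(\<Sum>i<n. (g (xs i) - f0 (xs i))\<^sup>2) \<le> E"
    and B: "\<And>\<beta>. \<beta> \<in> B \<Longrightarrow> net \<beta> \<in> Fc \<and> (\<forall>i<n. \<bar>net \<beta> (xs i) - g (xs i)\<bar> \<le> \<tau>)"
    and Sv: "\<And>\<beta>. \<beta> \<in> Sv \<Longrightarrow> \<exists>h\<in>N. \<forall>i<n. \<bar>net \<beta> (xs i) - h (xs i)\<bar> \<le> \<tau>"
    and A: "\<And>f. f \<in> A \<Longrightarrow> 2 * X + 2 \<le> (\<Sum>i<n. (f (xs i) - f0 (xs i))\<^sup>2)"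
  shows "posterior Q net Fc (lik n xs Y) A \<le>
     (exp (3 - 3 / 8 * X) + exp (real n ^ 3 / 2) * (1 - measure Q Sv)) / (b * exp (- (2 * E + 2)))"
proof -
  interpret prob_space Q by fact
  \<comment> \<open>The likelihood at \<open>f0\<close> is a common factor of both integrals and
    cancels in the quotient.\<close>
  define l0 where "l0 = lik n xs Y f0"
  have l0: "l0 > 0" unfolding l0_def by (rule lik_pos)
  have lik: "lik n xs Y f = l0 * exp (loglik_ratio n xs f0 Y f)" for f
    unfolding l0_def by (rule lik_eq)
  define num where "num = (\<integral>\<beta>. indicator (A \<inter> Fc) (net \<beta>) * lik n xs Y (net \<beta>) \<partial>Q)"
  define den where "den = (\<integral>\<beta>. indicator Fc (net \<beta>) * lik n xs Y (net \<beta>) \<partial>Q)"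
  define u where "u = exp (3 - 3 / 8 * X)"
  define v where "v = exp (real n ^ 3 / 2)"
  have uv: "0 \<le> u" "0 \<le> v" unfolding u_def v_def by auto
  have nonneg: "0 \<le> u + v * (1 - measure Q Sv)" using uv by simp
  have num: "num \<le> l0 * (u + v * (1 - measure Q Sv))"
  proof (cases "integrable Q (\<lambda>\<beta>. indicator (A \<inter> Fc) (net \<beta>) * lik n xs Y (net \<beta>))")
    case True
    have "num \<le> (\<integral>\<beta>. l0 * (u + v * indicator (space Q - Sv) \<beta>) \<partial>Q)"
      unfolding num_def
    proof (rule integral_mono[OF True])
      show "integrable Q (\<lambda>\<beta>. l0 * (u + v * indicator (space Q - Sv) \<beta>))"
        using assms(2) by (intro integrable_mult_right integrable_add) (auto simp: emeasure_eq_measure)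
      fix \<beta> assume \<beta>: "\<beta> \<in> space Q"
      show "indicator (A \<inter> Fc) (net \<beta>) * lik n xs Y (net \<beta>) \<le> l0 * (u + v * indicator (space Q - Sv) \<beta>)"
      proof (cases "net \<beta> \<in> A \<inter> Fc")
        case False
        then show ?thesis using l0 uv by (auto intro!: mult_nonneg_nonneg add_nonneg_nonneg)
      next
        case inA: True
        have "exp (loglik_ratio n xs f0 Y (net \<beta>)) \<le> u + v * indicator (space Q - Sv) \<beta>"
        proof (cases "\<beta> \<in> Sv")
          case True
          from Sv[OF this] obtain h where "h \<in> N" "\<forall>i<n. \<bar>net \<beta> (xs i) - h (xs i)\<bar> \<le> \<tau>" by blast
          then have "loglik_ratio n xs f0 Y (net \<beta>) \<le> 3 - 3 / 8 * X"
            using loglik_ratio_upper[OF good _ _ \<tau>] A inA by blast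
          then have "exp (loglik_ratio n xs f0 Y (net \<beta>)) \<le> u" unfolding u_def by simp
          then show ?thesis using uv by (auto simp: indicator_def)
        next
          case False
          have "loglik_ratio n xs f0 Y (net \<beta>) \<le> real n ^ 3 / 2"
            using good by (intro loglik_ratio_crude) (auto simp: good_noise_def)
          then have "exp (loglik_ratio n xs f0 Y (net \<beta>)) \<le> v" unfolding v_def by simp
          then show ?thesis using uv False \<beta> by (auto simp: indicator_def)
        qed
        then show ?thesis using l0 inA lik by simp
      qed
    qed
    also have "\<dots> = l0 * (u + v * measure Q (space Q - Sv))"
      using assms(2) by (subst Bochner_Integration.integral_mult_right_zero, subst Bochner_Integration.integral_add)
        (auto simp: emeasure_eq_measure prob_space)
    also have "measure Q (space Q - Sv) = 1 - measure Q Sv" using assms(2) by (rule prob_compl)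
    finally show ?thesis .
  next
    case False
    then have "num = 0" unfolding num_def by (rule not_integrable_integral_eq)
    then show ?thesis using l0 nonneg by (auto intro: mult_nonneg_nonneg)
  qed
  show ?thesis
  proof (cases "integrable Q (\<lambda>\<beta>. indicator Fc (net \<beta>) * lik n xs Y (net \<beta>))")
    case True
    have "l0 * exp (- (2 * E + 2)) * b \<le> l0 * exp (- (2 * E + 2)) * measure Q B"
      using assms(5) l0 by (intro mult_left_mono) auto
    also have "\<dots> = (\<integral>\<beta>. l0 * exp (- (2 * E + 2)) * indicator B \<beta> \<partial>Q)"
      using assms(3) sets.sets_into_space[OF assms(3)] by (simp add: Int_absorb1 Int_absorb2)
    also have "\<dots> \<le> den" unfolding den_def
    proof (rule integral_mono[OF _ True])
      show "integrable Q (\<lambda>\<beta>. l0 * exp (- (2 * E + 2)) * indicator B \<beta>)"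
        using assms(3) by (intro integrable_mult_right) (auto simp: emeasure_eq_measure)
      fix \<beta> assume "\<beta> \<in> space Q"
      show "l0 * exp (- (2 * E + 2)) * indicator B \<beta> \<le> indicator Fc (net \<beta>) * lik n xs Y (net \<beta>)"
      proof (cases "\<beta> \<in> B")
        case True
        then have "- (2 * E + 2) \<le> loglik_ratio n xs f0 Y (net \<beta>)"
          using loglik_ratio_lower[OF good _ \<tau> gE] B by blast
        then show ?thesis using True B[OF True] l0 lik by simp
      next
        case False
        then show ?thesis using l0 lik by (auto intro!: mult_nonneg_nonneg)
      qed
    qed
    finally have den: "l0 * exp (- (2 * E + 2)) * b \<le> den" .
    have "num / den \<le> (l0 * (u + v * (1 - measure Q Sv))) / (l0 * exp (- (2 * E + 2)) * b)"
      using num den l0 nonneg assms(4) by (intro frac_le) (auto intro!: mult_nonneg_nonneg)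
    also have "\<dots> = (u + v * (1 - measure Q Sv)) / (b * exp (- (2 * E + 2)))" using l0 by (simp add: mult.commute mult.assoc)
    finally show ?thesis unfolding posterior_def num_def den_def u_def v_def .
  next
    case False
    then have "den = 0" unfolding den_def by (rule not_integrable_integral_eq)
    then have "posterior Q net Fc (lik n xs Y) A = 0" unfolding posterior_def den_def by simp
    then show ?thesis using nonneg assms(4) unfolding u_def v_def by simp
  qed
qed

subsection \<open>The prior\<close>

lemma std_normal_tail:
  assumes "0 \<le> R"
  shows "1 - 2 * exp (- R\<^sup>2 / 2) \<le> measure (density lborel std_normal_density) {- R..R}"
proof -
  let ?M = "density lborel std_normal_density"
  interpret prob_space ?M by (rule prob_space_normal_density) simp
  have tail: "measure ?M {y. R\<^sup>2 \<le> t * y} \<le> exp (- R\<^sup>2 / 2)" if "t\<^sup>2 = R\<^sup>2" for t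
  proof -
    have "emeasure ?M {y. R\<^sup>2 \<le> t * y} = (\<integral>\<^sup>+ y. indicator {y. R\<^sup>2 \<le> t * y} y \<partial>?M)" by simp
    also have "\<dots> \<le> (\<integral>\<^sup>+ y. ennreal (exp (- R\<^sup>2)) * ennreal (exp (t * (y - 0))) \<partial>?M)"
      by (intro nn_integral_mono) (auto simp: indicator_def ennreal_mult'[symmetric] exp_add[symmetric])
    also have "\<dots> = ennreal (exp (- R\<^sup>2)) * ennreal (exp (t\<^sup>2 / 2))"
      by (subst nn_integral_cmult) (simp, simp only: nn_integral_exp_gaussian)
    also have "\<dots> = ennreal (exp (- R\<^sup>2 / 2))" by (simp add: that ennreal_mult'[symmetric] exp_add[symmetric])
    finally show ?thesis by (simp add: emeasure_eq_measure)
  qed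
  have "space ?M - {- R..R} \<subseteq> {y. R\<^sup>2 \<le> R * y} \<union> {y. R\<^sup>2 \<le> - R * y}"
  proof
    fix y assume "y \<in> space ?M - {- R..R}"
    then consider "R \<le> y" | "R \<le> - y" by fastforce
    then show "y \<in> {y. R\<^sup>2 \<le> R * y} \<union> {y. R\<^sup>2 \<le> - R * y}"
      using mult_left_mono[OF _ assms, of R y] mult_left_mono[OF _ assms, of R "- y"]
      by cases (auto simp: power2_eq_square)
  qed
  then have "measure ?M (space ?M - {- R..R}) \<le> measure ?M ({y. R\<^sup>2 \<le> R * y} \<union> {y. R\<^sup>2 \<le> - R * y})"
    by (intro finite_measure_mono) auto
  also have "\<dots> \<le> measure ?M {y. R\<^sup>2 \<le> R * y} + measure ?M {y. R\<^sup>2 \<le> - R * y}"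
    by (rule measure_Un_le) auto
  also have "\<dots> \<le> 2 * exp (- R\<^sup>2 / 2)" using tail[of R] tail[of "- R"] by simp
  finally show ?thesis using prob_compl[of "{- R..R}"] by simp
qed

lemma std_normal_interval:
  assumes "\<bar>b\<bar> \<le> V" "0 < \<eta>" "\<eta> \<le> 1"
  shows "2 * \<eta> * std_normal_density (V + 1) \<le> measure (density lborel std_normal_density) {b - \<eta>..b + \<eta>}"
proof -
  let ?M = "density lborel std_normal_density"
  interpret prob_space ?M by (rule prob_space_normal_density) simp
  have "std_normal_density (V + 1) \<le> std_normal_density y" if "y \<in> {b - \<eta>..b + \<eta>}" for y
  proof -
    have "\<bar>y\<bar> \<le> \<bar>V + 1\<bar>" using that assms by auto
    then have "y\<^sup>2 \<le> (V + 1)\<^sup>2" by (simp add: abs_le_square_iff)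
    then show ?thesis by (simp add: std_normal_density_def divide_right_mono)
  qed
  then have "(\<integral>\<^sup>+ y. ennreal (std_normal_density (V + 1)) * indicator {b - \<eta>..b + \<eta>} y \<partial>lborel)
      \<le> (\<integral>\<^sup>+ y. ennreal (std_normal_density y) * indicator {b - \<eta>..b + \<eta>} y \<partial>lborel)"
    by (intro nn_integral_mono) (auto simp: indicator_def intro!: ennreal_leI)
  also have "\<dots> = emeasure ?M {b - \<eta>..b + \<eta>}" by (simp add: emeasure_density)
  also have "(\<integral>\<^sup>+ y. ennreal (std_normal_density (V + 1)) * indicator {b - \<eta>..b + \<eta>} y \<partial>lborel)
     = ennreal (2 * \<eta> * std_normal_density (V + 1))"
    using assms by (subst nn_integral_cmult) (simp_all add: ennreal_mult'[symmetric] mult.commute)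
  finally show ?thesis using assms by (simp add: emeasure_eq_measure)
qed

lemma uniform_interval:
  assumes "\<bar>b\<bar> \<le> 1" "0 < \<eta>" "\<eta> \<le> 1"
  shows "\<eta> / 2 \<le> measure (uniform_measure lborel {-1..1::real}) {b - \<eta>..b + \<eta>}"
proof -
  \<comment> \<open>The half of the interval that points towards 0 stays inside [-1,1], and the
    density there is 1/2.\<close>
  define c where "c = (if 0 \<le> b then b - \<eta> else b)"
  have "{c..c + \<eta>} \<subseteq> {-1..1} \<inter> {b - \<eta>..b + \<eta>}" using assms by (auto simp: c_def split: if_splits)
  moreover have "{-1..1} \<inter> {b - \<eta>..b + \<eta>} = {max (-1) (b - \<eta>)..min 1 (b + \<eta>)}" by auto
  ultimately have "measure lborel {c..c + \<eta>} \<le> measure lborel ({-1..1} \<inter> {b - \<eta>..b + \<eta>})"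
    by (intro measure_mono_fmeasurable) (auto simp: fmeasurable_def emeasure_lborel_Icc_eq)
  then have "\<eta> \<le> measure lborel ({-1..1} \<inter> {b - \<eta>..b + \<eta>})" using assms by simp
  then show ?thesis by (subst measure_uniform_measure) auto
qed

section \<open>The prior as a mixture of product measures\<close>

definition slab_factor :: "nat list \<Rightarrow> nat \<Rightarrow> nat set \<Rightarrow> nat \<Rightarrow> real measure" where
  "slab_factor ps L S j = (if n_params ps L - top_size ps L \<le> j then density lborel std_normal_density
      else if j \<in> S then uniform_measure lborel {-1..1}
      else return lborel 0)"

lemma slab_given_eq: "slab_given ps L S = PiM {..<n_params ps L} (slab_factor ps L S)"
  by (simp add: slab_given_def slab_factor_def[abs_def])

lemma prob_space_slab_factor: "prob_space (slab_factor ps L S j)"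
  unfolding slab_factor_def
  by (auto intro!: prob_space_normal_density prob_space_uniform_measure prob_space_return)

lemma sets_slab_factor [simp, measurable_cong]: "sets (slab_factor ps L S j) = sets borel"
  by (simp add: slab_factor_def)

lemma sets_slab_given: "sets (slab_given ps L S) = sets (PiM {..<n_params ps L} (\<lambda>_. borel))"
  unfolding slab_given_eq by (intro sets_PiM_cong) auto

lemma prob_space_slab_given: "prob_space (slab_given ps L S)"
  unfolding slab_given_eq by (intro prob_space_PiM prob_space_slab_factor)

lemma measure_slab_given_box:
  assumes "\<And>j. j < n_params ps L \<Longrightarrow> E j \<in> sets borel"
  shows "measure (slab_given ps L S) (PiE {..<n_params ps L} E) = (\<Prod>j<n_params ps L. measure (slab_factor ps L S j) (E j))"
proof -
  interpret product_sigma_finite "slab_factor ps L S"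
    unfolding product_sigma_finite_def by (intro allI prob_space_imp_sigma_finite prob_space_slab_factor)
  interpret P: prob_space "slab_given ps L S" by (rule prob_space_slab_given)
  have em: "emeasure (slab_factor ps L S j) A = ennreal (measure (slab_factor ps L S j) A)" for j A
    by (rule finite_measure.emeasure_eq_measure[OF prob_space.finite_measure[OF prob_space_slab_factor]])
  have "emeasure (slab_given ps L S) (PiE {..<n_params ps L} E) = (\<Prod>j<n_params ps L. emeasure (slab_factor ps L S j) (E j))"
    unfolding slab_given_eq by (rule emeasure_PiM) (use assms in auto)
  also have "\<dots> = ennreal (\<Prod>j<n_params ps L. measure (slab_factor ps L S j) (E j))"
    by (simp add: em prod_ennreal)
  finally show ?thesis by (simp add: P.emeasure_eq_measure prod_nonneg)
qed

lemma finite_conn_sets: "finite (conn_sets ps L s)"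
  unfolding conn_sets_def by (rule finite_subset[of _ "Pow {..<n_params ps L - top_size ps L}"]) auto

lemma slab_given_measurable:
  "slab_given ps L \<in> measurable (measure_pmf q) (subprob_algebra (PiM {..<n_params ps L} (\<lambda>_. borel)))"
  using prob_space_slab_given sets_slab_given
  by (auto simp: space_subprob_algebra intro!: prob_space_imp_subprob_space)

lemma sets_ss_prior: "sets (ss_prior ps L s) = sets (PiM {..<n_params ps L} (\<lambda>_. borel))"
  unfolding ss_prior_def by (rule sets_bind) (auto simp: sets_slab_given)

lemma prob_space_ss_prior: "prob_space (ss_prior ps L s)"
  unfolding ss_prior_def
  by (rule prob_space.prob_space_bind[OF prob_space_measure_pmf _ slab_given_measurable]) (auto simp: prob_space_slab_given)

lemma measure_ss_prior:
  assumes "conn_sets ps L s \<noteq> {}" "A \<in> sets (PiM {..<n_params ps L} (\<lambda>_. borel))"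
  shows "measure (ss_prior ps L s) A = (\<Sum>S\<in>conn_sets ps L s. measure (slab_given ps L S) A) / real (card (conn_sets ps L s))"
proof -
  interpret prob_space "ss_prior ps L s" by (rule prob_space_ss_prior)
  have card: "card (conn_sets ps L s) > 0" using assms(1) finite_conn_sets card_gt_0_iff by blast
  have em: "emeasure (slab_given ps L S) A = ennreal (measure (slab_given ps L S) A)" for S
    using prob_space_slab_given[of ps L S] by (simp add: finite_measure.emeasure_eq_measure prob_space.finite_measure)
  have "emeasure (ss_prior ps L s) A = (\<integral>\<^sup>+ S. emeasure (slab_given ps L S) A \<partial>measure_pmf (pmf_of_set (conn_sets ps L s)))"
    unfolding ss_prior_def by (rule emeasure_bind[OF _ slab_given_measurable assms(2)]) auto
  also have "\<dots> = (\<Sum>S\<in>conn_sets ps L s. ennreal (measure (slab_given ps L S) A)) / real (card (conn_sets ps L s))"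
    by (subst nn_integral_pmf_of_set[OF assms(1) finite_conn_sets]) (simp add: em ennreal_of_nat_eq_real_of_nat)
  also have "\<dots> = ennreal ((\<Sum>S\<in>conn_sets ps L s. measure (slab_given ps L S) A) / real (card (conn_sets ps L s)))"
    using card by (simp add: ennreal_of_nat_eq_real_of_nat divide_ennreal sum_nonneg)
  finally show ?thesis by (simp add: emeasure_eq_measure sum_nonneg)
qed

lemma card_conn_sets_le: "card (conn_sets ps L s) \<le> n_params ps L ^ (s - top_size ps L)"
proof -
  have "card (conn_sets ps L s) = (n_params ps L - top_size ps L) choose (s - top_size ps L)"
    unfolding conn_sets_def using n_subsets[of "{..<n_params ps L - top_size ps L}"] by simp
  also have "\<dots> \<le> (n_params ps L - top_size ps L) ^ (s - top_size ps L)"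
    by (cases "s - top_size ps L \<le> n_params ps L - top_size ps L") (auto intro: binomial_le_pow simp: binomial_eq_0)
  also have "\<dots> \<le> n_params ps L ^ (s - top_size ps L)" by (intro power_mono) auto
  finally show ?thesis .
qed

definition param_sieve :: "nat list \<Rightarrow> nat \<Rightarrow> nat \<Rightarrow> real \<Rightarrow> (nat \<Rightarrow> real) set" where
  "param_sieve ps L s R = {\<beta> \<in> space (PiM {..<n_params ps L} (\<lambda>_. borel)).
     (\<forall>j<n_params ps L. \<bar>\<beta> j\<bar> \<le> R) \<and> card {j. j < n_params ps L \<and> \<beta> j \<noteq> 0} \<le> s}"

lemma param_sieve_measurable: "param_sieve ps L s R \<in> sets (PiM {..<n_params ps L} (\<lambda>_. borel))"
proof -
  let ?T = "n_params ps L"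
  have card: "card {j. j < ?T \<and> \<beta> j \<noteq> 0} = (\<Sum>j<?T. if \<beta> j \<noteq> 0 then 1 else 0)" for \<beta> :: "nat \<Rightarrow> real"
    by (simp add: sum.If_cases Int_def)
  show ?thesis unfolding param_sieve_def card by measurable
qed

text \<open>Given a connectivity pattern, sparsity holds almost surely and the uniform and zero
  coordinates never leave [-1,1]. Only the Gaussian top coordinates lose mass, which Bernoulli's
  inequality adds up.\<close>

lemma ss_prior_sieve:
  assumes "conn_sets ps L s \<noteq> {}" "top_size ps L \<le> s" "top_size ps L \<le> n_params ps L" "1 \<le> R"
  shows "1 - real (top_size ps L) * (2 * exp (- R\<^sup>2 / 2)) \<le> measure (ss_prior ps L s) (param_sieve ps L s R)"
proof -
  let ?T = "n_params ps L"
  define tp where "tp = top_size ps L"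
  define v where "v = 1 - real tp * (2 * exp (- R\<^sup>2 / 2))"
  have slab: "v \<le> measure (slab_given ps L S) (param_sieve ps L s R)" if S: "S \<in> conn_sets ps L s" for S
  proof -
    interpret prob_space "slab_given ps L S" by (rule prob_space_slab_given)
    have S': "S \<subseteq> {..<?T - tp}" "card S = s - tp" using S by (auto simp: conn_sets_def tp_def)
    define E where "E = (\<lambda>j. if ?T - tp \<le> j then {- R..R} else if j \<in> S then {-1..1} else {0::real})"
    define t where "t = measure (density lborel std_normal_density) {- R..R}"
    have "PiE {..<?T} E \<subseteq> param_sieve ps L s R"
    proof
      fix \<beta> assume \<beta>: "\<beta> \<in> PiE {..<?T} E"
      have "\<bar>\<beta> j\<bar> \<le> R" if "j < ?T" for j
        using PiE_mem[OF \<beta>, of j] that assms(4) by (auto simp: E_def split: if_splits)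
      moreover have "{j. j < ?T \<and> \<beta> j \<noteq> 0} \<subseteq> S \<union> {?T - tp..<?T}"
      proof
        fix j assume "j \<in> {j. j < ?T \<and> \<beta> j \<noteq> 0}"
        then show "j \<in> S \<union> {?T - tp..<?T}" using PiE_mem[OF \<beta>, of j] by (auto simp: E_def split: if_splits)
      qed
      then have "card {j. j < ?T \<and> \<beta> j \<noteq> 0} \<le> card (S \<union> {?T - tp..<?T})"
        using S' finite_subset by (intro card_mono) auto
      then have "card {j. j < ?T \<and> \<beta> j \<noteq> 0} \<le> s"
        using card_Un_le[of S "{?T - tp..<?T}"] S'(2) assms(2,3) by (simp add: tp_def)
      ultimately show "\<beta> \<in> param_sieve ps L s R" using \<beta> by (auto simp: param_sieve_def space_PiM PiE_def)
    qed
    then have "measure (slab_given ps L S) (PiE {..<?T} E) \<le> measure (slab_given ps L S) (param_sieve ps L s R)"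
      by (intro finite_measure_mono) (auto simp: sets_slab_given param_sieve_measurable)
    moreover have "measure (slab_given ps L S) (PiE {..<?T} E) = (\<Prod>j<?T. measure (slab_factor ps L S j) (E j))"
      by (rule measure_slab_given_box) (auto simp: E_def)
    moreover have "(\<Prod>j<?T. measure (slab_factor ps L S j) (E j)) = (\<Prod>j<?T. if ?T - tp \<le> j then t else 1)"
    proof (intro prod.cong refl)
      fix j
      have "measure (uniform_measure lborel {-1..1::real}) {-1..1} = 1" by (subst measure_uniform_measure) auto
      moreover have "measure (return lborel 0) {0::real} = 1" by (simp add: measure_return)
      ultimately show "measure (slab_factor ps L S j) (E j) = (if ?T - tp \<le> j then t else 1)"
        by (simp add: slab_factor_def E_def t_def tp_def)
    qed
    moreover have "\<dots> = t ^ tp"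
    proof -
      have "{..<?T} \<inter> {j. ?T - tp \<le> j} = {?T - tp..<?T}" by auto
      then show ?thesis using assms(3) by (simp add: prod.If_cases tp_def)
    qed
    moreover have "v \<le> t ^ tp"
    proof -
      have t: "1 - 2 * exp (- R\<^sup>2 / 2) \<le> t" "0 \<le> t" unfolding t_def using std_normal_tail[of R] assms(4) by auto
      have "1 + real tp * (t - 1) \<le> (1 + (t - 1)) ^ tp" by (rule Bernoulli_inequality) (use t in simp)
      moreover have "real tp * (- (2 * exp (- R\<^sup>2 / 2))) \<le> real tp * (t - 1)" using t by (intro mult_left_mono) auto
      ultimately show ?thesis unfolding v_def by simp
    qed
    ultimately show ?thesis by simp
  qed
  have card: "card (conn_sets ps L s) > 0" using assms(1) finite_conn_sets card_gt_0_iff by blast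
  have "v * card (conn_sets ps L s) \<le> (\<Sum>S\<in>conn_sets ps L s. measure (slab_given ps L S) (param_sieve ps L s R))"
    using sum_mono[of "conn_sets ps L s" "\<lambda>_. v"] slab by (simp add: mult.commute)
  then show ?thesis unfolding measure_ss_prior[OF assms(1) param_sieve_measurable] v_def tp_def
    using card by (simp add: field_simps)
qed

text \<open>Inactive coordinates are pinned to 0, where the Dirac factor has all its mass given the
  pattern \<open>S\<close>; so they cost nothing and the box stays sparse.\<close>

definition param_box :: "nat list \<Rightarrow> nat \<Rightarrow> nat set \<Rightarrow> (nat \<Rightarrow> real) \<Rightarrow> real \<Rightarrow> (nat \<Rightarrow> real) set" where
  "param_box ps L S b \<eta> = PiE {..<n_params ps L}
     (\<lambda>j. if n_params ps L - top_size ps L \<le> j \<or> j \<in> S then {b j - \<eta>..b j + \<eta>} else {0})"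

lemma param_box_measurable: "param_box ps L S b \<eta> \<in> sets (PiM {..<n_params ps L} (\<lambda>_. borel))"
  unfolding param_box_def by (rule sets_PiM_I_finite) auto

text \<open>The factor $T^{-s}$ comes from the number of connectivity patterns.\<close>
lemma ss_prior_box:
  assumes "S \<in> conn_sets ps L s" "top_size ps L \<le> s" "top_size ps L \<le> n_params ps L"
    "0 < \<eta>" "\<eta> \<le> 1" "\<And>j. j < n_params ps L - top_size ps L \<Longrightarrow> \<bar>b j\<bar> \<le> 1" "\<And>j. \<bar>b j\<bar> \<le> V"
  shows "(min (1 / 2) (2 * std_normal_density (V + 1)) * \<eta> / real (n_params ps L)) ^ s
    \<le> measure (ss_prior ps L s) (param_box ps L S b \<eta>)"
proof -
  let ?T = "n_params ps L"
  define tp where "tp = top_size ps L"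
  define k where "k = min (1 / 2) (2 * std_normal_density (V + 1))"
  have k: "0 \<le> k" "k \<le> 1 / 2" "k \<le> 2 * std_normal_density (V + 1)" unfolding k_def by auto
  have T1: "1 \<le> ?T" using assms(3) by (simp add: top_size_def)
  have S': "S \<subseteq> {..<?T - tp}" "card S = s - tp" using assms(1) by (auto simp: conn_sets_def tp_def)
  define E where "E = (\<lambda>j. if ?T - tp \<le> j \<or> j \<in> S then {b j - \<eta>..b j + \<eta>} else {0})"
  \<comment> \<open>Exactly \<open>s\<close> coordinates cost a factor: the top layer and those in
    \<open>S\<close>. \<open>k\<close> is the smaller of the uniform and the Gaussian
    constants.\<close>
  have "(k * \<eta>) ^ s = (\<Prod>j<?T. if ?T - tp \<le> j \<or> j \<in> S then k * \<eta> else 1)"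
  proof -
    have "{..<?T} \<inter> {j. ?T - tp \<le> j \<or> j \<in> S} = {?T - tp..<?T} \<union> S" using S' by auto
    moreover have "card ({?T - tp..<?T} \<union> S) = s"
    proof (subst card_Un_disjoint)
      show "card {?T - tp..<?T} + card S = s" using S'(2) assms(2,3) by (simp add: tp_def)
    qed (use S' finite_subset in auto)
    ultimately show ?thesis by (simp add: prod.If_cases)
  qed
  also have "\<dots> \<le> (\<Prod>j<?T. measure (slab_factor ps L S j) (E j))"
  proof (rule prod_mono)
    fix j assume j: "j \<in> {..<?T}"
    have "k * \<eta> \<le> 2 * std_normal_density (V + 1) * \<eta>" using k(3) assms(4) by (intro mult_right_mono) auto
    also have "\<dots> = 2 * \<eta> * std_normal_density (V + 1)" by simp
    also have "\<dots> \<le> measure (density lborel std_normal_density) {b j - \<eta>..b j + \<eta>}"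
      by (rule std_normal_interval[OF assms(7) assms(4,5)])
    finally have "k * \<eta> \<le> measure (density lborel std_normal_density) {b j - \<eta>..b j + \<eta>}" .
    moreover have "k * \<eta> \<le> measure (uniform_measure lborel {-1..1}) {b j - \<eta>..b j + \<eta>}" if "j < ?T - tp"
    proof -
      have "k * \<eta> \<le> 1 / 2 * \<eta>" using k(2) assms(4) by (intro mult_right_mono) auto
      also have "\<dots> = \<eta> / 2" by simp
      also have "\<dots> \<le> measure (uniform_measure lborel {-1..1}) {b j - \<eta>..b j + \<eta>}"
        by (rule uniform_interval[OF assms(6) assms(4,5)]) (use that in \<open>simp add: tp_def\<close>)
      finally show ?thesis .
    qed
    moreover have "measure (return lborel 0) {0::real} = 1" by (simp add: measure_return)
    ultimately show "0 \<le> (if ?T - tp \<le> j \<or> j \<in> S then k * \<eta> else 1) \<and>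
        (if ?T - tp \<le> j \<or> j \<in> S then k * \<eta> else 1) \<le> measure (slab_factor ps L S j) (E j)"
      using k assms(4) by (auto simp: slab_factor_def E_def tp_def)
  qed
  also have "\<dots> = measure (slab_given ps L S) (param_box ps L S b \<eta>)"
    unfolding param_box_def E_def[unfolded tp_def, symmetric] by (rule measure_slab_given_box[symmetric]) (auto simp: E_def)
  finally have 1: "(k * \<eta>) ^ s \<le> measure (slab_given ps L S) (param_box ps L S b \<eta>)" .
  have ne: "conn_sets ps L s \<noteq> {}" using assms(1) by auto
  have card: "card (conn_sets ps L s) > 0" using ne finite_conn_sets card_gt_0_iff by blast
  have "card (conn_sets ps L s) \<le> ?T ^ s"
    by (rule order_trans[OF card_conn_sets_le power_increasing]) (use T1 in auto)
  then have cardle: "real (card (conn_sets ps L s)) \<le> real ?T ^ s" by (metis of_nat_le_iff of_nat_power)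
  have "(k * \<eta> / real ?T) ^ s = (k * \<eta>) ^ s / real ?T ^ s" by (simp add: power_divide)
  also have "\<dots> \<le> (k * \<eta>) ^ s / real (card (conn_sets ps L s))"
    using cardle card k assms(4) T1 by (intro divide_left_mono) (auto intro!: mult_nonneg_nonneg mult_pos_pos zero_less_power)
  \<comment> \<open>Of the mixture over patterns only the summand of \<open>S\<close> is
    kept.\<close>
  also have "\<dots> \<le> (\<Sum>S'\<in>conn_sets ps L s. measure (slab_given ps L S') (param_box ps L S b \<eta>)) / real (card (conn_sets ps L s))"
    using 1 member_le_sum[OF assms(1), of "\<lambda>S'. measure (slab_given ps L S') (param_box ps L S b \<eta>)"] finite_conn_sets
    by (intro divide_right_mono) auto
  also have "\<dots> = measure (ss_prior ps L s) (param_box ps L S b \<eta>)"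
    by (rule measure_ss_prior[OF ne param_box_measurable, symmetric])
  finally show ?thesis unfolding k_def .
qed

text \<open>A sparse vector rounded to multiples of \<eta> is coded by \<open>s\<close> pairs of an
  index and an integer, so the number of codes has logarithm of order s, up to logs. The bound R + 1
  allows for the rounding.\<close>

lemma sparse_param_net:
  fixes T s H :: nat and \<eta> R :: real
  assumes "1 \<le> T" "0 < \<eta>" "\<eta> \<le> 1" "R / \<eta> + 1 \<le> real H"
  shows "\<exists>N. finite N \<and> card N \<le> (T * (2 * H + 1)) ^ s \<and> (\<forall>\<beta>. (\<forall>j<T. \<bar>\<beta> j\<bar> \<le> R) \<longrightarrow> card {j. j < T \<and> \<beta> j \<noteq> 0} \<le> s \<longrightarrow>
     (\<exists>\<beta>'\<in>N. \<forall>j<T. \<bar>\<beta> j - \<beta>' j\<bar> \<le> \<eta> \<and> \<bar>\<beta>' j\<bar> \<le> R + 1))"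
proof -
  define X where "X = {xs::(nat \<times> int) list. set xs \<subseteq> {..<T} \<times> {- int H..int H} \<and> length xs = s}"
  define dec where "dec = (\<lambda>(xs::(nat \<times> int) list) j. case map_of xs j of None \<Rightarrow> 0 | Some i \<Rightarrow> \<eta> * of_int (i::int))"
  have X: "finite X" unfolding X_def by (rule finite_lists_length_eq) simp
  have "card X = card ({..<T} \<times> {- int H..int H}) ^ s" unfolding X_def by (rule card_lists_length_eq) simp
  also have "card ({..<T} \<times> {- int H..int H}) = T * (2 * H + 1)" 
  proof -
    have "nat (2 * int H + 1) = 2 * H + 1" by linarith
    then show ?thesis by (simp add: card_cartesian_product)
  qed
  finally have cX: "card (dec ` X) \<le> (T * (2 * H + 1)) ^ s" using card_image_le[OF X, of dec] by simp
  have "\<exists>\<beta>'\<in>dec ` X. \<forall>j<T. \<bar>\<beta> j - \<beta>' j\<bar> \<le> \<eta> \<and> \<bar>\<beta>' j\<bar> \<le> R + 1"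
    if \<beta>: "\<forall>j<T. \<bar>\<beta> j\<bar> \<le> R" "card {j. j < T \<and> \<beta> j \<noteq> 0} \<le> s" for \<beta>
  proof -
    define A where "A = {j. j < T \<and> \<beta> j \<noteq> 0}"
    have fA: "finite A" by (simp add: A_def)
    \<comment> \<open>Padding with index 0 gives all codes length \<open>s\<close>. Repetitions do
      no harm because the entry paired with an index depends on the index only.\<close>
    define us where "us = sorted_list_of_set A @ replicate (s - card A) 0"
    have us: "length us = s" "A \<subseteq> set us" "set us \<subseteq> {..<T}"
      using \<beta>(2) fA assms(1) by (auto simp: us_def A_def)
    define f where "f = (\<lambda>j. \<lfloor>\<beta> j / \<eta>\<rfloor>)"
    define xs where "xs = map (\<lambda>j. (j, f j)) us"
    have f: "\<bar>\<beta> j - \<eta> * of_int (f j)\<bar> \<le> \<eta>" for j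
    proof -
      have "of_int (f j) \<le> \<beta> j / \<eta>" "\<beta> j / \<eta> \<le> of_int (f j) + 1" unfolding f_def by linarith+
      then have "\<eta> * of_int (f j) \<le> \<beta> j" "\<beta> j \<le> \<eta> * of_int (f j) + \<eta>" using assms(2) by (simp_all add: field_simps)
      then show ?thesis using assms(2) by auto
    qed
    have "xs \<in> X"
    proof -
      have "f j \<in> {- int H..int H}" if "j < T" for j
      proof -
        have "\<bar>\<beta> j\<bar> / \<eta> \<le> R / \<eta>" using \<beta>(1) that assms(2) by (intro divide_right_mono) auto
        then have "\<bar>\<beta> j / \<eta>\<bar> \<le> real H - 1" using assms(2,4) by (simp add: abs_divide)
        then have "real_of_int (- int H) \<le> real_of_int (f j)" "real_of_int (f j) \<le> real_of_int (int H)"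
          unfolding f_def by (simp, linarith)+
        then show ?thesis by (simp only: of_int_le_iff atLeastAtMost_iff)
      qed
      then show ?thesis using us unfolding X_def xs_def by auto
    qed
    moreover have "\<bar>\<beta> j - dec xs j\<bar> \<le> \<eta> \<and> \<bar>dec xs j\<bar> \<le> R + 1" if j: "j < T" for j
    proof -
      have "map_of xs j = (if j \<in> set us then Some (f j) else None)"
        unfolding xs_def by (simp add: map_of_map_restrict restrict_map_def)
      moreover have "\<beta> j = 0" if "j \<notin> set us" using us(2) that j by (auto simp: A_def)
      ultimately have "\<bar>\<beta> j - dec xs j\<bar> \<le> \<eta>" using f[of j] assms(2) by (auto simp: dec_def)
      moreover have "\<bar>\<beta> j\<bar> \<le> R" using \<beta>(1) j by auto
      ultimately show ?thesis using assms(3) by linarith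
    qed
    ultimately show ?thesis by (intro bexI[of _ "dec xs"]) auto
  qed
  then show ?thesis using X cX by (intro exI[of _ "dec ` X"]) auto
qed

subsection \<open>A finite sample bound\<close>

text \<open>No asymptotics yet: all tuning parameters are free. \<tau> is the output error caused by
  a parameter error \<eta>, and \<open>F' + \<tau> \<le> F\<close> keeps the whole box around
  \<open>b\<close> inside the class.\<close>

lemma finite_sample_bound:
  fixes n p L N s H :: nat and F F' V R \<tau> \<eta> E X e :: real
  assumes arch: "1 \<le> p" "1 \<le> N" "1 \<le> L"
    and xs: "\<forall>i<n. xs i \<in> cube p"
  defines "ps \<equiv> arch_widths p L N"
  assumes s: "top_size ps L \<le> s" "s \<le> n_params ps L"
    and b: "\<forall>j<layer_off ps L. \<bar>b j\<bar> \<le> 1" "\<forall>j. \<bar>b j\<bar> \<le> V" "card {j. j < layer_off ps L \<and> b j \<noteq> 0} \<le> s - top_size ps L"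
      "\<forall>z. \<bar>relu_net L ps b z\<bar> \<le> F'" "(\<Sum>i<n. (relu_net L ps b (xs i) - f0 (xs i))\<^sup>2) \<le> E"
    and F: "F' + \<tau> \<le> F" and R: "1 \<le> R" "V \<le> R"
    and \<eta>: "0 < \<eta>" "\<eta> \<le> 1" "real (Suc L) * \<eta> * ((real (12 * p * N) + 1) * (R + 1)) ^ Suc L \<le> \<tau>"
    and H: "R / \<eta> + 1 \<le> real H"
    and \<tau>: "(real n)\<^sup>2 * \<tau> \<le> 1" "real n * \<tau>\<^sup>2 \<le> 1"
    and e: "(exp (3 - 3 / 8 * X) + exp (real n ^ 3 / 2) * (real (top_size ps L) * (2 * exp (- R\<^sup>2 / 2)))) /
       ((min (1 / 2) (2 * std_normal_density (V + 1)) * \<eta> / real (n_params ps L)) ^ s * exp (- (2 * E + 2))) \<le> e"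
    and A: "\<And>f. f \<in> A \<Longrightarrow> 2 * X + 2 \<le> (\<Sum>i<n. (f (xs i) - f0 (xs i))\<^sup>2)"
  shows "measure (data_law f0 xs n) {Y \<in> space (data_law f0 xs n).
       e < posterior (ss_prior ps L s) (relu_net L ps) (nn_class F p L ps s) (lik n xs Y) A}
     \<le> 2 * real n * exp (- (real n)\<^sup>2 / 2) + exp (- E / 2) + real (n_params ps L * (2 * H + 1)) ^ s * exp (- X / 32)"
proof -
  define T where "T = n_params ps L"
  define tp where "tp = top_size ps L"
  define off where "off = layer_off ps L"
  have T: "T = off + tp" unfolding T_def off_def tp_def ps_def by (rule n_params_eq)
  have T1: "1 \<le> T" unfolding T by (simp add: tp_def top_size_def)
  have widths: "ps ! k \<le> 12 * p * N" if "k \<le> L" for k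
    using that arch(1,2) unfolding ps_def by (cases "k = 0") (auto simp: arch_widths_nth)
  have \<tau>0: "0 \<le> \<tau>" by (rule order_trans[OF _ \<eta>(3)]) (use \<eta> R in auto)
  have close: "\<bar>relu_net L ps \<beta> z - relu_net L ps \<beta>' z\<bar> \<le> \<tau>"
    if "\<And>j. j < T \<Longrightarrow> \<bar>\<beta> j\<bar> \<le> R + 1 \<and> \<bar>\<beta>' j\<bar> \<le> R + 1 \<and> \<bar>\<beta> j - \<beta>' j\<bar> \<le> \<eta>" "z \<in> cube p" for \<beta> \<beta>' z
    by (rule order_trans[OF relu_net_perturbation[where R = "R + 1" and \<eta> = \<eta> and w = "12 * p * N" and p = p] \<eta>(3)])
       (use that widths R \<eta> in \<open>auto simp: T_def ps_def arch_widths_nth\<close>)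
  \<comment> \<open>The prior charges only patterns of one exact size, so the support of
    \<open>b\<close> is enlarged to it; on the added coordinates the box is centred at 0.\<close>
  have "\<exists>S. {j. j < off \<and> b j \<noteq> 0} \<subseteq> S \<and> S \<subseteq> {..<off} \<and> card S = s - tp"
    by (rule exists_subset_between) (use b(3) s T in \<open>auto simp: T_def tp_def off_def\<close>)
  then obtain S where S: "{j. j < off \<and> b j \<noteq> 0} \<subseteq> S" "S \<subseteq> {..<off}" "card S = s - tp" by blast
  have Sc: "S \<in> conn_sets ps L s" using S T unfolding conn_sets_def T_def[symmetric] tp_def[symmetric] by auto
  then have ne: "conn_sets ps L s \<noteq> {}" by auto
  define B where "B = param_box ps L S b \<eta>"
  have "(min (1 / 2) (2 * std_normal_density (V + 1)) * \<eta> / real T) ^ s \<le> measure (ss_prior ps L s) B"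
    unfolding B_def T_def
    by (rule ss_prior_box[OF Sc s(1) _ \<eta>(1,2)]) (use b T in \<open>auto simp: T_def[symmetric] tp_def[symmetric] off_def[symmetric]\<close>)
  note massB = this
  have V0: "0 \<le> V" using b(2) abs_ge_zero order_trans by blast
  have Bprop: "relu_net L ps \<beta> \<in> nn_class F p L ps s \<and> (\<forall>i<n. \<bar>relu_net L ps \<beta> (xs i) - relu_net L ps b (xs i)\<bar> \<le> \<tau>)"
    if \<beta>: "\<beta> \<in> B" for \<beta>
  proof -
    have mem: "\<beta> j \<in> (if off \<le> j \<or> j \<in> S then {b j - \<eta>..b j + \<eta>} else {0})" if "j < T" for j
      using PiE_mem[OF \<beta>[unfolded B_def param_box_def], of j] that T
      unfolding T_def[symmetric] tp_def[symmetric] by simp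
    have d: "\<bar>\<beta> j - b j\<bar> \<le> \<eta>" if "j < T" for j
    proof (cases "off \<le> j \<or> j \<in> S")
      case True
      then show ?thesis using mem[OF that] by (auto simp: abs_le_iff)
    next
      case False
      then have "b j = 0" using subsetD[OF S(1), of j] by auto
      then show ?thesis using mem[OF that] False \<eta> by auto
    qed
    have c: "\<bar>relu_net L ps \<beta> z - relu_net L ps b z\<bar> \<le> \<tau>" if "z \<in> cube p" for z
    proof (rule close[OF _ that])
      fix j assume j: "j < T"
      have "\<bar>b j\<bar> \<le> R" using b(2) R(2) order_trans by blast
      then show "\<bar>\<beta> j\<bar> \<le> R + 1 \<and> \<bar>b j\<bar> \<le> R + 1 \<and> \<bar>\<beta> j - b j\<bar> \<le> \<eta>" using d[OF j] \<eta>(2) by auto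
    qed
    have "{j \<in> {..<T}. \<beta> j \<noteq> 0} \<subseteq> S \<union> {off..<T}"
    proof
      fix j assume "j \<in> {j \<in> {..<T}. \<beta> j \<noteq> 0}"
      then show "j \<in> S \<union> {off..<T}" using mem[of j] by (auto split: if_splits)
    qed
    then have "card {j \<in> {..<T}. \<beta> j \<noteq> 0} \<le> card (S \<union> {off..<T})"
      using S(2) finite_subset by (intro card_mono) auto
    also have "\<dots> \<le> s" using card_Un_le[of S "{off..<T}"] S(3) s(1) T by (simp add: tp_def)
    finally have "card {j \<in> {..<T}. \<beta> j \<noteq> 0} \<le> s" .
    moreover have "\<bar>relu_net L ps \<beta> z\<bar> \<le> F" if "z \<in> cube p" for z
      using c[OF that] b(4) F by (smt (verit))
    ultimately have "relu_net L ps \<beta> \<in> nn_class F p L ps s"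
      unfolding nn_class_def T_def by blast
    then show ?thesis using c xs by blast
  qed
  obtain Np where Np: "finite Np" "card Np \<le> (T * (2 * H + 1)) ^ s"
    "\<And>\<beta>. \<forall>j<T. \<bar>\<beta> j\<bar> \<le> R \<Longrightarrow> card {j. j < T \<and> \<beta> j \<noteq> 0} \<le> s \<Longrightarrow>
       \<exists>\<beta>'\<in>Np. \<forall>j<T. \<bar>\<beta> j - \<beta>' j\<bar> \<le> \<eta> \<and> \<bar>\<beta>' j\<bar> \<le> R + 1"
    using sparse_param_net[OF T1 \<eta>(1,2) H, of s] by blast
  define Nf where "Nf = relu_net L ps ` Np"
  have "card Nf \<le> (T * (2 * H + 1)) ^ s" unfolding Nf_def using card_image_le[OF Np(1)] Np(2) order_trans by blast
  then have cardNf: "real (card Nf) \<le> real (T * (2 * H + 1)) ^ s" by (metis of_nat_le_iff of_nat_power)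
  have Svprop: "\<exists>h\<in>Nf. \<forall>i<n. \<bar>relu_net L ps \<beta> (xs i) - h (xs i)\<bar> \<le> \<tau>" if \<beta>: "\<beta> \<in> param_sieve ps L s R" for \<beta>
  proof -
    have \<beta>R: "\<forall>j<T. \<bar>\<beta> j\<bar> \<le> R" "card {j. j < T \<and> \<beta> j \<noteq> 0} \<le> s" using \<beta> unfolding param_sieve_def T_def by auto
    obtain \<beta>' where \<beta>': "\<beta>' \<in> Np" "\<And>j. j < T \<Longrightarrow> \<bar>\<beta> j - \<beta>' j\<bar> \<le> \<eta> \<and> \<bar>\<beta>' j\<bar> \<le> R + 1" using Np(3)[OF \<beta>R] by blast
    have "\<bar>relu_net L ps \<beta> (xs i) - relu_net L ps \<beta>' (xs i)\<bar> \<le> \<tau>" if "i < n" for i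
    proof (rule close)
      fix j assume j: "j < T"
      have "\<bar>\<beta> j\<bar> \<le> R + 1" using \<beta>R(1) j by fastforce
      then show "\<bar>\<beta> j\<bar> \<le> R + 1 \<and> \<bar>\<beta>' j\<bar> \<le> R + 1 \<and> \<bar>\<beta> j - \<beta>' j\<bar> \<le> \<eta>" using \<beta>'(2)[OF j] by auto
    qed (use xs that in auto)
    then show ?thesis using \<beta>'(1) unfolding Nf_def by blast
  qed
  define P where "P = data_law f0 xs n"
  interpret P: prob_space P unfolding P_def by (rule prob_space_data_law)
  obtain Z where Z: "Z \<in> sets P" "measure P Z \<le> 2 * real n * exp (- (real n)\<^sup>2 / 2) + exp (- E / 2) + real (card Nf) * exp (- X / 32)"
    "\<And>Y. Y \<in> space P - Z \<Longrightarrow> good_noise n xs f0 (relu_net L ps b) Nf E X Y"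
    using good_noise_prob[where N = Nf and n = n and g = "relu_net L ps b" and xs = xs and ?f0.0 = f0 and E = E and X = X] Np(1) b(5) unfolding Nf_def P_def by blast
  have post: "posterior (ss_prior ps L s) (relu_net L ps) (nn_class F p L ps s) (lik n xs Y) A \<le> e"
    if Y: "Y \<in> space P - Z" for Y
  proof -
    define b0 where "b0 = (min (1 / 2) (2 * std_normal_density (V + 1)) * \<eta> / real T) ^ s"
    have b0: "0 < b0" unfolding b0_def using \<eta>(1) T1 by (auto intro!: zero_less_power divide_pos_pos mult_pos_pos normal_density_pos)
    have "posterior (ss_prior ps L s) (relu_net L ps) (nn_class F p L ps s) (lik n xs Y) A \<le>
      (exp (3 - 3 / 8 * X) + exp (real n ^ 3 / 2) * (1 - measure (ss_prior ps L s) (param_sieve ps L s R))) / (b0 * exp (- (2 * E + 2)))"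
      by (rule posterior_bound[where Sv = "param_sieve ps L s R" and B = B, OF prob_space_ss_prior _ _ b0 _ Z(3)[OF Y] \<tau> b(5)])
         (use Bprop Svprop A massB in \<open>auto simp: sets_ss_prior param_sieve_measurable B_def param_box_measurable b0_def\<close>)
    also have "\<dots> \<le> (exp (3 - 3 / 8 * X) + exp (real n ^ 3 / 2) * (real (top_size ps L) * (2 * exp (- R\<^sup>2 / 2)))) / (b0 * exp (- (2 * E + 2)))"
      using ss_prior_sieve[OF ne s(1) _ R(1)] T b0
      by (intro divide_right_mono add_left_mono mult_left_mono) (auto simp: T_def tp_def)
    also have "\<dots> \<le> e" using e unfolding b0_def T_def .
    finally show ?thesis .
  qed
  have "measure P {Y \<in> space P. e < posterior (ss_prior ps L s) (relu_net L ps) (nn_class F p L ps s) (lik n xs Y) A} \<le> measure P Z"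
    by (rule P.finite_measure_mono[OF _ Z(1)]) (use post in fastforce)
  also have "\<dots> \<le> 2 * real n * exp (- (real n)\<^sup>2 / 2) + exp (- E / 2) + real (T * (2 * H + 1)) ^ s * exp (- X / 32)"
    using order_trans[OF Z(2) add_left_mono[OF mult_right_mono[OF cardNf]]] by simp
  finally show ?thesis unfolding P_def T_def .
qed

lemma n_params_le:
  assumes "1 \<le> p" "1 \<le> N"
  shows "n_params (arch_widths p L N) L \<le> Suc L * (12 * p * N + 1)\<^sup>2"
proof -
  let ?ps = "arch_widths p L N"
  have w: "?ps ! k \<le> 12 * p * N + 1" "k \<le> L \<Longrightarrow> ?ps ! k + 1 \<le> 12 * p * N + 1" if "k \<le> Suc L" for k
  proof -
    have "p \<le> 12 * p * N" using assms by simp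
    then have *: "?ps ! k \<le> 12 * p * N" if "k \<le> L" for k using that by (cases "k = 0") (auto simp: arch_widths_nth)
    then show "k \<le> L \<Longrightarrow> ?ps ! k + 1 \<le> 12 * p * N + 1" by simp
    show "?ps ! k \<le> 12 * p * N + 1" using * that by (cases "k = Suc L") (auto simp: arch_widths_nth le_Suc_eq intro: le_SucI)
  qed
  have "n_params ?ps L \<le> (\<Sum>i<Suc L. (12 * p * N + 1)\<^sup>2)"
    unfolding n_params_def layer_off_def power2_eq_square
    by (intro sum_mono mult_mono) (use w in auto)
  then show ?thesis by simp
qed

text \<open>One block between two hidden layers already has this many parameters. It ensures that
  \<open>s\<close> does not exceed the number of parameters, so that connectivity patterns
  exist.\<close>

lemma n_params_ge:
  assumes "2 \<le> L"
  shows "(12 * p * N)\<^sup>2 \<le> n_params (arch_widths p L N) L"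
proof -
  let ?ps = "arch_widths p L N"
  have "(12 * p * N)\<^sup>2 \<le> ?ps ! Suc 1 * (?ps ! 1 + 1)"
    using assms by (simp add: arch_widths_nth power2_eq_square del: One_nat_def)
  also have "\<dots> \<le> n_params ?ps L" unfolding n_params_def layer_off_def
    using assms by (intro member_le_sum[of 1 _ "\<lambda>i. ?ps ! Suc i * (?ps ! i + 1)"]) auto
  finally show ?thesis .
qed

subsection \<open>Choice of the tuning parameters\<close>

text \<open>Every requirement that n be large is stated as a hypothesis, so that the argument here
  is for one fixed n and the limits are treated separately. \<open>ent\<close> and
  \<open>err\<close> say that entropy and bias stay below \<open>E\<close>.\<close>

lemma contraction_at_sample_size:
  fixes n p L s \<kappa> N :: nat and \<alpha> F CN CL Cs V e Mn :: real and f0 :: fn and xs :: "nat \<Rightarrow> nat \<Rightarrow> real"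
  defines "l \<equiv> ln (real n)" and "X \<equiv> real n powr (real p / (2 * \<alpha> + real p))"
    and "u \<equiv> real n powr (1 / (2 * \<alpha> + real p))" and "V' \<equiv> V + F + 1"
  defines "E \<equiv> X * l powr (4 * \<alpha> + 4)"
    and "k0 \<equiv> min (1 / 2) (2 * std_normal_density (V' + 1))"
    and "C1 \<equiv> real \<kappa> * (1 + 2 powr \<alpha>) + 1"
    and "N \<equiv> nat \<lfloor>CN * real_of_int \<lfloor>X / l\<rfloor>\<rfloor>"
  defines "ps \<equiv> arch_widths p L N"
  assumes "1 \<le> p" "0 < \<alpha>" "0 < F" "0 < CN" "0 < CL" "0 < Cs" "0 < e" "1 \<le> \<kappa>" "0 \<le> V"
    and f0: "\<forall>z\<in>cube p. \<bar>f0 z\<bar> \<le> F" and xs: "\<forall>i<n. xs i \<in> cube p"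
    and apx: "\<And>n M k a d w pts F'. (\<forall>i<n. pts i \<in> cube p) \<Longrightarrow> M \<ge> 1 \<Longrightarrow> (n + 1) * M \<le> 2 ^ a \<Longrightarrow>
     0 \<le> F' \<Longrightarrow> F' \<le> F \<Longrightarrow> \<kappa> * (k + a + 1) \<le> d \<Longrightarrow> \<kappa> * M ^ p \<le> w \<Longrightarrow>
     (\<exists>u v. relu_layers p w d (\<kappa> * M ^ p * d) [u, v] \<and> (\<forall>z. \<bar>V * (u z - v z) - F'\<bar> \<le> F') \<and>
       (\<forall>i<n. \<bar>V * (u (pts i) - v (pts i)) - F' - f0 (pts i)\<bar>
          \<le> real \<kappa> * (1 / 4 ^ k + (1 / real M) powr \<alpha>) + (F - F')))"
    and L: "9 * real \<kappa> * l \<le> real L" "real L \<le> CL * l" and s: "X \<le> real s" "real s \<le> Cs * X"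
    and l1: "1 \<le> l"
    and wK: "real \<kappa> * (X / l\<^sup>2) \<le> CN * (X / l - 1) - 1"
    and cost: "real \<kappa> * (X / l\<^sup>2) * (CL * l) + 12 * real p * (CN * (X / l)) + 1 \<le> X"
    and sT: "Cs * X \<le> (CN * (X / l - 1) - 1)\<^sup>2"
    and wn: "12 * real p * (CN * (X / l)) + 1 \<le> real n"
    and Ln: "CL * l + 1 \<le> real n"
    and ent: "Cs * ((4 * (CL * l) + 13) * l) \<le> l powr (4 * \<alpha> + 4)"
    and err: "C1\<^sup>2 * l powr (4 * \<alpha>) \<le> l powr (4 * \<alpha> + 4)"
    and En: "E \<le> (real n)\<^sup>2" and El: "l \<le> E"
    and tail: "exp (real n ^ 3 / 2) * (real n * (2 * exp (- ((real n)\<^sup>2)\<^sup>2 / 2))) / exp (- (3 * (real n)\<^sup>2 + 2)) \<le> e / 2"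
    and small: "exp (5 - 34 * l) \<le> e / 2"
    and u1: "1 \<le> u / l\<^sup>2" and Fn: "1 / (real n)\<^sup>2 \<le> F" and Vn: "V' \<le> (real n)\<^sup>2" and k0n: "1 / k0 \<le> real n"
    and Ldepth: "2 * (2 * (3 / 2 * ln (real n + 1)) + 1) + 1 \<le> 9 * l" and Mn: "20 \<le> Mn"
  shows "measure (data_law f0 xs n) {Y \<in> space (data_law f0 xs n).
       posterior (ss_prior ps L s) (relu_net L ps) (nn_class F p L ps s) (lik n xs Y)
         {f \<in> nn_class F p L ps s. emp_norm n xs (\<lambda>z. f z - f0 z) >
           Mn * (real n powr (- \<alpha> / (2 * \<alpha> + real p)) * l powr (2 * \<alpha> + 2))} > e}
     \<le> 2 * real n * exp (- (real n)\<^sup>2 / 2) + exp (- l / 2) + exp (- 2 * l)"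
proof -
  have n3: "3 \<le> n"
  proof -
    have "0 < n" using l1 unfolding l_def by (cases n) auto
    then have "exp 1 \<le> real n" using l1 unfolding l_def by (simp add: ln_ge_iff)
    moreover have "2 < exp (1::real)"
      using exp_ge_one_plus_x_over_n_power_n[of 2 1] by (simp add: power2_eq_square)
    ultimately show ?thesis by linarith
  qed
  have n0: "0 < real n" using n3 by simp
  have n1: "1 \<le> real n" using n3 by simp
  define D where "D = 2 * \<alpha> + real p"
  have D: "1 \<le> D" "0 < D" "2 * \<alpha> + real p = D" unfolding D_def using assms(10,11) by auto
  have X0: "0 < X" unfolding X_def using n0 by simp
  have E1: "1 \<le> E" using El l1 by simp
  \<comment> \<open>u^p = X, and since p \<ge> 1 the division by l^2 leaves at most X / l^2 cells.
    The floor costs at most a factor 2, which is where the power of 2 in \<open>C1\<close> comes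
    from.\<close>
  define M where "M = nat \<lfloor>u / l\<^sup>2\<rfloor>"
  have M: "1 \<le> M" "real M \<le> u / l\<^sup>2" "u / (2 * l\<^sup>2) \<le> real M"
  proof -
    have 1: "1 \<le> \<lfloor>u / l\<^sup>2\<rfloor>" using u1 by (simp add: le_floor_iff)
    then have 2: "real M = of_int \<lfloor>u / l\<^sup>2\<rfloor>" unfolding M_def by simp
    show "1 \<le> M" using 1 unfolding M_def by linarith
    show "real M \<le> u / l\<^sup>2" unfolding 2 by simp
    have "u / l\<^sup>2 < real M + 1" unfolding 2 by linarith
    moreover have "1 \<le> real M" using 1 2 by simp
    ultimately show "u / (2 * l\<^sup>2) \<le> real M" by (simp add: field_simps)
  qed
  have ll: "1 \<le> l\<^sup>2" using l1 by simp
  have u_le: "u \<le> real n"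
  proof -
    have "u \<le> real n powr 1" unfolding u_def D(3) using n1 D by (intro powr_mono) (auto simp: divide_le_eq)
    then show ?thesis using n0 by simp
  qed
  have u0: "0 < u" unfolding u_def using n0 by simp
  have M_le: "M \<le> n"
  proof -
    have "u / l\<^sup>2 \<le> u" using ll u0 by (simp add: divide_le_eq)
    then have "real M \<le> real n" using M(2) u_le by linarith
    then show ?thesis by simp
  qed
  have Mp: "real (M ^ p) \<le> X / l\<^sup>2"
  proof -
    have "real (M ^ p) \<le> (u / l\<^sup>2) ^ p" using M(2) by (simp add: power_mono)
    also have "\<dots> = u ^ p / (l\<^sup>2) ^ p" by (simp add: power_divide)
    also have "u ^ p = X" unfolding u_def X_def using n0 by (simp add: powr_realpow[symmetric] powr_powr)
    also have "X / (l\<^sup>2) ^ p \<le> X / l\<^sup>2"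
      using ll X0 assms(10) power_increasing[of 1 p "l\<^sup>2"] l1
      by (intro divide_left_mono mult_pos_pos zero_less_power) auto
    finally show ?thesis .
  qed
  define w where "w = 12 * p * N"
  have Nreal: "real N \<le> CN * (X / l)" "CN * (X / l - 1) - 1 \<le> real N"
  proof -
    have "0 \<le> X / l" using X0 l1 by simp
    then have "0 \<le> CN * real_of_int \<lfloor>X / l\<rfloor>" using assms(13) by (simp add: le_floor_iff)
    then have N: "real N = of_int \<lfloor>CN * real_of_int \<lfloor>X / l\<rfloor>\<rfloor>" unfolding N_def by (simp add: le_floor_iff)
    have "CN * real_of_int \<lfloor>X / l\<rfloor> \<le> CN * (X / l)" "CN * (X / l - 1) \<le> CN * real_of_int \<lfloor>X / l\<rfloor>"
      using assms(13) by (intro mult_left_mono; linarith)+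
    then show "real N \<le> CN * (X / l)" "CN * (X / l - 1) - 1 \<le> real N" unfolding N by linarith+
  qed
  have \<kappa>M: "real (\<kappa> * M ^ p) \<le> real N"
  proof -
    have "real (\<kappa> * M ^ p) = real \<kappa> * real (M ^ p)" by simp
    also have "\<dots> \<le> real \<kappa> * (X / l\<^sup>2)" using Mp by (intro mult_left_mono) auto
    finally show ?thesis using wK Nreal(2) by linarith
  qed
  then have \<kappa>MN: "\<kappa> * M ^ p \<le> N" by (simp only: of_nat_le_iff)
  have "1 * 1 \<le> \<kappa> * M ^ p" using M(1) assms(17) by (intro mult_mono) auto
  then have N1: "1 \<le> N" using \<kappa>MN by linarith
  have Nw: "N \<le> w" unfolding w_def using assms(10) by simp
  then have w\<kappa>: "\<kappa> * M ^ p \<le> w" using \<kappa>MN by linarith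
  have wreal: "real w \<le> 12 * real p * (CN * (X / l))" "1 \<le> w"
  proof -
    show "real w \<le> 12 * real p * (CN * (X / l))" unfolding w_def using Nreal(1) mult_left_mono[OF Nreal(1), of "12 * real p"] by simp
    show "1 \<le> w" unfolding w_def using N1 assms(10) by simp
  qed
  have L2: "2 \<le> L"
  proof -
    have "9 * 1 * 1 \<le> 9 * real \<kappa> * l" using assms(17) l1 by (intro mult_mono) auto
    then show ?thesis using L(1) by linarith
  qed
  define T where "T = n_params ps L"
  define tp where "tp = top_size ps L"
  have tp: "tp = w + 1" unfolding tp_def top_size_def ps_def w_def using L2 by (simp add: arch_widths_nth)
  have tpn: "real tp \<le> real n" unfolding tp using wreal(1) wn by simp
  have LnN: "real (Suc L) \<le> real n" using L(2) Ln by simp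
  have Tn: "real T \<le> real n ^ 3"
  proof -
    have "T \<le> Suc L * tp\<^sup>2" unfolding T_def ps_def tp w_def by (rule n_params_le[OF assms(10) N1])
    then have "real T \<le> real (Suc L) * (real tp)\<^sup>2" by (metis of_nat_le_iff of_nat_mult of_nat_power)
    also have "\<dots> \<le> real n * (real n)\<^sup>2" using LnN tpn by (intro mult_mono power_mono) auto
    finally show ?thesis by (simp add: power3_eq_cube power2_eq_square)
  qed
  have "real s \<le> real T"
  proof -
    have "0 \<le> real \<kappa> * (X / l\<^sup>2)" using X0 by simp
    then have "0 \<le> CN * (X / l - 1) - 1" using wK by linarith
    moreover have "CN * (X / l - 1) - 1 \<le> real w" using Nreal(2) Nw by linarith
    ultimately have "(CN * (X / l - 1) - 1)\<^sup>2 \<le> (real w)\<^sup>2" by (intro power_mono)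
    moreover have "w\<^sup>2 \<le> T" unfolding w_def T_def ps_def by (rule n_params_ge[OF L2])
    then have "(real w)\<^sup>2 \<le> real T" by (metis of_nat_le_iff of_nat_power)
    ultimately show ?thesis using s(2) sT by linarith
  qed
  then have sT': "s \<le> T" by simp
  \<comment> \<open>As M \<le> n, the square covers (n + 1) M. The same \<open>a\<close> serves as
    multiplication accuracy, since 4^-a \<le> 1/n. Then 2a + 1 \<le> 6 ln(n + 1) + 3 \<le> 9 ln n,
    the origin of the 9 in the depth condition.\<close>
  define a where "a = nat \<lceil>log 2 ((real n + 1)\<^sup>2)\<rceil>"
  have a: "(n + 1) * M \<le> 2 ^ a" "real a \<le> 2 * (3 / 2 * ln (real n + 1)) + 1"
  proof -
    have "log 2 ((real n + 1)\<^sup>2) \<le> real a" unfolding a_def by linarith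
    then have "(real n + 1)\<^sup>2 \<le> 2 powr real a" using n0 by (subst (asm) log_le_iff) auto
    then have "(real n + 1)\<^sup>2 \<le> 2 ^ a" by (simp add: powr_realpow)
    moreover have "real ((n + 1) * M) \<le> (real n + 1)\<^sup>2"
    proof -
      have "real ((n + 1) * M) = (real n + 1) * real M" by (simp add: algebra_simps)
      also have "\<dots> \<le> (real n + 1) * (real n + 1)" using M_le by (intro mult_left_mono) auto
      finally show ?thesis by (simp only: power2_eq_square)
    qed
    ultimately have "real ((n + 1) * M) \<le> real (2 ^ a)" by simp
    then show "(n + 1) * M \<le> 2 ^ a" by (simp only: of_nat_le_iff)
    have pos: "0 \<le> ln (real n + 1)" using n0 by simp
    have "log 2 ((real n + 1)\<^sup>2) = 2 * (ln (real n + 1) / ln 2)" using n0 by (simp add: log_def ln_realpow)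
    also have "ln (real n + 1) / ln 2 \<le> ln (real n + 1) / (2 / 3)"
      using pos ln2_ge_two_thirds by (intro divide_left_mono) auto
    finally have "log 2 ((real n + 1)\<^sup>2) \<le> 2 * (3 / 2 * ln (real n + 1))" by simp
    moreover have "0 \<le> log 2 ((real n + 1)\<^sup>2)" using n0 by simp
    ultimately show "real a \<le> 2 * (3 / 2 * ln (real n + 1)) + 1" unfolding a_def by linarith
  qed
  have depth: "\<kappa> * (a + a + 1) \<le> L"
  proof -
    have "real (\<kappa> * (a + a + 1)) = real \<kappa> * (2 * real a + 1)" by (simp add: algebra_simps)
    also have "\<dots> \<le> real \<kappa> * (9 * l)"
    proof (rule mult_left_mono)
      have "2 * real a + 1 \<le> 2 * (2 * (3 / 2 * ln (real n + 1)) + 1) + 1" using a(2) by simp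
      then show "2 * real a + 1 \<le> 9 * l" using Ldepth by (rule order_trans)
    qed simp
    finally have "real (\<kappa> * (a + a + 1)) \<le> real L" using L(1) by simp
    then show ?thesis by (simp only: of_nat_le_iff)
  qed
  \<comment> \<open>With n errors of size at most n, this accuracy changes a noise correlation by at
    most 1. It is also the gap left between \<open>F'\<close> and \<open>F\<close>.\<close>
  define \<tau> where "\<tau> = 1 / (real n)\<^sup>2"
  have \<tau>0: "0 < \<tau>" unfolding \<tau>_def using n0 by simp
  define F' where "F' = F - \<tau>"
  have F': "0 \<le> F'" "F' \<le> F" unfolding F'_def \<tau>_def using Fn by auto
  obtain uu vv where uv: "relu_layers p w L (\<kappa> * M ^ p * L) [uu, vv]" "\<forall>z. \<bar>V * (uu z - vv z) - F'\<bar> \<le> F'"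
    "\<forall>i<n. \<bar>V * (uu (xs i) - vv (xs i)) - F' - f0 (xs i)\<bar> \<le> real \<kappa> * (1 / 4 ^ a + (1 / real M) powr \<alpha>) + (F - F')"
    using apx[OF xs M(1) a(1) F' depth w\<kappa>] by blast
  have V': "\<bar>V\<bar> \<le> V'" "\<bar>- F'\<bar> \<le> V'" "1 \<le> V'" unfolding V'_def using assms(12,18) F' by auto
  obtain b where b: "\<forall>j<layer_off ps L. \<bar>b j\<bar> \<le> 1" "\<forall>j. \<bar>b j\<bar> \<le> V'"
    "card {j. j < layer_off ps L \<and> b j \<noteq> 0} \<le> \<kappa> * M ^ p * L" "\<forall>z. relu_net L ps b z = V * (uu z - vv z) + - F'"
    using relu_net_params_exist[OF uv(1) _ _ V', of N] L2 unfolding ps_def w_def by auto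
  have bF: "\<forall>z. \<bar>relu_net L ps b z\<bar> \<le> F'" using uv(2) b(4) by simp
  have rate: "\<bar>relu_net L ps b (xs i) - f0 (xs i)\<bar> \<le> C1 * (l powr (2 * \<alpha>) * u powr (- \<alpha>))" if i: "i < n" for i
  proof -
    have la: "1 \<le> l powr (2 * \<alpha>)" using l1 assms(11) by (simp add: ge_one_powr_ge_zero)
    have ua: "1 / real n \<le> u powr (- \<alpha>)"
    proof -
      have "u powr (- \<alpha>) = real n powr (- (\<alpha> / D))" unfolding u_def D(3) by (simp add: powr_powr)
      moreover have "\<alpha> / D \<le> 1" unfolding D_def using assms(10,11) by (simp add: divide_le_eq)
      then have "real n powr (- 1) \<le> real n powr (- (\<alpha> / D))" using n1 by (intro powr_mono) auto
      ultimately show ?thesis using n0 by (simp add: powr_minus_divide)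
    qed
    have q: "1 / real n \<le> l powr (2 * \<alpha>) * u powr (- \<alpha>)"
      using mult_mono[OF la ua] by simp
    have "1 / (4::real) ^ a \<le> 1 / real n"
    proof -
      have "n * 1 \<le> (n + 1) * M" using M(1) by (intro mult_mono) auto
      then have "n \<le> 2 ^ a" using a(1) by linarith
      also have "(2::nat) ^ a \<le> 4 ^ a" by (intro power_mono) auto
      finally have "real n \<le> 4 ^ a" by (metis of_nat_le_iff of_nat_power of_nat_numeral)
      then show ?thesis using n0 by (intro divide_left_mono) auto
    qed
    moreover have "(1 / real M) powr \<alpha> \<le> 2 powr \<alpha> * (l powr (2 * \<alpha>) * u powr (- \<alpha>))"
    proof -
      have "1 / real M \<le> 1 / (u / (2 * l\<^sup>2))" using M u0 l1 by (intro divide_left_mono) auto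
      then have "(1 / real M) powr \<alpha> \<le> (2 * (l\<^sup>2 * (1 / u))) powr \<alpha>" using assms(11) by (intro powr_mono2) auto
      also have "\<dots> = 2 powr \<alpha> * ((l\<^sup>2) powr \<alpha> * (1 / u) powr \<alpha>)" using u0 by (simp only: powr_mult)
      also have "(l\<^sup>2) powr \<alpha> = l powr (2 * \<alpha>)" using powr_powr[of l 2 \<alpha>] l1 by simp
      also have "(1 / u) powr \<alpha> = u powr (- \<alpha>)" using u0 by (simp add: powr_divide powr_minus_divide)
      finally show ?thesis .
    qed
    moreover have "F - F' \<le> 1 / real n"
      unfolding F'_def \<tau>_def using n1 by (simp add: power2_eq_square divide_simps)
    ultimately have "real \<kappa> * (1 / 4 ^ a + (1 / real M) powr \<alpha>) + (F - F')
        \<le> real \<kappa> * (l powr (2 * \<alpha>) * u powr (- \<alpha>) + 2 powr \<alpha> * (l powr (2 * \<alpha>) * u powr (- \<alpha>))) + l powr (2 * \<alpha>) * u powr (- \<alpha>)"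
      using q by (intro add_mono mult_left_mono) auto
    also have "\<dots> = C1 * (l powr (2 * \<alpha>) * u powr (- \<alpha>))" unfolding C1_def by (simp add: algebra_simps)
    finally show ?thesis using uv(3) i b(4) by force
  qed
  have nu: "real n * (u powr (- \<alpha>))\<^sup>2 = X"
  proof -
    have "(u powr (- \<alpha>))\<^sup>2 = real n powr (- (2 * \<alpha> / D))" unfolding u_def D(3)
      by (simp add: powr_powr power2_eq_square powr_add[symmetric])
    then have "real n * (u powr (- \<alpha>))\<^sup>2 = real n powr (1 + (- (2 * \<alpha> / D)))"
      using n0 by (subst powr_add) simp
    also have "1 + (- (2 * \<alpha> / D)) = real p / D" using D(2) unfolding D_def by (simp add: field_simps)
    finally show ?thesis unfolding X_def D(3) .
  qed
  have bE: "(\<Sum>i<n. (relu_net L ps b (xs i) - f0 (xs i))\<^sup>2) \<le> E"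
  proof -
    have "(\<Sum>i<n. (relu_net L ps b (xs i) - f0 (xs i))\<^sup>2) \<le> (\<Sum>i<n. (C1 * (l powr (2 * \<alpha>) * u powr (- \<alpha>)))\<^sup>2)"
      by (intro sum_mono abs_le_square_iff[THEN iffD1] order_trans[OF rate abs_ge_self]) simp
    also have "\<dots> = C1\<^sup>2 * (l powr (2 * \<alpha>))\<^sup>2 * (real n * (u powr (- \<alpha>))\<^sup>2)" by (simp add: power_mult_distrib)
    also have "(l powr (2 * \<alpha>))\<^sup>2 = l powr (4 * \<alpha>)" by (simp add: power2_eq_square powr_add[symmetric])
    finally have "(\<Sum>i<n. (relu_net L ps b (xs i) - f0 (xs i))\<^sup>2) \<le> C1\<^sup>2 * l powr (4 * \<alpha>) * X" unfolding nu .
    also have "\<dots> \<le> l powr (4 * \<alpha> + 4) * X" using err X0 by (intro mult_right_mono) auto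
    finally show ?thesis unfolding E_def by (simp add: mult.commute)
  qed
  have cost': "\<kappa> * M ^ p * L + tp \<le> s"
  proof -
    have "real (\<kappa> * M ^ p * L) = real \<kappa> * real (M ^ p) * real L" by simp
    also have "\<dots> \<le> real \<kappa> * (X / l\<^sup>2) * (CL * l)" using Mp L(2) X0 by (intro mult_mono) auto
    finally have "real (\<kappa> * M ^ p * L + tp) \<le> real s" unfolding tp using cost wreal(1) s(1) by simp
    then show ?thesis by (simp only: of_nat_le_iff)
  qed
  \<comment> \<open>The tail exp(-n^4/2) has to beat exp(n^3/2) and the denominator exp(-(3E + 2))
    with E \<le> n^2; a sieve of radius n would not do.\<close>
  define R where "R = (real n)\<^sup>2"
  have R1: "1 \<le> R" unfolding R_def using n1 by simp
  \<comment> \<open>Since L + 1 \<le> n and (12pN + 1)(R + 1) \<le> n^4, the output moves by at most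
    n^(4L+5) \<eta>, which is then \<tau> = n^-2.\<close>
  define \<eta> where "\<eta> = 1 / real n ^ (4 * L + 7)"
  have \<eta>: "0 < \<eta>" "\<eta> \<le> 1" unfolding \<eta>_def using n0 n1 by (auto simp: divide_le_eq one_le_power)
  define H where "H = n ^ (4 * L + 9) + 1"
  have H: "R / \<eta> + 1 \<le> real H" unfolding R_def \<eta>_def H_def by (simp add: power_add[symmetric] add.commute)
  have lip: "real (Suc L) * \<eta> * ((real (12 * p * N) + 1) * (R + 1)) ^ Suc L \<le> \<tau>"
  proof -
    have "(real (12 * p * N) + 1) * (R + 1) \<le> real n * (real n ^ 3)"
    proof (intro mult_mono)
      show "real (12 * p * N) + 1 \<le> real n" using tpn unfolding tp w_def by simp
      have "R + 1 \<le> 2 * (real n)\<^sup>2" using R1 unfolding R_def by simp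
      also have "\<dots> \<le> real n * (real n)\<^sup>2" using n3 by (intro mult_right_mono) auto
      finally show "R + 1 \<le> real n ^ 3" by (simp add: power3_eq_cube power2_eq_square)
    qed (use R1 in auto)
    also have "\<dots> = real n ^ 4" by (simp add: numeral_eq_Suc)
    finally have "((real (12 * p * N) + 1) * (R + 1)) ^ Suc L \<le> (real n ^ 4) ^ Suc L"
      using R1 by (intro power_mono) auto
    then have "real (Suc L) * \<eta> * ((real (12 * p * N) + 1) * (R + 1)) ^ Suc L \<le> real n * \<eta> * (real n ^ 4) ^ Suc L"
      using LnN \<eta>(1) R1 by (intro mult_mono) auto
    also have "\<dots> = real n ^ (4 * L + 5) / real n ^ (4 * L + 7)"
    proof -
      have "real n * (real n ^ 4) ^ Suc L = real n ^ Suc (4 * Suc L)"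
        by (simp only: power_Suc[of "real n" "4 * Suc L"] power_mult)
      moreover have "Suc (4 * Suc L) = 4 * L + 5" by simp
      ultimately show ?thesis unfolding \<eta>_def by (simp only: times_divide_eq_left times_divide_eq_right mult_1_right)
    qed
    also have "real n ^ (4 * L + 7) = real n ^ (4 * L + 5) * (real n)\<^sup>2" by (simp add: power_add[symmetric] add.commute)
    also have "real n ^ (4 * L + 5) / (real n ^ (4 * L + 5) * (real n)\<^sup>2) = \<tau>" unfolding \<tau>_def using n0 by simp
    finally show ?thesis .
  qed
  have k0: "0 < k0" unfolding k0_def by (simp add: normal_density_pos)
  have T1: "1 \<le> real T" unfolding T_def ps_def n_params_eq top_size_def by simp
  have nexp: "real n = exp l" unfolding l_def using n0 by simp
  have ent': "real s * ((4 * real L + 13) * l) \<le> E"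
  proof -
    have "real s * ((4 * real L + 13) * l) \<le> Cs * X * ((4 * (CL * l) + 13) * l)"
      using s(2) L(2) l1 by (intro mult_mono) auto
    also have "\<dots> = X * (Cs * ((4 * (CL * l) + 13) * l))" by simp
    also have "\<dots> \<le> E" unfolding E_def using ent X0 by (intro mult_left_mono) auto
    finally show ?thesis .
  qed
  \<comment> \<open>Used twice: for the reciprocal T / (k0 \<eta>) of a prior factor, and for the T
    (2H + 1) possible pairs in the code of a net point.\<close>
  have pow_s: "y ^ s \<le> exp E" if "0 \<le> y" "y \<le> real n ^ (4 * L + 13)" for y
  proof -
    have "y ^ s \<le> (real n ^ (4 * L + 13)) ^ s" using that by (intro power_mono)
    also have "\<dots> = exp (real s * ((4 * real L + 13) * l))"
      unfolding nexp by (simp add: exp_of_nat_mult[symmetric] mult_ac)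
    also have "\<dots> \<le> exp E" using ent' by simp
    finally show ?thesis .
  qed
  have box: "exp (- E) \<le> (k0 * \<eta> / real T) ^ s"
  proof -
    have "real T / (k0 * \<eta>) = (1 / k0) * real T * real n ^ (4 * L + 7)" unfolding \<eta>_def by simp
    also have "\<dots> \<le> real n * real n ^ 3 * real n ^ (4 * L + 7)"
      using k0n Tn k0 by (intro mult_right_mono mult_mono) auto
    also have "\<dots> = real n ^ (4 * L + 11)" by (simp add: power_add numeral_eq_Suc)
    also have "\<dots> \<le> real n ^ (4 * L + 13)" using n1 by (intro power_increasing) auto
    finally have "(real T / (k0 * \<eta>)) ^ s \<le> exp E" using k0 \<eta>(1) by (intro pow_s) auto
    then have "inverse (exp E) \<le> inverse ((real T / (k0 * \<eta>)) ^ s)"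
      using k0 \<eta>(1) T1 by (intro le_imp_inverse_le) auto
    then show ?thesis by (simp add: exp_minus power_inverse[symmetric] inverse_divide)
  qed
  have net: "real (T * (2 * H + 1)) ^ s \<le> exp E"
  proof (rule pow_s)
    have "real (2 * H + 1) \<le> real n ^ (4 * L + 10)"
    proof -
      have n9: "3 \<le> real n ^ (4 * L + 9)"
        using n3 self_le_power[OF n1, of "4 * L + 9"] by linarith
      have "real (2 * H + 1) = 2 * real n ^ (4 * L + 9) + 3" by (simp add: H_def)
      also have "\<dots> \<le> 3 * real n ^ (4 * L + 9)" using n9 by simp
      also have "\<dots> \<le> real n * real n ^ (4 * L + 9)" using n3 by (intro mult_right_mono) auto
      finally show ?thesis by (simp add: power_add numeral_eq_Suc)
    qed
    with Tn have "real T * real (2 * H + 1) \<le> real n ^ 3 * real n ^ (4 * L + 10)" by (intro mult_mono) auto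
    also have "\<dots> = real n ^ (4 * L + 13)" by (simp add: power_add[symmetric] add.commute)
    finally show "real (T * (2 * H + 1)) \<le> real n ^ (4 * L + 13)" by (simp only: of_nat_mult)
  qed simp
  define A where "A = {f \<in> nn_class F p L ps s. emp_norm n xs (\<lambda>z. f z - f0 z) >
           Mn * (real n powr (- \<alpha> / (2 * \<alpha> + real p)) * l powr (2 * \<alpha> + 2))}"
  \<comment> \<open>The separation level is 100 E: 3/8 of it outweighs the 3 E lost to prior mass
    and likelihood in the denominator, and 1/32 of it outweighs the net entropy E plus 2 l. From
    \<open>20 \<le> Mn\<close> the sum is at least 400 E.\<close>
  have Aprop: "2 * (100 * E) + 2 \<le> (\<Sum>i<n. (f (xs i) - f0 (xs i))\<^sup>2)" if f: "f \<in> A" for f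
  proof -
    define \<epsilon> where "\<epsilon> = real n powr (- \<alpha> / (2 * \<alpha> + real p)) * l powr (2 * \<alpha> + 2)"
    have "real n powr (- \<alpha> / (2 * \<alpha> + real p)) = u powr (- \<alpha>)" unfolding u_def by (simp add: powr_powr)
    then have "real n * \<epsilon>\<^sup>2 = real n * (u powr (- \<alpha>))\<^sup>2 * (l powr (2 * \<alpha> + 2))\<^sup>2"
      unfolding \<epsilon>_def by (simp add: power_mult_distrib)
    also have "(l powr (2 * \<alpha> + 2))\<^sup>2 = l powr (4 * \<alpha> + 4)" by (simp add: power2_eq_square powr_add[symmetric])
    finally have n\<epsilon>: "real n * \<epsilon>\<^sup>2 = E" unfolding nu E_def .
    have \<epsilon>0: "0 \<le> \<epsilon>" unfolding \<epsilon>_def by simp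
    define S where "S = (\<Sum>i<n. (f (xs i) - f0 (xs i))\<^sup>2)"
    have S0: "0 \<le> S" unfolding S_def by (intro sum_nonneg) auto
    have "Mn * \<epsilon> < sqrt (1 / real n * S)" using f unfolding A_def emp_norm_def \<epsilon>_def S_def by simp
    moreover have "20 * \<epsilon> \<le> Mn * \<epsilon>" using Mn \<epsilon>0 by (intro mult_right_mono)
    ultimately have "20 * \<epsilon> \<le> sqrt (1 / real n * S)" by linarith
    then have "(20 * \<epsilon>)\<^sup>2 \<le> (sqrt (1 / real n * S))\<^sup>2" using \<epsilon>0 by (intro power_mono) auto
    then have "400 * \<epsilon>\<^sup>2 \<le> S / real n" using S0 by (simp add: power_mult_distrib)
    then have "400 * (real n * \<epsilon>\<^sup>2) \<le> S" using n0 by (simp add: field_simps)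
    then show ?thesis unfolding n\<epsilon> S_def using E1 by linarith
  qed
  have bound: "(exp (3 - 3 / 8 * (100 * E)) + exp (real n ^ 3 / 2) * (real tp * (2 * exp (- R\<^sup>2 / 2)))) /
       ((k0 * \<eta> / real T) ^ s * exp (- (2 * E + 2))) \<le> e"
  proof -
    have "exp (- (3 * E + 2)) = exp (- E) * exp (- (2 * E + 2))" by (simp add: exp_add[symmetric])
    also have "\<dots> \<le> (k0 * \<eta> / real T) ^ s * exp (- (2 * E + 2))" using box by (intro mult_right_mono) auto
    finally have den: "exp (- (3 * E + 2)) \<le> (k0 * \<eta> / real T) ^ s * exp (- (2 * E + 2))" .
    have "(exp (3 - 3 / 8 * (100 * E)) + exp (real n ^ 3 / 2) * (real tp * (2 * exp (- R\<^sup>2 / 2)))) /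
       ((k0 * \<eta> / real T) ^ s * exp (- (2 * E + 2)))
      \<le> (exp (3 - 3 / 8 * (100 * E)) + exp (real n ^ 3 / 2) * (real tp * (2 * exp (- R\<^sup>2 / 2)))) / exp (- (3 * E + 2))"
      using den order_less_le_trans[OF exp_gt_zero den]
      by (intro divide_left_mono) (auto intro!: add_nonneg_nonneg mult_nonneg_nonneg)
    also have "\<dots> = exp (3 - 3 / 8 * (100 * E)) / exp (- (3 * E + 2)) + exp (real n ^ 3 / 2) * (real tp * (2 * exp (- R\<^sup>2 / 2))) / exp (- (3 * E + 2))"
      by (rule add_divide_distrib)
    also have "exp (3 - 3 / 8 * (100 * E)) / exp (- (3 * E + 2)) \<le> exp (5 - 34 * l)"
      using El E1 l1 by (simp add: exp_diff[symmetric])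
    also have "exp (real n ^ 3 / 2) * (real tp * (2 * exp (- R\<^sup>2 / 2))) / exp (- (3 * E + 2))
       \<le> exp (real n ^ 3 / 2) * (real n * (2 * exp (- ((real n)\<^sup>2)\<^sup>2 / 2))) / exp (- (3 * (real n)\<^sup>2 + 2))"
      unfolding R_def using tpn En by (intro frac_le mult_left_mono mult_right_mono) auto
    finally show ?thesis using tail small by linarith
  qed
  have "measure (data_law f0 xs n) {Y \<in> space (data_law f0 xs n).
       e < posterior (ss_prior ps L s) (relu_net L ps) (nn_class F p L ps s) (lik n xs Y) A}
     \<le> 2 * real n * exp (- (real n)\<^sup>2 / 2) + exp (- E / 2) + real (n_params ps L * (2 * H + 1)) ^ s * exp (- (100 * E) / 32)"
  proof (rule finite_sample_bound[where p = p and L = L and N = N and b = b and F' = F' and V = V' and R = R and \<eta> = \<eta> and \<tau> = \<tau>, folded ps_def])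
    show "(real n)\<^sup>2 * \<tau> \<le> 1" unfolding \<tau>_def using n0 by simp
    have "real n * \<tau>\<^sup>2 = 1 / real n ^ 3" unfolding \<tau>_def using n0 by (simp add: field_simps numeral_eq_Suc)
    then show "real n * \<tau>\<^sup>2 \<le> 1" using n1 by (simp add: one_le_power divide_le_eq)
    show "(exp (3 - 3 / 8 * (100 * E)) + exp (real n ^ 3 / 2) * (real (top_size ps L) * (2 * exp (- R\<^sup>2 / 2)))) /
       ((min (1 / 2) (2 * std_normal_density (V' + 1)) * \<eta> / real (n_params ps L)) ^ s * exp (- (2 * E + 2))) \<le> e"
      using bound unfolding tp_def T_def k0_def .
  qed (use assms(10) N1 L2 xs cost' sT' b(1-3) bF bE R1 Vn \<eta> lip H Aprop in \<open>auto simp: T_def tp_def F'_def R_def\<close>)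
  also have "real (n_params ps L * (2 * H + 1)) ^ s * exp (- (100 * E) / 32) \<le> exp E * exp (- (100 * E) / 32)"
    using net unfolding T_def by (intro mult_right_mono) auto
  also have "\<dots> \<le> exp (- 2 * l)" using El E1 l1 by (simp add: exp_add[symmetric])
  also have "exp (- E / 2) \<le> exp (- l / 2)" using El by simp
  finally show ?thesis unfolding A_def by simp
qed

text \<open>Exponents and constants are abstracted to variables of known sign, a form open to
  automatic asymptotics. The first seventeen claims follow the order of the side conditions of
  \<open>contraction_at_sample_size\<close>; the last is the limit of its bound.\<close>

lemma tuning_eventually:
  fixes r c \<alpha> CN CL Cs e k0 K F V q :: real
  assumes "0 < r" "r < 1" "0 < c" "0 < \<alpha>" "0 < CN" "0 < CL" "0 < Cs" "0 < e" "0 < k0" "0 < K" "0 < F" "0 < q"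
  shows
    "eventually (\<lambda>n::nat. 1 \<le> ln (real n)) sequentially"
    "eventually (\<lambda>n::nat. K * (real n powr r / (ln (real n))\<^sup>2) \<le> CN * (real n powr r / ln (real n) - 1) - 1) sequentially"
    "eventually (\<lambda>n::nat. K * (real n powr r / (ln (real n))\<^sup>2) * (CL * ln (real n)) + q * (CN * (real n powr r / ln (real n))) + 1 \<le> real n powr r) sequentially"
    "eventually (\<lambda>n::nat. Cs * real n powr r \<le> (CN * (real n powr r / ln (real n) - 1) - 1)\<^sup>2) sequentially"
    "eventually (\<lambda>n::nat. q * (CN * (real n powr r / ln (real n))) + 1 \<le> real n) sequentially"
    "eventually (\<lambda>n::nat. CL * ln (real n) + 1 \<le> real n) sequentially"
    "eventually (\<lambda>n::nat. Cs * ((4 * (CL * ln (real n)) + 13) * ln (real n)) \<le> ln (real n) powr (4 * \<alpha> + 4)) sequentially"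
    "eventually (\<lambda>n::nat. V\<^sup>2 * ln (real n) powr (4 * \<alpha>) \<le> ln (real n) powr (4 * \<alpha> + 4)) sequentially"
    "eventually (\<lambda>n::nat. real n powr r * ln (real n) powr (4 * \<alpha> + 4) \<le> (real n)\<^sup>2) sequentially"
    "eventually (\<lambda>n::nat. ln (real n) \<le> real n powr r * ln (real n) powr (4 * \<alpha> + 4)) sequentially"
    "eventually (\<lambda>n::nat. exp (real n ^ 3 / 2) * (real n * (2 * exp (- ((real n)\<^sup>2)\<^sup>2 / 2))) / exp (- (3 * (real n)\<^sup>2 + 2)) \<le> e / 2) sequentially"
    "eventually (\<lambda>n::nat. exp (5 - 34 * ln (real n)) \<le> e / 2) sequentially"
    "eventually (\<lambda>n::nat. 1 \<le> real n powr c / (ln (real n))\<^sup>2) sequentially"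
    "eventually (\<lambda>n::nat. 1 / (real n)\<^sup>2 \<le> F) sequentially"
    "eventually (\<lambda>n::nat. V \<le> (real n)\<^sup>2) sequentially"
    "eventually (\<lambda>n::nat. 1 / k0 \<le> real n) sequentially"
    "eventually (\<lambda>n::nat. 2 * (2 * (3 / 2 * ln (real n + 1)) + 1) + 1 \<le> 9 * ln (real n)) sequentially"
    "(\<lambda>n::nat. 2 * real n * exp (- (real n)\<^sup>2 / 2) + exp (- ln (real n) / 2) + exp (- 2 * ln (real n))) \<longlonglongrightarrow> 0"
  using assms by real_asymp+

theorem mainTheorem5:
  fixes p :: nat and \<alpha> F CN :: real and f0 :: fn
    and x :: "nat \<Rightarrow> nat \<Rightarrow> nat \<Rightarrow> real"
  assumes "p \<ge> 1" and "0 < \<alpha>" and "\<alpha> < real p" and "F > 0" and "CN > 0"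
    and "holder_smooth p \<alpha> f0" and "\<forall>z\<in>cube p. \<bar>f0 z\<bar> \<le> F"
    and "\<forall>n. \<forall>i<n. x n i \<in> cube p"
  shows "\<exists>cL cs. cL > 0 \<and> cs > 0 \<and>
    (\<forall>L s :: nat \<Rightarrow> nat.
      (\<exists>CL. eventually (\<lambda>n. cL * ln (real n) \<le> real (L n) \<and> real (L n) \<le> CL * ln (real n)) sequentially)
      \<and> (\<exists>Cs. eventually (\<lambda>n. cs * real n powr (real p / (2 * \<alpha> + real p)) \<le> real (s n)
                 \<and> real (s n) \<le> Cs * real n powr (real p / (2 * \<alpha> + real p))) sequentially)
      \<longrightarrow>
      (let N = (\<lambda>n. nat \<lfloor>CN * real_of_int \<lfloor>real n powr (real p / (2 * \<alpha> + real p)) / ln (real n)\<rfloor>\<rfloor>);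
           ps = (\<lambda>n. arch_widths p (L n) (N n))
       in \<exists>\<delta>>1. \<forall>M :: nat \<Rightarrow> real. filterlim M at_top sequentially \<longrightarrow>
          (\<forall>e>0. (\<lambda>n. measure (data_law f0 (x n) n)
              {Y \<in> space (data_law f0 (x n) n).
                 posterior (ss_prior (ps n) (L n) (s n)) (relu_net (L n) (ps n))
                   (nn_class F p (L n) (ps n) (s n)) (lik n (x n) Y)
                   {f \<in> nn_class F p (L n) (ps n) (s n).
                      emp_norm n (x n) (\<lambda>z. f z - f0 z)
                        > M n * (real n powr (- \<alpha> / (2 * \<alpha> + real p)) * ln (real n) powr \<delta>)}
                 > e}) \<longlonglongrightarrow> 0)))"
proof -
  obtain \<kappa> :: nat and V where \<kappa>: "\<kappa> \<ge> 1" and V: "V \<ge> 0"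
    and apx: "\<And>n M k a d w pts F'. (\<forall>i<n. pts i \<in> cube p) \<Longrightarrow> M \<ge> 1 \<Longrightarrow> (n + 1) * M \<le> 2 ^ a \<Longrightarrow>
     0 \<le> F' \<Longrightarrow> F' \<le> F \<Longrightarrow> \<kappa> * (k + a + 1) \<le> d \<Longrightarrow> \<kappa> * M ^ p \<le> w \<Longrightarrow>
     (\<exists>u v. relu_layers p w d (\<kappa> * M ^ p * d) [u, v] \<and> (\<forall>z. \<bar>V * (u z - v z) - F'\<bar> \<le> F') \<and>
       (\<forall>i<n. \<bar>V * (u (pts i) - v (pts i)) - F' - f0 (pts i)\<bar>
          \<le> real \<kappa> * (1 / 4 ^ k + (1 / real M) powr \<alpha>) + (F - F')))"
    using holder_relu_approximation[OF assms(1,2,6,4,7)] by blast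
  define r where "r = real p / (2 * \<alpha> + real p)"
  have r: "0 < r" "r < 1" "0 < 1 / (2 * \<alpha> + real p)"
    using assms(1,2) unfolding r_def by (auto simp: divide_less_eq add_pos_pos)
  show ?thesis
    unfolding Let_def
  \<comment> \<open>The depth needs the constant 9 \<kappa> from the approximation. For the sparsity
    1 is enough, because the approximant uses only O(X / l) parameters.\<close>
  proof (rule exI[of _ "9 * real \<kappa>"], rule exI[of _ "1::real"], intro conjI allI impI, goal_cases)
    case 1
    then show ?case using \<kappa> by simp
  next
    case 2
    then show ?case by simp
  next
    case (3 L s)
    show ?case
    \<comment> \<open>Half of the exponent of l in \<open>E\<close>; it depends on \<alpha> alone
      and is thus fixed before \<open>M\<close>.\<close>
    proof (rule exI[of _ "2 * \<alpha> + 2"], intro conjI allI impI, goal_cases)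
      case 1
      then show ?case using assms(2) by simp
    next
      case (2 M e)
      note M = 2(1) and e = 2(2)
      from 3 obtain CL' where L: "eventually (\<lambda>n. 9 * real \<kappa> * ln (real n) \<le> real (L n) \<and> real (L n) \<le> CL' * ln (real n)) sequentially"
        by blast
      from 3 obtain Cs' where s: "eventually (\<lambda>n. 1 * real n powr r \<le> real (s n) \<and> real (s n) \<le> Cs' * real n powr r) sequentially"
        unfolding r_def by blast
      \<comment> \<open>The given upper constants come without a sign; enlarging them makes them
        positive and keeps the upper bounds.\<close>
      define CL where "CL = \<bar>CL'\<bar> + 1"
      define Cs where "Cs = \<bar>Cs'\<bar> + 1"
      have C: "0 < CL" "CL' \<le> CL" "0 < Cs" "Cs' \<le> Cs" unfolding CL_def Cs_def by auto
      define V' where "V' = V + F + 1"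
      define k0 where "k0 = min (1 / 2) (2 * std_normal_density (V' + 1))"
      have k0: "0 < k0" unfolding k0_def by (simp add: normal_density_pos)
      define C1 where "C1 = real \<kappa> * (1 + 2 powr \<alpha>) + 1"
      have \<kappa>0: "0 < real \<kappa>" "0 < 12 * real p" using \<kappa> assms(1) by auto
      note ev = tuning_eventually[OF r assms(2,5) C(1,3) e k0 \<kappa>0(1) assms(4) \<kappa>0(2)]
      have Mn: "eventually (\<lambda>n. 20 \<le> M n) sequentially" using M by (simp add: filterlim_at_top)
      show ?case
      proof (rule tendsto_sandwich[OF _ _ tendsto_const ev(18)], goal_cases)
        case 1
        then show ?case by simp
      next
        case 2
        show ?case
          using L s Mn ev(1) ev(2) ev(3) ev(4) ev(5) ev(6) ev(7)
            ev(8)[of C1] ev(9) ev(10) ev(11) ev(12) ev(13) ev(14) ev(15)[of V'] ev(16) ev(17)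
        proof eventually_elim
          case (elim n)
          have L': "real (L n) \<le> CL * ln (real n)"
            using elim(1,4) C(2) mult_right_mono[of CL' CL "ln (real n)"] by linarith
          have s': "real (s n) \<le> Cs * real n powr r"
            using elim(2) C(4) mult_right_mono[of Cs' Cs "real n powr r"] by fastforce
          have s'': "real n powr r \<le> real (s n)" using elim(2) by simp
          show ?case
            by (rule contraction_at_sample_size[where \<kappa> = \<kappa> and CL = CL and Cs = Cs and V = V and CN = CN])
               (fact assms C e \<kappa> V elim(1)[THEN conjunct1] L' s'[unfolded r_def] s''[unfolded r_def]
                elim[unfolded r_def V'_def k0_def C1_def] | fact apx | use assms(8) elim(1) in simp)+
        qed
      qed
    qed
  qed
qed

end
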